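(* Let $\mathcal{Q}\subseteq\mathbb{R}^{n_q}$ with a measure $\nu$, and let $H(s,q)=\mathcal{C}(q)(s\mathcal{E}(q)-\mathcal{A}(q))^{-1}\mathcal{B}(q)$ be a full-order parametric transfer function with values in $\mathbb{C}^{n_{\rm o}\times n_{\rm i}}$, $H\in\mathcal{H}_2\otimes\mathcal{L}_2$. Let $\hat\alpha_i,\hat\beta_j,\hat\gamma_k:\mathcal{Q}\to\mathbb{R}$ ($1\le i\le n_A$, $1\le j\le n_B$, $1\le k\le n_C$) be measurable, let $\hat A_i\in\mathbb{C}^{r\times r}$ be diagonal, $\hat B_j\in\mathbb{C}^{r\times n_{\rm i}}$, $\hat C_k\in\mathbb{C}^{n_{\rm o}\times r}$, and set $\hat{\mathcal{A}}(q)=\sum_{i=1}^{n_A}\hat\alpha_i(q)\hat A_i$, $\hat{\mathcal{B}}(q)=\sum_{j=1}^{n_B}\hat\beta_j(q)\hat B_j$, $\hat{\mathcal{C}}(q)=\sum_{k=1}^{n_C}\hat\gamma_k(q)\hat C_k$, and $$\hat H(s,q)=\hat{\mathcal{C}}(q)\,(sI-\hat{\mathcal{A}}(q))^{-1}\,\hat{\mathcal{B}}(q).$$ Assume the standing integrability, boundedness and stability assumptions listed in the context. Suppose that $\hat H$ is an $\mathcal{H}_2\otimes\mathcal{L}_2$-optimal diagonal structured reduced-order model (D-StROM) for $H$. Let $\lambda_\ell(q)$ denote the $\ell$th diagonal entry of $\hat{\mathcal{A}}(q)$, and define $c_\ell(q)=\hat{\mathcal{C}}(q)e_\ell$ and $b_\ell(q)=\hat{\mathcal{B}}(q)^*e_\ell$.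 Then $$\hat H(s,q)=\sum_{\ell=1}^{r}\frac{c_\ell(q)\,b_\ell(q)^*}{s-\lambda_\ell(q)}$$ and $$\int_{\mathcal{Q}}\hat\gamma_k(q)\,H\bigl(-\overline{\lambda_\ell(q)},q\bigr)\,b_\ell(q)\,d\nu(q)=\int_{\mathcal{Q}}\hat\gamma_k(q)\,\hat H\bigl(-\overline{\lambda_\ell(q)},q\bigr)\,b_\ell(q)\,d\nu(q),$$ $$\int_{\mathcal{Q}}\hat\beta_j(q)\,c_\ell(q)^*\,H\bigl(-\overline{\lambda_\ell(q)},q\bigr)\,d\nu(q)=\int_{\mathcal{Q}}\hat\beta_j(q)\,c_\ell(q)^*\,\hat H\bigl(-\overline{\lambda_\ell(q)},q\bigr)\,d\nu(q),$$ $$\int_{\mathcal{Q}}\hat\alpha_i(q)\,c_\ell(q)^*\,\frac{\partial H}{\partial s}\bigl(-\overline{\lambda_\ell(q)},q\bigr)\,b_\ell(q)\,d\nu(q)=\int_{\mathcal{Q}}\hat\alpha_i(q)\,c_\ell(q)^*\,\frac{\partial\hat H}{\partial s}\bigl(-\overline{\lambda_\ell(q)},q\bigr)\,b_\ell(q)\,d\nu(q),$$ for all $\ell=1,\dots,r$, $k=1,\dots,n_C$, $j=1,\dots,n_B$, $i=1,\dots,n_A$.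
   Context: Notation: $e_\ell$ is the $\ell$th standard basis vector of $\mathbb{C}^r$; $^*$ is the conjugate transpose; $\overline{\,\cdot\,}$ is complex conjugation; $\boldsymbol{i}$ is the imaginary unit. $\mathcal{H}_2$ is the Hardy space of matrix-valued functions analytic in the open right half-plane, with norm $\|F\|_{\mathcal{H}_2}=\bigl(\frac{1}{2\pi}\int_{-\infty}^{\infty}\|F(\boldsymbol{i}\omega)\|_{\rm F}^2\,d\omega\bigr)^{1/2}$. The space $\mathcal{H}_2\otimes\mathcal{L}_2$ consists of (measurable) functions $H(s,q)$ with $H(\cdot,q)\in\mathcal{H}_2$ for $\nu$-a.e. $q$ and finite norm $$\|H\|_{\mathcal{H}_2\otimes\mathcal{L}_2}=\Bigl(\int_{\mathcal{Q}}\|H(\cdot,q)\|_{\mathcal{H}_2}^2\,d\nu(q)\Bigr)^{1/2}.$$ Optimality: with the order $r$ and the scalar functions $\hat\alpha_i,\hat\beta_j,\hat\gamma_k$ fixed, $\hat H$ is an $\mathcal{H}_2\otimes\mathcal{L}_2$-optimal D-StROM for $H$ if the tuple $(\hat A_i,\hat B_j,\hat C_k)$ is a (local) minimizer of $\|H-\hat H\|_{\mathcal{H}_2\otimes\mathcal{L}_2}$ over all diagonal $\hat A_i\in\mathbb{C}^{r\times r}$ and all $\hat B_j\in\mathbb{C}^{r\times n_{\rm i}}$, $\hat C_k\in\mathbb{C}^{n_{\rm o}\times r}$ (with $\hat{\mathcal{E}}(q)=I$ fixed). Standing assumptions: (i) $\displaystyle\int_{\mathcal{Q}}\frac{\bigl(\sum_{j}|\hat\beta_j(q)|\sum_{k}|\hat\gamma_k(q)|\bigr)^2}{\sum_{i}|\hat\alpha_i(q)|}\,d\nu(q)<\infty$;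 (ii) $\operatorname{ess\,sup}_{q\in\mathcal{Q}}\operatorname{ess\,sup}_{s\in\boldsymbol{i}\mathbb{R}}\|s(sI-\hat{\mathcal{A}}(q))^{-1}\|_2<\infty$ and $\operatorname{ess\,sup}_{q\in\mathcal{Q}}|\hat\alpha_i(q)|\operatorname{ess\,sup}_{s\in\boldsymbol{i}\mathbb{R}}\|(sI-\hat{\mathcal{A}}(q))^{-1}\|_2<\infty$ for $i=1,\dots,n_A$; (iii) for $\nu$-a.e. $q$, all $\lambda_\ell(q)$ lie in the open left half-plane (so that evaluation at $-\overline{\lambda_\ell(q)}$ is in the domain of analyticity of $H(\cdot,q)$ and $\hat H(\cdot,q)$). *)

theory Defs
  imports "HOL-Analysis.Analysis" "HOL-Probability.Essential_Supremum"
begin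

text \<open>
  Matrices with m rows and n columns have type \<open>complex^'n^'m\<close>. On this type \<open>norm\<close> is the
  Frobenius norm, and the induced 2-norm of \<open>M\<close> is \<open>onorm ((*v) M)\<close>. The matrix \<open>s I\<close> is \<open>mat s\<close>,
  so \<open>s M\<close> is \<open>mat s ** M\<close>.
\<close>

definition conj_transpose :: "complex^'n^'m \<Rightarrow> complex^'m^'n" where
  "conj_transpose M = (\<chi> i j. cnj (M $ j $ i))"

definition vcnj :: "complex^'n \<Rightarrow> complex^'n" where
  "vcnj v = (\<chi> i. cnj (v $ i))"

definition diagonal_matrix :: "complex^'n^'n \<Rightarrow> bool" where
  "diagonal_matrix M \<longleftrightarrow> (\<forall>i j. i \<noteq> j \<longrightarrow> M $ i $ j = 0)"

definition matrix_deriv :: "(complex \<Rightarrow> complex^'n^'m) \<Rightarrow> complex \<Rightarrow> complex^'n^'m" where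
  "matrix_deriv F z = (\<chi> i j. deriv (\<lambda>s. F s $ i $ j) z)"


text \<open>
  The Hardy space over the open right half-plane. A member carries its boundary values with it:
  on the imaginary axis it agrees almost everywhere with its horizontal limits from the right.
  Values in the open left half-plane are irrelevant.
\<close>

definition hardy2 :: "(complex \<Rightarrow> complex^'n^'m) set" where
  "hardy2 = {F.
     (\<forall>i j. (\<lambda>s. F s $ i $ j) holomorphic_on {s. 0 < Re s}) \<and>
     (\<exists>K::real. \<forall>x>0. (\<integral>\<^sup>+ \<omega>. ennreal ((norm (F (Complex x \<omega>)))\<^sup>2) \<partial>lebesgue) \<le> ennreal K) \<and>
     (AE \<omega> in lebesgue. ((\<lambda>x. F (Complex x \<omega>)) \<longlongrightarrow> F (\<i> * of_real \<omega>)) (at_right 0))}"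

definition hardy2_norm :: "(complex \<Rightarrow> complex^'n^'m) \<Rightarrow> real" where
  "hardy2_norm F =
     sqrt (1 / (2 * pi) * (\<integral> \<omega>. (norm (F (\<i> * of_real \<omega>)))\<^sup>2 \<partial>lebesgue))"

definition h2l2 :: "'q measure \<Rightarrow> (complex \<Rightarrow> 'q \<Rightarrow> complex^'n^'m) set" where
  "h2l2 \<nu> = {H.
     (\<lambda>(s, q). H s q) \<in> borel_measurable (restrict_space borel {s. 0 \<le> Re s} \<Otimes>\<^sub>M \<nu>) \<and>
     (AE q in \<nu>. (\<lambda>s. H s q) \<in> hardy2) \<and>
     integrable \<nu> (\<lambda>q. (hardy2_norm (\<lambda>s. H s q))\<^sup>2)}"

definition h2l2_norm :: "'q measure \<Rightarrow> (complex \<Rightarrow> 'q \<Rightarrow> complex^'n^'m) \<Rightarrow> real" where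
  "h2l2_norm \<nu> H = sqrt (\<integral> q. (hardy2_norm (\<lambda>s. H s q))\<^sup>2 \<partial>\<nu>)"


text \<open>
  \<open>H(s,q) = C(q) (s E(q) - A(q))\<^sup>-\<^sup>1 B(q)\<close>. Since \<open>matrix_inv\<close> is unspecified on singular matrices,
  \<open>H\<close> is only prescribed where the inverse exists; this is all but finitely many \<open>s\<close> because the
  pencil is required to be regular. In particular \<open>H(\<cdot>,q)\<close> may take the analytic continuation as
  its value at a removable singularity.
\<close>

definition is_transfer_function ::
  "'q set \<Rightarrow> ('q \<Rightarrow> complex^'n^'n) \<Rightarrow> ('q \<Rightarrow> complex^'n^'n) \<Rightarrow> ('q \<Rightarrow> complex^'i^'n) \<Rightarrow>
   ('q \<Rightarrow> complex^'n^'o) \<Rightarrow> (complex \<Rightarrow> 'q \<Rightarrow> complex^'i^'o) \<Rightarrow> bool" where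
  "is_transfer_function Q E A B C H \<longleftrightarrow>
     (\<forall>q\<in>Q. (\<exists>s. invertible (mat s ** E q - A q)) \<and>
        (\<forall>s. invertible (mat s ** E q - A q) \<longrightarrow>
           H s q = C q ** matrix_inv (mat s ** E q - A q) ** B q))"

definition param_sum :: "('k::finite \<Rightarrow> 'q \<Rightarrow> real) \<Rightarrow> (complex^'n^'m)^'k \<Rightarrow> 'q \<Rightarrow> complex^'n^'m" where
  "param_sum \<phi> M q = (\<Sum>k\<in>UNIV. \<phi> k q *\<^sub>R M $ k)"

type_synonym ('a, 'b, 'c, 'r, 'i, 'o) rom_params =
  "((complex^'r^'r)^'a) \<times> ((complex^'i^'r)^'b) \<times> ((complex^'r^'o)^'c)"

definition rom ::
  "('a::finite \<Rightarrow> 'q \<Rightarrow> real) \<Rightarrow> ('b::finite \<Rightarrow> 'q \<Rightarrow> real) \<Rightarrow> ('c::finite \<Rightarrow> 'q \<Rightarrow> real) \<Rightarrow>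
   ('a, 'b, 'c, 'r::finite, 'i::finite, 'o::finite) rom_params \<Rightarrow> complex \<Rightarrow> 'q \<Rightarrow> complex^'i^'o" where
  "rom \<alpha> \<beta> \<gamma> = (\<lambda>(A, B, C) s q.
     param_sum \<gamma> C q ** matrix_inv (mat s - param_sum \<alpha> A q) ** param_sum \<beta> B q)"

definition diagonal_params ::
  "('a::finite, 'b::finite, 'c::finite, 'r::finite, 'i::finite, 'o::finite) rom_params set" where
  "diagonal_params = {(A, B, C). \<forall>k. diagonal_matrix (A $ k)}"

text \<open>
  Local minimality of the error norm over all parameters with diagonal \<open>A\<close>-part. The norm of an
  error outside \<open>h2l2\<close> counts as infinite, so such competitors impose no condition.
\<close>

definition optimal_dstrom ::
  "'q measure \<Rightarrow> ('a::finite \<Rightarrow> 'q \<Rightarrow> real) \<Rightarrow> ('b::finite \<Rightarrow> 'q \<Rightarrow> real) \<Rightarrow> ('c::finite \<Rightarrow> 'q \<Rightarrow> real) \<Rightarrow>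
   (complex \<Rightarrow> 'q \<Rightarrow> complex^'i^'o) \<Rightarrow>
   ('a, 'b, 'c, 'r::finite, 'i::finite, 'o::finite) rom_params \<Rightarrow> bool" where
  "optimal_dstrom \<nu> \<alpha> \<beta> \<gamma> H X \<longleftrightarrow>
     X \<in> diagonal_params \<and>
     (\<lambda>s q. H s q - rom \<alpha> \<beta> \<gamma> X s q) \<in> h2l2 \<nu> \<and>
     (\<forall>\<^sub>F Y in at X within diagonal_params.
        (\<lambda>s q. H s q - rom \<alpha> \<beta> \<gamma> Y s q) \<in> h2l2 \<nu> \<longrightarrow>
        h2l2_norm \<nu> (\<lambda>s q. H s q - rom \<alpha> \<beta> \<gamma> X s q) \<le>
        h2l2_norm \<nu> (\<lambda>s q. H s q - rom \<alpha> \<beta> \<gamma> Y s q))"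

text \<open>
  Equality of two convergent integrals. The integrands below contain point evaluations and
  derivatives that are only defined almost everywhere, so the integrals are taken with respect to
  the completion; for \<open>\<nu>\<close>-measurable integrands this is the integral with respect to \<open>\<nu>\<close>.
  Integrability is explicit because the library integral of a non-integrable function is \<open>0\<close>.
\<close>

definition integrals_agree ::
  "'q measure \<Rightarrow> ('q \<Rightarrow> 'v::{banach, second_countable_topology}) \<Rightarrow> ('q \<Rightarrow> 'v) \<Rightarrow> bool" where
  "integrals_agree \<nu> f g \<longleftrightarrow>
     integrable (completion \<nu>) f \<and> integrable (completion \<nu>) g \<and>
     (\<integral> q. f q \<partial>completion \<nu>) = (\<integral> q. g q \<partial>completion \<nu>)"

end

theory Submission
  imports Defs "HOL-Complex_Analysis.Cauchy_Integral_Formula"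
begin

text \<open>
  Up to the factor \<open>2 * pi\<close>, the squared error of a model is the squared \<open>L\<^sup>2\<close> norm of the boundary values
  of \<open>H - Hhat\<close> on the product of the parameter set with the imaginary axis. Optimality is thus a
  least-squares condition: if a parameter is changed by \<open>t\<close> times a fixed direction and the model changes
  by \<open>t *\<^sub>R Gt t\<close> with \<open>Gt t\<close> tending to \<open>G\<close>, then the error is orthogonal to \<open>G\<close>
  (\<open>first_variation_vanishes\<close>).

  Since the \<open>A\<close>-coefficients are diagonal, the model is a sum of terms \<open>c\<^sub>l b\<^sub>l\<^sup>* / (s - \<lambda>\<^sub>l)\<close>, and
  it suffices to use directions that act on one term only. Changing an entry of an output
  coefficient \<open>C\<^sub>k\<close> gives \<open>G = \<gamma>\<^sub>k e b\<^sub>l\<^sup>* / (s - \<lambda>\<^sub>l)\<close> with a unit vector \<open>e\<close>, changing an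
  entry of an input coefficient \<open>B\<^sub>j\<close> gives \<open>G = \<beta>\<^sub>j c\<^sub>l e\<^sup>* / (s - \<lambda>\<^sub>l)\<close>, and changing a diagonal
  entry of \<open>A\<^sub>i\<close> moves the pole and gives \<open>G = \<alpha>\<^sub>i c\<^sub>l b\<^sub>l\<^sup>* / (s - \<lambda>\<^sub>l)\<^sup>2\<close>.

  On the imaginary axis the conjugate of \<open>1 / (s - \<lambda>)\<close> is \<open>1 / (\<mu> - s)\<close> with \<open>\<mu> = - cnj \<lambda>\<close>. Cauchy's
  formula for Hardy functions, \<open>Cauchy_boundary\<close> and \<open>Cauchy_boundary_deriv\<close>, therefore turns the inner
  integral over frequencies of the error against \<open>G\<close> into a value or a derivative of the error at the
  mirrored pole. The formula is proved by integrating over rectangles, letting them grow to a half-plane,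
  and passing to the boundary by weak convergence in \<open>L\<^sup>2\<close>. Using each direction both with the factor
  \<open>1\<close> and with the factor \<open>\<i>\<close> removes the real part from the orthogonality relation. The same pairings
  with \<open>H\<close> in place of the error show that all integrals converge.

  Two estimates make the perturbation argument uniform in the parameter. The bound on \<open>\<alpha>\<^sub>i\<close> times the
  resolvent yields \<open>\<bar>\<alpha>\<^sub>i\<bar> \<le> L * \<bar>Re \<lambda>\<^sub>l\<bar>\<close> (\<open>coefficients_bounded_by_decay\<close>), so small perturbations
  keep all poles in the left half-plane. As the squared norm of \<open>1 / (s - \<lambda>\<^sub>l)\<close> is \<open>pi / \<bar>Re \<lambda>\<^sub>l\<bar>\<close>,
  the integrability assumption then makes every \<open>G\<close> square integrable (\<open>weighted_resolvent_L2\<close>).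
\<close>

section \<open>Square-integrable functions on product spaces\<close>

text \<open>
  The parameter measure \<open>\<nu>\<close> comes without any finiteness assumption, whereas frequencies carry Lebesgue
  measure. Tonelli's theorem for nonnegative functions needs only the measure that is integrated first
  to be \<open>\<sigma>\<close>-finite, and splitting into positive and negative part extends this to integrable functions.
\<close>

lemma (in sigma_finite_measure) integral_fst_real:
  fixes f :: "'b \<times> 'a \<Rightarrow> real"
  assumes f: "integrable (N \<Otimes>\<^sub>M M) f"
  shows "AE x in N. integrable M (\<lambda>y. f (x, y))"
    and "integrable N (\<lambda>x. \<integral>y. f (x, y) \<partial>M)"
    and "(\<integral>x. (\<integral>y. f (x, y) \<partial>M) \<partial>N) = integral\<^sup>L (N \<Otimes>\<^sub>M M) f"
proof -
  have [measurable]: "f \<in> borel_measurable (N \<Otimes>\<^sub>M M)" using f by auto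
  have fin: "(\<integral>\<^sup>+x. (\<integral>\<^sup>+y. norm (f (x, y)) \<partial>M) \<partial>N) < \<infinity>"
    using f unfolding integrable_iff_bounded by (subst nn_integral_fst) auto
  have "AE x in N. (\<integral>\<^sup>+y. norm (f (x, y)) \<partial>M) \<noteq> \<infinity>"
    using fin by (intro nn_integral_PInf_AE borel_measurable_nn_integral) (auto simp: measurable_split_conv)
  with AE_space show 1: "AE x in N. integrable M (\<lambda>y. f (x, y))"
    by eventually_elim (auto simp: integrable_iff_bounded less_top)
  have part: "integrable N (\<lambda>x. \<integral>y. g (x, y) \<partial>M) \<and>
      (\<integral>x. (\<integral>y. g (x, y) \<partial>M) \<partial>N) = integral\<^sup>L (N \<Otimes>\<^sub>M M) g"
    if g: "integrable (N \<Otimes>\<^sub>M M) g" and nn: "\<And>p. 0 \<le> g p"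
      and int: "AE x in N. integrable M (\<lambda>y. g (x, y))" for g :: "'b \<times> 'a \<Rightarrow> real"
  proof -
    have [measurable]: "g \<in> borel_measurable (N \<Otimes>\<^sub>M M)" using g by auto
    have "(\<integral>\<^sup>+x. ennreal (\<integral>y. g (x, y) \<partial>M) \<partial>N) = (\<integral>\<^sup>+x. (\<integral>\<^sup>+y. ennreal (g (x, y)) \<partial>M) \<partial>N)"
      using int by (intro nn_integral_cong_AE, eventually_elim) (simp add: nn nn_integral_eq_integral)
    also have "\<dots> = (\<integral>\<^sup>+p. ennreal (g p) \<partial>(N \<Otimes>\<^sub>M M))" by (rule nn_integral_fst) simp
    also have "\<dots> = ennreal (integral\<^sup>L (N \<Otimes>\<^sub>M M) g)"
      using g nn by (intro nn_integral_eq_integral) auto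
    finally show ?thesis
      using nn by (subst (asm) nn_integral_eq_integrable)
        (auto intro!: integral_nonneg_AE borel_measurable_lebesgue_integral simp: measurable_split_conv)
  qed
  have intp: "integrable (N \<Otimes>\<^sub>M M) (\<lambda>p. max 0 (f p))" "integrable (N \<Otimes>\<^sub>M M) (\<lambda>p. max 0 (- f p))"
    using f by auto
  have "AE x in N. integrable M (\<lambda>y. max 0 (f (x, y)))" "AE x in N. integrable M (\<lambda>y. max 0 (- f (x, y)))"
    using 1 by (eventually_elim, simp)+
  note p = part[OF intp(1) _ this(1)] part[OF intp(2) _ this(2)]
  have split: "f p = max 0 (f p) - max 0 (- f p)" for p by auto
  have eq: "AE x in N. (\<integral>y. f (x, y) \<partial>M) = (\<integral>y. max 0 (f (x, y)) \<partial>M) - (\<integral>y. max 0 (- f (x, y)) \<partial>M)"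
    using 1
  proof eventually_elim
    fix x assume "integrable M (\<lambda>y. f (x, y))"
    then show "(\<integral>y. f (x, y) \<partial>M) = (\<integral>y. max 0 (f (x, y)) \<partial>M) - (\<integral>y. max 0 (- f (x, y)) \<partial>M)"
      by (subst Bochner_Integration.integral_diff[symmetric]) (simp_all flip: split)
  qed
  have m: "(\<lambda>x. \<integral>y. f (x, y) \<partial>M) \<in> borel_measurable N"
    by (rule borel_measurable_lebesgue_integral) simp
  have i: "integrable N (\<lambda>x. (\<integral>y. max 0 (f (x, y)) \<partial>M) - (\<integral>y. max 0 (- f (x, y)) \<partial>M))"
    using p by auto
  show "integrable N (\<lambda>x. \<integral>y. f (x, y) \<partial>M)"
    by (rule integrable_cong_AE_imp[OF i m]) (use eq in auto)
  have "(\<integral>x. (\<integral>y. f (x, y) \<partial>M) \<partial>N) = (\<integral>x. (\<integral>y. max 0 (f (x, y)) \<partial>M) - (\<integral>y. max 0 (- f (x, y)) \<partial>M) \<partial>N)"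
    using eq m i by (intro integral_cong_AE) auto
  also have "\<dots> = (\<integral>p. max 0 (f p) - max 0 (- f p) \<partial>(N \<Otimes>\<^sub>M M))"
    using p intp by simp
  also have "\<dots> = integral\<^sup>L (N \<Otimes>\<^sub>M M) f" by (simp flip: split)
  finally show "(\<integral>x. (\<integral>y. f (x, y) \<partial>M) \<partial>N) = integral\<^sup>L (N \<Otimes>\<^sub>M M) f" .
qed

lemma (in sigma_finite_measure) AE_pair_sections:
  assumes "AE x in N. \<forall>y. P (x, y)"
  shows "AE p in N \<Otimes>\<^sub>M M. P p"
proof -
  obtain S where S: "S \<in> null_sets N" "{x \<in> space N. \<not> (\<forall>y. P (x, y))} \<subseteq> S"
    using assms by (auto simp: eventually_ae_filter)
  have "S \<times> space M \<in> null_sets (N \<Otimes>\<^sub>M M)" using S by (intro times_in_null_sets1) auto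
  then show ?thesis
    by (rule AE_I') (use S in \<open>auto simp: space_pair_measure\<close>)
qed

lemma (in sigma_finite_measure) integrable_pair_nonneg:
  fixes g :: "'b \<times> 'a \<Rightarrow> real"
  assumes [measurable]: "g \<in> borel_measurable (N \<Otimes>\<^sub>M M)"
    and nn: "\<And>p. 0 \<le> g p"
    and int: "AE x in N. integrable M (\<lambda>y. g (x, y))"
    and outer: "integrable N (\<lambda>x. \<integral>y. g (x, y) \<partial>M)"
  shows "integrable (N \<Otimes>\<^sub>M M) g"
proof -
  have "(\<integral>\<^sup>+p. ennreal (g p) \<partial>(N \<Otimes>\<^sub>M M)) = (\<integral>\<^sup>+x. (\<integral>\<^sup>+y. ennreal (g (x, y)) \<partial>M) \<partial>N)"
    by (rule nn_integral_fst[symmetric]) simp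
  also have "\<dots> = (\<integral>\<^sup>+x. ennreal (\<integral>y. g (x, y) \<partial>M) \<partial>N)"
    using int by (intro nn_integral_cong_AE, eventually_elim) (simp add: nn nn_integral_eq_integral)
  also have "\<dots> = ennreal (\<integral>x. \<integral>y. g (x, y) \<partial>M \<partial>N)"
    using outer nn by (intro nn_integral_eq_integral) auto
  finally show ?thesis using nn by (intro integrableI_bounded) auto
qed

lemma integrable_inner_L2:
  fixes f g :: "'x \<Rightarrow> 'v::euclidean_space"
  assumes [measurable]: "f \<in> borel_measurable M" "g \<in> borel_measurable M"
    and "integrable M (\<lambda>x. (norm (f x))\<^sup>2)" "integrable M (\<lambda>x. (norm (g x))\<^sup>2)"
  shows "integrable M (\<lambda>x. f x \<bullet> g x)"
proof (rule Bochner_Integration.integrable_bound)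
  show "integrable M (\<lambda>x. (norm (f x))\<^sup>2 + (norm (g x))\<^sup>2)" using assms by auto
  have "\<bar>f x \<bullet> g x\<bar> \<le> (norm (f x))\<^sup>2 + (norm (g x))\<^sup>2" for x
  proof -
    have "0 \<le> norm (f x) * norm (g x)" by simp
    then show ?thesis
      using Cauchy_Schwarz_ineq2[of "f x" "g x"] sum_squares_bound[of "norm (f x)" "norm (g x)"]
      by linarith
  qed
  then show "AE x in M. norm (f x \<bullet> g x) \<le> norm ((norm (f x))\<^sup>2 + (norm (g x))\<^sup>2)" by simp
qed simp

lemma integrable_norm_product_L2:
  fixes f :: "'x \<Rightarrow> 'v::euclidean_space" and g :: "'x \<Rightarrow> 'w::euclidean_space"
  assumes [measurable]: "f \<in> borel_measurable M" "g \<in> borel_measurable M"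
    and "integrable M (\<lambda>x. (norm (f x))\<^sup>2)" "integrable M (\<lambda>x. (norm (g x))\<^sup>2)"
  shows "integrable M (\<lambda>x. norm (f x) * norm (g x))"
  using integrable_inner_L2[of "\<lambda>x. norm (f x)" M "\<lambda>x. norm (g x)"] assms by simp

lemma norm_add_power2_le:
  fixes x y :: "'v::real_normed_vector"
  shows "(norm (x + y))\<^sup>2 \<le> 2 * (norm x)\<^sup>2 + 2 * (norm y)\<^sup>2"
proof -
  have "(norm (x + y))\<^sup>2 \<le> (norm x + norm y)\<^sup>2" by (intro power_mono norm_triangle_ineq) auto
  also have "\<dots> \<le> 2 * (norm x)\<^sup>2 + 2 * (norm y)\<^sup>2"
    using sum_squares_bound[of "norm x" "norm y"] by (simp add: power2_sum)
  finally show ?thesis .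
qed

lemma norm_diff_power2_le:
  fixes x y :: "'v::real_normed_vector"
  shows "(norm (x - y))\<^sup>2 \<le> 2 * (norm x)\<^sup>2 + 2 * (norm y)\<^sup>2"
  using norm_add_power2_le[of x "- y"] by simp

lemma integrable_norm2_diff:
  fixes f g :: "'x \<Rightarrow> 'v::euclidean_space"
  assumes [measurable]: "f \<in> borel_measurable M" "g \<in> borel_measurable M"
    and "integrable M (\<lambda>x. (norm (f x))\<^sup>2)" "integrable M (\<lambda>x. (norm (g x))\<^sup>2)"
  shows "integrable M (\<lambda>x. (norm (f x - g x))\<^sup>2)"
proof (rule Bochner_Integration.integrable_bound)
  show "integrable M (\<lambda>x. 2 * (norm (f x))\<^sup>2 + 2 * (norm (g x))\<^sup>2)" using assms by auto
  have "(norm (f x - g x))\<^sup>2 \<le> 2 * (norm (f x))\<^sup>2 + 2 * (norm (g x))\<^sup>2" for x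
    by (rule norm_diff_power2_le)
  then show "AE x in M. norm ((norm (f x - g x))\<^sup>2) \<le> norm (2 * (norm (f x))\<^sup>2 + 2 * (norm (g x))\<^sup>2)" by simp
qed simp

text \<open>
  The sign of the linear term changes with the sign of \<open>t\<close>, while the quadratic bound does not; dividing
  by \<open>\<bar>t\<bar>\<close> and letting \<open>t\<close> tend to \<open>0\<close> leaves no room for a nonzero slope.
\<close>

lemma linear_term_vanishes:
  fixes I C \<delta> :: real
  assumes "\<delta> > 0" and *: "\<And>t. \<bar>t\<bar> < \<delta> \<Longrightarrow> t \<noteq> 0 \<Longrightarrow> t * I \<le> t\<^sup>2 * C"
  shows "I = 0"
proof (rule ccontr)
  assume "I \<noteq> 0"
  have ev: "\<forall>\<^sub>F t in at_right (0::real). \<bar>I\<bar> \<le> t * C"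
    unfolding eventually_at_right_field
  proof (intro exI conjI allI impI)
    show "0 < \<delta>" by fact
    fix t :: real assume t: "0 < t" "t < \<delta>"
    have "t * I \<le> t\<^sup>2 * C" "(- t) * I \<le> (- t)\<^sup>2 * C" using t by (intro *; simp)+
    then have "t * \<bar>I\<bar> \<le> t * (t * C)" by (auto simp: abs_if power2_eq_square algebra_simps)
    then show "\<bar>I\<bar> \<le> t * C" using t by simp
  qed
  have "((\<lambda>t. t * C) \<longlongrightarrow> 0 * C) (at_right 0)" by (intro tendsto_intros)
  from tendsto_lowerbound[OF this ev] have "\<bar>I\<bar> \<le> 0" by simp
  then show False using \<open>I \<noteq> 0\<close> by simp
qed

text \<open>
  Stationarity of a least-squares error under a perturbation that is only asymptotically linear: the
  true increment is \<open>t *\<^sub>R Gt t\<close>, and \<open>Gt t\<close> differs from the tangent direction \<open>G\<close> by at most \<open>\<bar>t\<bar> * g\<close>.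
  Expanding the square, everything except \<open>- 2 * t * (D \<bullet> G)\<close> is of order \<open>t\<^sup>2\<close> with the integrable
  coefficient \<open>(norm D)\<^sup>2 + 2 * g\<^sup>2\<close>.
\<close>

lemma first_variation_vanishes:
  fixes D G :: "'x \<Rightarrow> 'v::euclidean_space" and Gt :: "real \<Rightarrow> 'x \<Rightarrow> 'v" and g :: "'x \<Rightarrow> real"
  assumes [measurable]: "D \<in> borel_measurable M" "G \<in> borel_measurable M" "g \<in> borel_measurable M"
      "\<And>t. Gt t \<in> borel_measurable M"
    and D: "integrable M (\<lambda>x. (norm (D x))\<^sup>2)" and g: "integrable M (\<lambda>x. (g x)\<^sup>2)"
    and "\<delta> > 0" and G: "AE x in M. norm (G x) \<le> g x"
    and Gt: "\<And>t. \<bar>t\<bar> < \<delta> \<Longrightarrow> t \<noteq> 0 \<Longrightarrow> AE x in M. norm (Gt t x) \<le> g x \<and> norm (Gt t x - G x) \<le> \<bar>t\<bar> * g x"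
    and min: "\<And>t. \<bar>t\<bar> < \<delta> \<Longrightarrow> t \<noteq> 0 \<Longrightarrow>
        (\<integral>x. (norm (D x))\<^sup>2 \<partial>M) \<le> (\<integral>x. (norm (D x - t *\<^sub>R Gt t x))\<^sup>2 \<partial>M)"
  shows "(\<integral>x. D x \<bullet> G x \<partial>M) = 0"
proof -
  have bound: "(norm (d - t *\<^sub>R h))\<^sup>2 \<le> (norm d)\<^sup>2 - 2 * t * (d \<bullet> G') + t\<^sup>2 * ((norm d)\<^sup>2 + 2 * r\<^sup>2)"
    if h: "norm h \<le> r" "norm (h - G') \<le> \<bar>t\<bar> * r" for d h G' :: 'v and t r :: real
  proof -
    have r: "0 \<le> r" using h(1) norm_ge_zero order_trans by blast
    have "- (d \<bullet> (h - G')) * t \<le> norm d * (\<bar>t\<bar> * r) * \<bar>t\<bar>"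
    proof -
      have "- (d \<bullet> (h - G')) * t \<le> \<bar>d \<bullet> (h - G')\<bar> * \<bar>t\<bar>"
        by (metis abs_ge_self abs_minus_cancel abs_mult)
      also have "\<dots> \<le> (norm d * norm (h - G')) * \<bar>t\<bar>"
        by (intro mult_right_mono Cauchy_Schwarz_ineq2) auto
      also have "\<dots> \<le> norm d * (\<bar>t\<bar> * r) * \<bar>t\<bar>" by (intro mult_right_mono mult_left_mono h) auto
      finally show ?thesis .
    qed
    also have "\<dots> = t\<^sup>2 * (norm d * r)"
      by (simp add: power2_eq_square algebra_simps)
    also have "\<dots> \<le> t\<^sup>2 * (((norm d)\<^sup>2 + r\<^sup>2) / 2)"
      using sum_squares_bound[of "norm d" r] by (intro mult_left_mono) auto
    finally have 1: "- (d \<bullet> (h - G')) * t \<le> t\<^sup>2 * (((norm d)\<^sup>2 + r\<^sup>2) / 2)" .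
    have 2: "t\<^sup>2 * (norm h)\<^sup>2 \<le> t\<^sup>2 * r\<^sup>2" using h(1) by (intro mult_left_mono power_mono) auto
    have "(norm (d - t *\<^sub>R h))\<^sup>2 = (norm d)\<^sup>2 - 2 * t * (d \<bullet> h) + t\<^sup>2 * (norm h)\<^sup>2"
      unfolding power2_norm_eq_inner
      by (simp add: inner_diff_left inner_diff_right inner_commute power2_eq_square algebra_simps)
    then show ?thesis using 1 2 by (simp add: inner_diff_right algebra_simps)
  qed
  have G2: "integrable M (\<lambda>x. (norm (G x))\<^sup>2)"
    by (rule Bochner_Integration.integrable_bound[OF g]) (use G in \<open>auto elim!: eventually_mono intro!: power_mono\<close>)
  have DG: "integrable M (\<lambda>x. D x \<bullet> G x)" by (rule integrable_inner_L2) (use D G2 in auto)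
  define C where "C = (\<integral>x. (norm (D x))\<^sup>2 + 2 * (g x)\<^sup>2 \<partial>M)"
  show ?thesis
  proof (rule linear_term_vanishes[OF \<open>\<delta> > 0\<close>])
    fix t assume t: "\<bar>t\<bar> < \<delta>" "t \<noteq> 0"
    let ?u = "\<lambda>x. (norm (D x))\<^sup>2 - 2 * t * (D x \<bullet> G x) + t\<^sup>2 * ((norm (D x))\<^sup>2 + 2 * (g x)\<^sup>2)"
    have le: "AE x in M. (norm (D x - t *\<^sub>R Gt t x))\<^sup>2 \<le> ?u x"
      using Gt[OF t] by eventually_elim (auto intro!: bound)
    have u: "integrable M ?u" using D DG g by auto
    have "(\<integral>x. (norm (D x))\<^sup>2 \<partial>M) \<le> (\<integral>x. (norm (D x - t *\<^sub>R Gt t x))\<^sup>2 \<partial>M)" by (rule min[OF t])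
    also have "\<dots> \<le> integral\<^sup>L M ?u"
    proof (rule integral_mono_AE[OF _ u le])
      show "integrable M (\<lambda>x. (norm (D x - t *\<^sub>R Gt t x))\<^sup>2)"
        by (rule Bochner_Integration.integrable_bound[OF u]) (use le in \<open>auto elim!: eventually_mono\<close>)
    qed
    also have "\<dots> = (\<integral>x. (norm (D x))\<^sup>2 \<partial>M) - 2 * t * (\<integral>x. D x \<bullet> G x \<partial>M) + t\<^sup>2 * C"
      unfolding C_def using D DG g by simp
    finally show "t * (\<integral>x. D x \<bullet> G x \<partial>M) \<le> t\<^sup>2 * (C / 2)" by simp
  qed
qed

text \<open>
  A sequence that is bounded in \<open>L\<^sup>2\<close> and converges almost everywhere converges weakly. It is needed
  because membership in the Hardy space provides boundary values only as limits almost everywhere, and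
  not in norm.
\<close>

lemma weak_convergence_L2:
  fixes f :: "nat \<Rightarrow> 'x \<Rightarrow> complex" and f' g :: "'x \<Rightarrow> complex"
  assumes [measurable]: "\<And>n. f n \<in> borel_measurable M" "f' \<in> borel_measurable M" "g \<in> borel_measurable M"
    and lim: "AE x in M. (\<lambda>n. f n x) \<longlonglongrightarrow> f' x"
    and f: "\<And>n. integrable M (\<lambda>x. (norm (f n x))\<^sup>2)" "\<And>n. (\<integral>x. (norm (f n x))\<^sup>2 \<partial>M) \<le> K"
    and f': "integrable M (\<lambda>x. (norm (f' x))\<^sup>2)" "(\<integral>x. (norm (f' x))\<^sup>2 \<partial>M) \<le> K"
    and g: "integrable M (\<lambda>x. (norm (g x))\<^sup>2)"
  shows "(\<lambda>n. \<integral>x. f n x * g x \<partial>M) \<longlonglongrightarrow> (\<integral>x. f' x * g x \<partial>M)"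
proof -
  have K: "0 \<le> K" using f(2)[of 0] by (rule order_trans[rotated]) auto
  let ?d = "\<lambda>n x. norm (f n x - f' x)"
  have d: "integrable M (\<lambda>x. (?d n x)\<^sup>2)" for n by (rule integrable_norm2_diff) (use f f' in auto)
  have d4: "(\<integral>x. (?d n x)\<^sup>2 \<partial>M) \<le> 4 * K" for n
  proof -
    have "(?d n x)\<^sup>2 \<le> 2 * (norm (f n x))\<^sup>2 + 2 * (norm (f' x))\<^sup>2" for x
      by (rule norm_diff_power2_le)
    then have "(\<integral>x. (?d n x)\<^sup>2 \<partial>M) \<le> (\<integral>x. 2 * (norm (f n x))\<^sup>2 + 2 * (norm (f' x))\<^sup>2 \<partial>M)"
      using d f f' by (intro integral_mono) auto
    also have "\<dots> = 2 * (\<integral>x. (norm (f n x))\<^sup>2 \<partial>M) + 2 * (\<integral>x. (norm (f' x))\<^sup>2 \<partial>M)"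
      using f(1) f'(1) by simp
    also have "\<dots> \<le> 4 * K" using f(2)[of n] f'(2) by linarith
    finally show ?thesis .
  qed
  have dg: "integrable M (\<lambda>x. ?d n x * norm (g x))" for n
    by (rule integrable_norm_product_L2) (use d g in auto)
  have lim0: "(\<lambda>n. \<integral>x. ?d n x * norm (g x) \<partial>M) \<longlonglongrightarrow> 0"
  proof (rule LIMSEQ_I)
    fix e :: real assume e: "0 < e"
    define B where "B = (8 * K + 1) / e"
    have B: "0 < B" using K e by (auto simp: B_def)
    \<comment> \<open>Where the difference is at most \<open>B * norm g\<close>, dominated convergence applies with majorant
      \<open>B * (norm g)\<^sup>2\<close>; where it is larger, the product is at most \<open>?d\<^sup>2 / B\<close>, and the choice of \<open>B\<close>
      makes \<open>4 * K / B\<close> smaller than \<open>e / 2\<close>.\<close>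
    let ?h = "\<lambda>n x. min (?d n x) (B * norm (g x)) * norm (g x)"
    have hm: "?h n \<in> borel_measurable M" for n by measurable
    have hb: "norm (?h n x) \<le> B * (norm (g x))\<^sup>2" for n x
    proof -
      have "?h n x \<le> B * norm (g x) * norm (g x)" by (intro mult_right_mono) auto
      moreover have "0 \<le> ?h n x" using B by (intro mult_nonneg_nonneg) auto
      ultimately show ?thesis by (simp add: power2_eq_square mult.assoc)
    qed
    have hi: "integrable M (?h n)" for n
      by (rule Bochner_Integration.integrable_bound[of _ "\<lambda>x. B * (norm (g x))\<^sup>2"]) (use g hb B in auto)
    have "(\<lambda>n. integral\<^sup>L M (?h n)) \<longlonglongrightarrow> (\<integral>x. 0 \<partial>M)"
    proof (rule integral_dominated_convergence)
      show "integrable M (\<lambda>x. B * (norm (g x))\<^sup>2)" using g by auto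
      show "AE x in M. (\<lambda>n. ?h n x) \<longlonglongrightarrow> 0"
        using lim
      proof eventually_elim
        fix x assume "(\<lambda>n. f n x) \<longlonglongrightarrow> f' x"
        then have "(\<lambda>n. ?d n x) \<longlonglongrightarrow> 0" using LIM_zero tendsto_norm_zero by blast
        then have "(\<lambda>n. ?h n x) \<longlonglongrightarrow> min 0 (B * norm (g x)) * norm (g x)"
          by (intro tendsto_intros)
        then show "(\<lambda>n. ?h n x) \<longlonglongrightarrow> 0" using B by (simp add: min_def)
      qed
    qed (use hb hm in auto)
    from LIMSEQ_D[OF this, of "e / 2"] e
    obtain N where N: "\<And>n. n \<ge> N \<Longrightarrow> norm (integral\<^sup>L M (?h n)) < e / 2"
      by auto
    show "\<exists>no. \<forall>n\<ge>no. norm ((\<integral>x. ?d n x * norm (g x) \<partial>M) - 0) < e"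
    proof (intro exI allI impI)
      fix n assume n: "n \<ge> N"
      have "a * b \<le> min a (B * b) * b + a\<^sup>2 / B" if "0 \<le> a" "0 \<le> b" for a b :: real
      proof (cases "a \<le> B * b")
        case False
        have "a * (B * b) \<le> a * a" using False that by (intro mult_left_mono) auto
        moreover have "0 \<le> B * (B * (b * b))" using B that by auto
        ultimately have "a * (B * b) \<le> a * a + B * (B * (b * b))" by linarith
        then have "B * (a * b) \<le> B * (B * b * b + a\<^sup>2 / B)"
          using B by (simp add: algebra_simps power2_eq_square)
        then show ?thesis using B False by (simp add: min_def)
      qed (use B in auto)
      then have "(\<integral>x. ?d n x * norm (g x) \<partial>M) \<le> (\<integral>x. ?h n x + (?d n x)\<^sup>2 / B \<partial>M)"
        using dg hi d by (intro integral_mono) auto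
      also have "\<dots> = integral\<^sup>L M (?h n) + (\<integral>x. (?d n x)\<^sup>2 \<partial>M) / B"
        using hi d by simp
      also have "\<dots> \<le> integral\<^sup>L M (?h n) + 4 * K / B" using B d4[of n] by (simp add: divide_right_mono)
      also have "4 * K / B < e / 2" using e K by (simp add: B_def field_simps)
      also have "integral\<^sup>L M (?h n) + e / 2 < e" using N[OF n] by auto
      finally have "(\<integral>x. ?d n x * norm (g x) \<partial>M) < e" by simp
      moreover have "0 \<le> (\<integral>x. ?d n x * norm (g x) \<partial>M)" by simp
      ultimately show "norm ((\<integral>x. ?d n x * norm (g x) \<partial>M) - 0) < e" by simp
    qed
  qed
  have bnd: "norm ((\<integral>x. f n x * g x \<partial>M) - (\<integral>x. f' x * g x \<partial>M)) \<le> (\<integral>x. ?d n x * norm (g x) \<partial>M)" for n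
  proof -
    have i: "integrable M (\<lambda>x. f n x * g x)" "integrable M (\<lambda>x. f' x * g x)"
      using integrable_norm_product_L2[of "f n" M g] integrable_norm_product_L2[of f' M g] f f' g
      by (auto intro: Bochner_Integration.integrable_bound simp: norm_mult)
    have "(\<integral>x. f n x * g x \<partial>M) - (\<integral>x. f' x * g x \<partial>M) = (\<integral>x. (f n x - f' x) * g x \<partial>M)"
      using i by (simp add: left_diff_distrib)
    also have "norm \<dots> \<le> (\<integral>x. norm ((f n x - f' x) * g x) \<partial>M)" by (rule integral_norm_bound)
    finally show ?thesis by (simp add: norm_mult)
  qed
  have "(\<lambda>n. (\<integral>x. f n x * g x \<partial>M) - (\<integral>x. f' x * g x \<partial>M)) \<longlonglongrightarrow> 0"
    by (rule Lim_null_comparison[OF _ lim0]) (simp add: bnd)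
  then show ?thesis by (rule LIM_zero_cancel)
qed

section \<open>Cauchy's formula with boundary values on the imaginary axis\<close>

lemma integral_inverse_one_plus_square:
  shows "integrable lborel (\<lambda>x::real. 1 / (1 + x\<^sup>2))" and "(\<integral>x. 1 / (1 + x\<^sup>2) \<partial>lborel) = pi"
proof -
  have t: "((arctan \<circ> real_of_ereal) \<longlongrightarrow> - (pi / 2)) (at_right (-\<infinity>))" "((arctan \<circ> real_of_ereal) \<longlongrightarrow> pi / 2) (at_left \<infinity>)"
    by (auto simp: ereal_tendsto_simps1 tendsto_arctan_at_top tendsto_arctan_at_bot)
  have d: "\<And>x::real. DERIV arctan x :> 1 / (1 + x\<^sup>2)"
    by (auto intro!: derivative_eq_intros simp: field_simps)
  have c: "isCont (\<lambda>x. 1 / (1 + x\<^sup>2)) x" for x :: real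
    using sum_power2_gt_zero_iff[of 1 x] by (intro continuous_intros) (auto simp: add_nonneg_eq_0_iff)
  note f = interval_integral_FTC_nonneg[OF _ d c _ t]
  show "integrable lborel (\<lambda>x::real. 1 / (1 + x\<^sup>2))"
    using f(1) by (simp add: set_integrable_def)
  have "(LBINT x=-\<infinity>..\<infinity>. 1 / (1 + x\<^sup>2)) = pi" using f(2) by simp
  then show "(\<integral>x. 1 / (1 + x\<^sup>2) \<partial>lborel) = pi"
    by (simp add: interval_lebesgue_integral_def set_lebesgue_integral_def)
qed

text \<open>
  The size of a simple pole on the imaginary axis. It makes the decay rate \<open>\<bar>Re p\<bar>\<close> of a pole the
  quantity that controls square integrability over the parameter set.
\<close>

lemma resolvent_L2:
  assumes "Re p \<noteq> 0"
  shows "integrable lborel (\<lambda>\<omega>. (norm (1 / (p - \<i> * of_real \<omega>)))\<^sup>2)"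
    and "(\<integral>\<omega>. (norm (1 / (p - \<i> * of_real \<omega>)))\<^sup>2 \<partial>lborel) = pi / \<bar>Re p\<bar>"
proof -
  let ?f = "\<lambda>\<omega>. (norm (1 / (p - \<i> * of_real \<omega>)))\<^sup>2"
  have eq: "?f (Im p + \<bar>Re p\<bar> * x) = (1 / (1 + x\<^sup>2)) / (Re p)\<^sup>2" for x
  proof -
    have "?f (Im p + \<bar>Re p\<bar> * x) = 1 / ((Re p)\<^sup>2 + (Re p)\<^sup>2 * x\<^sup>2)"
      by (simp add: norm_divide power_divide cmod_power2 power_mult_distrib)
    also have "\<dots> = 1 / ((Re p)\<^sup>2 * (1 + x\<^sup>2))" by (simp add: algebra_simps)
    finally show ?thesis by simp
  qed
  have i: "integrable lborel (\<lambda>x. ?f (Im p + \<bar>Re p\<bar> * x))"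
    unfolding eq by (intro integrable_divide_zero integral_inverse_one_plus_square(1))
  then show "integrable lborel ?f"
    by (subst (asm) lborel_integrable_real_affine_iff) (use assms in auto)
  have "integral\<^sup>L lborel ?f = \<bar>Re p\<bar> * (\<integral>x. ?f (Im p + \<bar>Re p\<bar> * x) \<partial>lborel)"
    using lborel_integral_real_affine[of "\<bar>Re p\<bar>" ?f "Im p"] assms by simp
  also have "\<dots> = pi / \<bar>Re p\<bar>"
    unfolding eq integral_divide_zero integral_inverse_one_plus_square(2) using assms
    by (simp add: field_simps power2_eq_square abs_if)
  finally show "integral\<^sup>L lborel ?f = pi / \<bar>Re p\<bar>" .
qed

lemma contour_integral_linepath_same_Im:
  fixes f :: "complex \<Rightarrow> complex"
  assumes "a < b"
  shows "contour_integral (linepath (Complex a c) (Complex b c)) f = integral {a..b} (\<lambda>x. f (Complex x c))"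
proof -
  \<comment> \<open>Multiplication by the imaginary unit turns the horizontal segment into a vertical one.\<close>
  let ?z = "Complex a c" and ?w = "Complex b c"
  have lp: "- (\<i> * linepath (\<i> * ?z) (\<i> * ?w) x) = linepath ?z ?w x" for x
    by (auto simp: linepath_def complex_eq_iff algebra_simps)
  have "contour_integral (linepath ?z ?w) f =
      contour_integral (linepath (\<i> * ?z) (\<i> * ?w)) (\<lambda>w. - \<i> * f (- \<i> * w))"
    unfolding contour_integral_integral vector_derivative_linepath_at
    by (rule Henstock_Kurzweil_Integration.integral_cong) (simp add: lp algebra_simps)
  also have "\<dots> = \<i> * integral {a..b} (\<lambda>x. - \<i> * f (- \<i> * Complex (- c) x))"
    using assms by (intro contour_integral_linepath_same_Re) auto
  also have "(\<lambda>x. - \<i> * f (- \<i> * Complex (- c) x)) = (\<lambda>x. - \<i> * f (Complex x c))"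
    by (intro ext arg_cong[where f="\<lambda>u. - \<i> * f u"]) (simp add: complex_eq_iff)
  also have "integral {a..b} \<dots> = - \<i> * integral {a..b} (\<lambda>x. f (Complex x c))"
    by (rule integral_mult_right)
  finally show ?thesis by simp
qed

lemma Cauchy_rectangle:
  fixes f :: "complex \<Rightarrow> complex"
  assumes hol: "f holomorphic_on {s. 0 < Re s}"
    and "0 < a" "a < Re \<mu>" "Re \<mu> < R" "\<bar>Im \<mu>\<bar> < T"
  shows "integral {-T..T} (\<lambda>\<omega>. f (Complex a \<omega>) / (\<mu> - Complex a \<omega>))
       - integral {-T..T} (\<lambda>\<omega>. f (Complex R \<omega>) / (\<mu> - Complex R \<omega>))
       + \<i> * (integral {a..R} (\<lambda>x. f (Complex x T) / (Complex x T - \<mu>))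
            - integral {a..R} (\<lambda>x. f (Complex x (-T)) / (Complex x (-T) - \<mu>)))
       = 2 * pi * f \<mu>"
proof -
  let ?F = "\<lambda>w. f w / (w - \<mu>)"
  let ?p1 = "Complex a (-T)" and ?p2 = "Complex R (-T)" and ?p3 = "Complex R T" and ?p4 = "Complex a T"
  have \<mu>: "\<mu> \<in> box ?p1 ?p3" using assms by (auto simp: in_box_complex_iff)
  have path: "path_image (rectpath ?p1 ?p3) \<subseteq> {s. 0 < Re s} - {\<mu>}"
    using assms by (subst path_image_rectpath) (auto simp: in_box_complex_iff)
  have "(?F has_contour_integral (2 * pi * \<i> * winding_number (rectpath ?p1 ?p3) \<mu> * f \<mu>)) (rectpath ?p1 ?p3)"
    by (rule Cauchy_integral_formula_convex_simple[OF _ hol])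
      (use assms path in \<open>auto simp: convex_halfspace_Re_gt interior_open open_halfspace_Re_gt\<close>)
  then have main: "contour_integral (rectpath ?p1 ?p3) ?F = 2 * pi * \<i> * f \<mu>"
    using winding_number_rectpath[OF \<mu>] by (simp add: contour_integral_unique)
  have cont: "continuous_on S ?F" if "S \<subseteq> {s. 0 < Re s} - {\<mu>}" for S
    using that by (intro continuous_intros holomorphic_on_imp_continuous_on holomorphic_on_subset[OF hol]) auto
  have seg: "closed_segment ?p1 ?p2 \<subseteq> {s. 0 < Re s} - {\<mu>}" "closed_segment ?p2 ?p3 \<subseteq> {s. 0 < Re s} - {\<mu>}"
       "closed_segment ?p3 ?p4 \<subseteq> {s. 0 < Re s} - {\<mu>}" "closed_segment ?p4 ?p1 \<subseteq> {s. 0 < Re s} - {\<mu>}"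
    using path by (auto simp: rectpath_def Let_def path_image_join)
  note ci = contour_integrable_continuous_linepath[OF cont]
  have "contour_integral (rectpath ?p1 ?p3) ?F = contour_integral (linepath ?p1 ?p2) ?F
      + contour_integral (linepath ?p2 ?p3) ?F + contour_integral (linepath ?p3 ?p4) ?F
      + contour_integral (linepath ?p4 ?p1) ?F"
    using seg by (simp add: rectpath_def Let_def contour_integral_join contour_integrable_join ci)
  also have "contour_integral (linepath ?p3 ?p4) ?F = - contour_integral (linepath ?p4 ?p3) ?F"
    by (rule contour_integral_reverse_linepath) (use seg in \<open>auto intro: cont\<close>)
  also have "contour_integral (linepath ?p4 ?p1) ?F = - contour_integral (linepath ?p1 ?p4) ?F"
    by (rule contour_integral_reverse_linepath) (use seg in \<open>auto intro: cont\<close>)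
  also have "contour_integral (linepath ?p1 ?p2) ?F = integral {a..R} (\<lambda>x. ?F (Complex x (-T)))"
    by (rule contour_integral_linepath_same_Im) (use assms in auto)
  also have "contour_integral (linepath ?p4 ?p3) ?F = integral {a..R} (\<lambda>x. ?F (Complex x T))"
    by (rule contour_integral_linepath_same_Im) (use assms in auto)
  also have "contour_integral (linepath ?p2 ?p3) ?F = \<i> * integral {-T..T} (\<lambda>x. ?F (Complex R x))"
    by (rule contour_integral_linepath_same_Re) (use assms in auto)
  also have "contour_integral (linepath ?p1 ?p4) ?F = \<i> * integral {-T..T} (\<lambda>x. ?F (Complex a x))"
    by (rule contour_integral_linepath_same_Re) (use assms in auto)
  finally have eq: "2 * pi * \<i> * f \<mu> = integral {a..R} (\<lambda>x. ?F (Complex x (-T)))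
      + \<i> * integral {-T..T} (\<lambda>x. ?F (Complex R x))
      + - integral {a..R} (\<lambda>x. ?F (Complex x T)) + - (\<i> * integral {-T..T} (\<lambda>x. ?F (Complex a x)))"
    unfolding main .
  have flip: "integral {-T..T} (\<lambda>x. ?F (Complex r x)) = - integral {-T..T} (\<lambda>\<omega>. f (Complex r \<omega>) / (\<mu> - Complex r \<omega>))" for r
    by (simp flip: integral_neg) (metis minus_diff_eq minus_divide_right)
  have "\<i> * (2 * pi * f \<mu>) = \<i> * (integral {-T..T} (\<lambda>\<omega>. f (Complex a \<omega>) / (\<mu> - Complex a \<omega>))
       - integral {-T..T} (\<lambda>\<omega>. f (Complex R \<omega>) / (\<mu> - Complex R \<omega>))
       + \<i> * (integral {a..R} (\<lambda>x. f (Complex x T) / (Complex x T - \<mu>))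
            - integral {a..R} (\<lambda>x. f (Complex x (-T)) / (Complex x (-T) - \<mu>))))"
    using eq unfolding flip by (simp add: algebra_simps)
  then show ?thesis by simp
qed

text \<open>
  A scalar function with the properties of one entry of a member of \<^const>\<open>hardy2\<close>: \<open>K\<close> bounds the
  squared \<open>L\<^sup>2\<close> norm on all vertical lines of the right half-plane.
\<close>

locale hardy_function =
  fixes f :: "complex \<Rightarrow> complex" and K :: real
  assumes hol: "f holomorphic_on {s. 0 < Re s}"
    and K: "0 \<le> K"
    and lines: "\<And>x. 0 < x \<Longrightarrow> (\<integral>\<^sup>+ \<omega>. ennreal ((norm (f (Complex x \<omega>)))\<^sup>2) \<partial>lborel) \<le> ennreal K"
    and boundary_measurable: "(\<lambda>\<omega>. f (\<i> * of_real \<omega>)) \<in> borel_measurable borel"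
    and boundary: "AE \<omega> in lborel. ((\<lambda>x. f (Complex x \<omega>)) \<longlongrightarrow> f (\<i> * of_real \<omega>)) (at_right 0)"
begin

lemma continuous_line: "0 < x \<Longrightarrow> continuous_on S (\<lambda>\<omega>. f (Complex x \<omega>))"
  unfolding Complex_eq
  by (rule continuous_on_compose2[OF holomorphic_on_imp_continuous_on[OF hol]]) (auto intro!: continuous_intros)

lemma continuous_horizontal: "S \<subseteq> {0<..} \<Longrightarrow> continuous_on S (\<lambda>x. f (Complex x \<omega>))"
  unfolding Complex_eq
  by (rule continuous_on_compose2[OF holomorphic_on_imp_continuous_on[OF hol]]) (auto intro!: continuous_intros)

lemma line_measurable: "0 < x \<Longrightarrow> (\<lambda>\<omega>. f (Complex x \<omega>)) \<in> borel_measurable borel"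
  by (intro borel_measurable_continuous_onI continuous_line)

lemma line_L2:
  assumes "0 < x"
  shows "integrable lborel (\<lambda>\<omega>. (norm (f (Complex x \<omega>)))\<^sup>2)"
    and "(\<integral>\<omega>. (norm (f (Complex x \<omega>)))\<^sup>2 \<partial>lborel) \<le> K"
proof -
  have [measurable]: "(\<lambda>\<omega>. f (Complex x \<omega>)) \<in> borel_measurable borel" using assms by (rule line_measurable)
  show i: "integrable lborel (\<lambda>\<omega>. (norm (f (Complex x \<omega>)))\<^sup>2)"
    by (rule integrableI_bounded) (use lines[OF assms] in \<open>auto simp: le_less_trans\<close>)
  show "(\<integral>\<omega>. (norm (f (Complex x \<omega>)))\<^sup>2 \<partial>lborel) \<le> K"
    using lines[OF assms] i K by (subst (asm) nn_integral_eq_integral) auto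
qed

lemma boundary_sequence:
  assumes "X \<longlonglongrightarrow> 0" "\<And>n. 0 < X n"
  shows "AE \<omega> in lborel. (\<lambda>n. f (Complex (X n) \<omega>)) \<longlonglongrightarrow> f (\<i> * of_real \<omega>)"
  using boundary
proof eventually_elim
  fix \<omega> assume "((\<lambda>x. f (Complex x \<omega>)) \<longlongrightarrow> f (\<i> * of_real \<omega>)) (at_right 0)"
  moreover have "filterlim X (at_right 0) sequentially"
    using assms by (auto simp: filterlim_at less_imp_neq[THEN not_sym] intro!: always_eventually)
  ultimately show "(\<lambda>n. f (Complex (X n) \<omega>)) \<longlonglongrightarrow> f (\<i> * of_real \<omega>)" by (rule filterlim_compose)
qed

text \<open>
  Fatou's lemma carries the bound on vertical lines over to the boundary.
\<close>

lemma boundary_L2: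
  shows "integrable lborel (\<lambda>\<omega>. (norm (f (\<i> * of_real \<omega>)))\<^sup>2)"
    and "(\<integral>\<omega>. (norm (f (\<i> * of_real \<omega>)))\<^sup>2 \<partial>lborel) \<le> K"
proof -
  note [measurable] = boundary_measurable
  let ?X = "\<lambda>n. inverse (real (Suc n))"
  have X: "?X \<longlonglongrightarrow> 0" "\<And>n. 0 < ?X n" using LIMSEQ_inverse_real_of_nat by auto
  have [measurable]: "(\<lambda>\<omega>. f (Complex (?X n) \<omega>)) \<in> borel_measurable borel" for n by (rule line_measurable) simp
  have "(\<integral>\<^sup>+ \<omega>. ennreal ((norm (f (\<i> * of_real \<omega>)))\<^sup>2) \<partial>lborel)
      = (\<integral>\<^sup>+ \<omega>. liminf (\<lambda>n. ennreal ((norm (f (Complex (?X n) \<omega>)))\<^sup>2)) \<partial>lborel)"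
    using boundary_sequence[OF X]
  proof (intro nn_integral_cong_AE, eventually_elim)
    fix \<omega> assume "(\<lambda>n. f (Complex (?X n) \<omega>)) \<longlonglongrightarrow> f (\<i> * of_real \<omega>)"
    then have "(\<lambda>n. ennreal ((norm (f (Complex (?X n) \<omega>)))\<^sup>2)) \<longlonglongrightarrow> ennreal ((norm (f (\<i> * of_real \<omega>)))\<^sup>2)"
      by (intro tendsto_ennrealI tendsto_intros)
    then show "ennreal ((norm (f (\<i> * of_real \<omega>)))\<^sup>2) = liminf (\<lambda>n. ennreal ((norm (f (Complex (?X n) \<omega>)))\<^sup>2))"
      by (intro lim_imp_Liminf[symmetric]) auto
  qed
  also have "\<dots> \<le> liminf (\<lambda>n. \<integral>\<^sup>+ \<omega>. ennreal ((norm (f (Complex (?X n) \<omega>)))\<^sup>2) \<partial>lborel)"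
    by (rule nn_integral_liminf) measurable
  also have "\<dots> \<le> liminf (\<lambda>n. ennreal K)"
    by (intro Liminf_mono always_eventually allI lines X)
  also have "\<dots> = ennreal K" by (simp add: Liminf_const)
  finally have le: "(\<integral>\<^sup>+ \<omega>. ennreal ((norm (f (\<i> * of_real \<omega>)))\<^sup>2) \<partial>lborel) \<le> ennreal K" .
  show i: "integrable lborel (\<lambda>\<omega>. (norm (f (\<i> * of_real \<omega>)))\<^sup>2)"
    by (rule integrableI_bounded) (use le in \<open>auto simp: le_less_trans\<close>)
  show "(\<integral>\<omega>. (norm (f (\<i> * of_real \<omega>)))\<^sup>2 \<partial>lborel) \<le> K"
    using le i K by (subst (asm) nn_integral_eq_integral) auto
qed

text \<open>
  Without a pointwise decay estimate, the horizontal sides of the contour have to be chosen. The squared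
  moduli on the segments at the heights \<open>T\<close> and \<open>-T\<close>, integrated over all \<open>T\<close>, amount to at most
  \<open>2 * (R - a) * K\<close>, so one of the two segments cannot exceed \<open>1\<close> at every height of a longer interval.
\<close>

lemma small_horizontal_segments:
  assumes "0 < a" "a < R"
  shows "\<exists>T>T0. integral {a..R} (\<lambda>x. (norm (f (Complex x T)))\<^sup>2) \<le> 1 \<and>
      integral {a..R} (\<lambda>x. (norm (f (Complex x (-T))))\<^sup>2) \<le> 1"
proof (rule ccontr)
  assume neg: "\<not> ?thesis"
  define F where "F = (\<lambda>z. indicator {s. 0 < Re s} z *\<^sub>R f z)"
  have [measurable]: "F \<in> borel_measurable borel"
    unfolding F_def
    by (intro borel_measurable_continuous_on_indicator holomorphic_on_imp_continuous_on hol)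
      (auto intro!: borel_open open_halfspace_Re_gt)
  have F: "F (Complex x t) = f (Complex x t)" if "0 < x" for x t using that by (simp add: F_def)
  have [measurable]: "(\<lambda>p. Complex (fst p) (snd p)) \<in> borel_measurable (borel \<Otimes>\<^sub>M borel)"
    unfolding Complex_eq by measurable
  have Cm[measurable]: "(\<lambda>(x, t). F (Complex x t)) \<in> borel_measurable (lborel \<Otimes>\<^sub>M lborel)"
    "(\<lambda>(x, t). F (Complex x (- t))) \<in> borel_measurable (lborel \<Otimes>\<^sub>M lborel)"
    unfolding Complex_eq by measurable
  let ?g = "\<lambda>x t. ennreal ((norm (F (Complex x t)))\<^sup>2) + ennreal ((norm (F (Complex x (- t))))\<^sup>2)"
  have seg: "(\<integral>\<^sup>+x. indicator {a..R} x * ennreal ((norm (F (Complex x t)))\<^sup>2) \<partial>lborel)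
      = ennreal (integral {a..R} (\<lambda>x. (norm (f (Complex x t)))\<^sup>2))" for t
  proof -
    have si: "set_integrable lborel {a..R} (\<lambda>x. (norm (f (Complex x t)))\<^sup>2)"
      by (intro borel_integrable_atLeastAtMost' continuous_intros continuous_horizontal) (use assms in auto)
    have "(\<integral>\<^sup>+x. indicator {a..R} x * ennreal ((norm (F (Complex x t)))\<^sup>2) \<partial>lborel)
        = (\<integral>\<^sup>+x. ennreal (indicator {a..R} x *\<^sub>R (norm (f (Complex x t)))\<^sup>2) \<partial>lborel)"
      using assms by (intro nn_integral_cong) (auto simp: F split: split_indicator)
    also have "\<dots> = ennreal (LINT x:{a..R}|lborel. (norm (f (Complex x t)))\<^sup>2)"
      unfolding set_lebesgue_integral_def using si
      by (intro nn_integral_eq_integral) (auto simp: set_integrable_def)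
    finally show ?thesis using set_borel_integral_eq_integral(2)[OF si] by simp
  qed
  define L where "L = (R - a) * (K + K) + 1"
  have L: "0 \<le> L" using assms K by (auto simp: L_def)
  have "ennreal L = (\<integral>\<^sup>+t. indicator {T0<..<T0 + L} t \<partial>lborel)"
    using L by simp
  also have "\<dots> \<le> (\<integral>\<^sup>+t. (\<integral>\<^sup>+x. indicator {a..R} x * ?g x t \<partial>lborel) \<partial>lborel)"
  proof (intro nn_integral_mono)
    fix t :: real
    show "indicator {T0<..<T0 + L} t \<le> (\<integral>\<^sup>+x. indicator {a..R} x * ?g x t \<partial>lborel)"
    proof (cases "t > T0")
      case True
      let ?i = "\<lambda>t. integral {a..R} (\<lambda>x. (norm (f (Complex x t)))\<^sup>2)"
      have nn: "0 \<le> ?i t" "0 \<le> ?i (-t)"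
        by (intro Henstock_Kurzweil_Integration.integral_nonneg integrable_continuous_real continuous_intros continuous_horizontal;
            use assms in auto)+
      have "1 \<le> ?i t + ?i (- t)"
      proof (cases "?i t \<le> 1")
        case le: True
        then have "\<not> ?i (- t) \<le> 1" using neg True by blast
        then show ?thesis using nn by linarith
      qed (use nn in linarith)
      then have "(1::ennreal) \<le> ennreal (?i t + ?i (- t))"
        unfolding ennreal_1[symmetric] by (rule ennreal_leI)
      also have "\<dots> = (\<integral>\<^sup>+x. indicator {a..R} x * ennreal ((norm (F (Complex x t)))\<^sup>2) \<partial>lborel)
          + (\<integral>\<^sup>+x. indicator {a..R} x * ennreal ((norm (F (Complex x (-t))))\<^sup>2) \<partial>lborel)"
        using nn by (simp add: seg)
      also have "\<dots> = (\<integral>\<^sup>+x. indicator {a..R} x * ?g x t \<partial>lborel)"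
        unfolding Complex_eq by (subst nn_integral_add[symmetric]) (auto simp: algebra_simps)
      finally show ?thesis by (simp add: indicator_def)
    qed simp
  qed
  also have "\<dots> = (\<integral>\<^sup>+x. (\<integral>\<^sup>+t. indicator {a..R} x * ?g x t \<partial>lborel) \<partial>lborel)"
    by (rule lborel_pair.Fubini') measurable
  also have "\<dots> \<le> (\<integral>\<^sup>+x. indicator {a..R} x * (ennreal K + ennreal K) \<partial>lborel)"
  proof (intro nn_integral_mono)
    fix x :: real
    show "(\<integral>\<^sup>+t. indicator {a..R} x * ?g x t \<partial>lborel) \<le> indicator {a..R} x * (ennreal K + ennreal K)"
    proof (cases "x \<in> {a..R}")
      case True
      then have x: "0 < x" using assms by auto
      have [measurable]: "(\<lambda>t. f (Complex x t)) \<in> borel_measurable borel" using x by (rule line_measurable)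
      have refl: "(\<integral>\<^sup>+t. ennreal ((norm (f (Complex x (-t))))\<^sup>2) \<partial>lborel) = (\<integral>\<^sup>+t. ennreal ((norm (f (Complex x t)))\<^sup>2) \<partial>lborel)"
        by (subst (2) nn_integral_real_affine[where c="-1" and t=0]) auto
      have "(\<integral>\<^sup>+t. indicator {a..R} x * ?g x t \<partial>lborel) =
          (\<integral>\<^sup>+t. ennreal ((norm (f (Complex x t)))\<^sup>2) + ennreal ((norm (f (Complex x (-t))))\<^sup>2) \<partial>lborel)"
        using True x by (simp add: F)
      also have "\<dots> = (\<integral>\<^sup>+t. ennreal ((norm (f (Complex x t)))\<^sup>2) \<partial>lborel) + (\<integral>\<^sup>+t. ennreal ((norm (f (Complex x (-t))))\<^sup>2) \<partial>lborel)"
        by (rule nn_integral_add) measurable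
      also have "\<dots> \<le> ennreal K + ennreal K" unfolding refl using lines[OF x] by (intro add_mono)
      finally show ?thesis using True by simp
    qed simp
  qed
  also have "\<dots> = ennreal (R - a) * (ennreal K + ennreal K)"
    using assms by (subst nn_integral_multc) auto
  also have "\<dots> = ennreal ((R - a) * (K + K))"
    using assms K by (simp add: ennreal_mult flip: ennreal_plus)
  finally show False using assms K by (simp add: L_def ennreal_le_iff)
qed

lemma line_integrable:
  assumes "0 < x" "x \<noteq> Re \<mu>"
  shows "integrable lborel (\<lambda>\<omega>. norm (f (Complex x \<omega>)) * norm (1 / (\<mu> - Complex x \<omega>)))"
    and "integrable lborel (\<lambda>\<omega>. f (Complex x \<omega>) / (\<mu> - Complex x \<omega>))"
    and "integrable lborel (\<lambda>\<omega>. (norm (1 / (\<mu> - Complex x \<omega>)))\<^sup>2)"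
    and "(\<integral>\<omega>. (norm (1 / (\<mu> - Complex x \<omega>)))\<^sup>2 \<partial>lborel) = pi / \<bar>Re \<mu> - x\<bar>"
proof -
  have [measurable]: "(\<lambda>\<omega>. f (Complex x \<omega>)) \<in> borel_measurable borel" using assms(1) by (rule line_measurable)
  have eq: "\<mu> - Complex x \<omega> = (\<mu> - of_real x) - \<i> * of_real \<omega>" for \<omega> by (simp add: Complex_eq)
  have m[measurable]: "(\<lambda>\<omega>. 1 / (\<mu> - Complex x \<omega>)) \<in> borel_measurable borel" unfolding eq by measurable
  show k: "integrable lborel (\<lambda>\<omega>. (norm (1 / (\<mu> - Complex x \<omega>)))\<^sup>2)"
    and "(\<integral>\<omega>. (norm (1 / (\<mu> - Complex x \<omega>)))\<^sup>2 \<partial>lborel) = pi / \<bar>Re \<mu> - x\<bar>"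
    unfolding eq using resolvent_L2[of "\<mu> - of_real x"] assms by auto
  show p: "integrable lborel (\<lambda>\<omega>. norm (f (Complex x \<omega>)) * norm (1 / (\<mu> - Complex x \<omega>)))"
    by (rule integrable_norm_product_L2) (use line_L2[OF assms(1)] k in auto)
  have "(\<lambda>\<omega>. f (Complex x \<omega>) * (1 / (\<mu> - Complex x \<omega>))) \<in> borel_measurable lborel" by measurable
  then show "integrable lborel (\<lambda>\<omega>. f (Complex x \<omega>) / (\<mu> - Complex x \<omega>))"
    by (intro Bochner_Integration.integrable_bound[OF p]) (auto simp: norm_divide)
qed

text \<open>
  The \<open>L\<^sup>2\<close> bound on the segment bounds the \<open>L\<^sup>1\<close> norm by \<open>R - a + 1\<close>, and the Cauchy kernel contributes
  the reciprocal of the distance from \<open>\<mu>\<close> to the segment, so the horizontal sides vanish in the limit.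
\<close>

lemma horizontal_bound:
  assumes "0 < a" "a < R" "\<bar>Im \<mu>\<bar> < \<bar>T\<bar>" and J: "integral {a..R} (\<lambda>x. (norm (f (Complex x T)))\<^sup>2) \<le> 1"
  shows "norm (integral {a..R} (\<lambda>x. f (Complex x T) / (Complex x T - \<mu>))) \<le> (R - a + 1) / (\<bar>T\<bar> - \<bar>Im \<mu>\<bar>)"
proof -
  let ?d = "\<bar>T\<bar> - \<bar>Im \<mu>\<bar>"
  have d: "?d \<le> norm (Complex x T - \<mu>)" for x
    using abs_Im_le_cmod[of "Complex x T - \<mu>"] by simp
  have nz: "Complex x T - \<mu> \<noteq> 0" for x using d[of x] assms(3) by auto
  have c: "continuous_on {a..R} (\<lambda>x. f (Complex x T))" by (rule continuous_horizontal) (use assms in auto)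
  have le: "norm (f (Complex x T) / (Complex x T - \<mu>)) \<le> (1 + (norm (f (Complex x T)))\<^sup>2) / ?d" for x
  proof -
    have "norm (f (Complex x T)) \<le> 1 + (norm (f (Complex x T)))\<^sup>2"
    proof -
      have "2 * norm (f (Complex x T)) \<le> 1 + (norm (f (Complex x T)))\<^sup>2"
        using sum_squares_bound[of 1 "norm (f (Complex x T))"] by simp
      then show ?thesis using norm_ge_zero[of "f (Complex x T)"] by linarith
    qed
    then show ?thesis unfolding norm_divide using d[of x] assms(3)
      by (intro frac_le) auto
  qed
  have "norm (integral {a..R} (\<lambda>x. f (Complex x T) / (Complex x T - \<mu>)))
      \<le> integral {a..R} (\<lambda>x. (1 + (norm (f (Complex x T)))\<^sup>2) / ?d)"
  proof (rule integral_norm_bound_integral)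
    show "(\<lambda>x. f (Complex x T) / (Complex x T - \<mu>)) integrable_on {a..R}"
      using nz unfolding Complex_eq
      by (intro integrable_continuous_real continuous_intros c[unfolded Complex_eq]) auto
    show "(\<lambda>x. (1 + (norm (f (Complex x T)))\<^sup>2) / ?d) integrable_on {a..R}"
      using assms(3) by (intro integrable_continuous_real continuous_intros c) auto
  qed (rule le)
  also have "\<dots> = (integral {a..R} (\<lambda>x. 1) + integral {a..R} (\<lambda>x. (norm (f (Complex x T)))\<^sup>2)) / ?d"
    by (subst Henstock_Kurzweil_Integration.integral_add[symmetric])
      (auto intro!: integrable_continuous_real continuous_intros c)
  also have "\<dots> \<le> (R - a + 1) / ?d" using J assms by (intro divide_right_mono) auto
  finally show ?thesis .
qed

lemma truncated_line_integral:
  assumes "0 < x" "x \<noteq> Re \<mu>" "\<And>n. real n \<le> T n"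
  shows "(\<lambda>n. integral {- T n..T n} (\<lambda>\<omega>. f (Complex x \<omega>) / (\<mu> - Complex x \<omega>)))
    \<longlonglongrightarrow> (\<integral>\<omega>. f (Complex x \<omega>) / (\<mu> - Complex x \<omega>) \<partial>lborel)"
proof -
  let ?k = "\<lambda>\<omega>. f (Complex x \<omega>) / (\<mu> - Complex x \<omega>)"
  have k: "integrable lborel ?k" by (rule line_integrable) (use assms in auto)
  have "(\<lambda>n. \<integral>\<omega>. indicator {- T n..T n} \<omega> *\<^sub>R ?k \<omega> \<partial>lborel) \<longlonglongrightarrow> integral\<^sup>L lborel ?k"
  proof (rule integral_dominated_convergence)
    show "integrable lborel (\<lambda>\<omega>. norm (?k \<omega>))" using k by simp
    show "AE \<omega> in lborel. (\<lambda>n. indicator {- T n..T n} \<omega> *\<^sub>R ?k \<omega>) \<longlonglongrightarrow> ?k \<omega>"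
    proof (intro AE_I2 tendsto_eventually)
      fix \<omega> :: real
      obtain N where "\<bar>\<omega>\<bar> \<le> real N" using real_arch_simple by blast
      then have "indicator {- T n..T n} \<omega> *\<^sub>R ?k \<omega> = ?k \<omega>" if "n \<ge> N" for n
        using assms(3)[of n] that by (auto simp: abs_le_iff indicator_def)
      then show "\<forall>\<^sub>F n in sequentially. indicator {- T n..T n} \<omega> *\<^sub>R ?k \<omega> = ?k \<omega>"
        by (auto simp: eventually_sequentially)
    qed
  qed (use k in \<open>auto split: split_indicator\<close>)
  moreover have "(\<integral>\<omega>. indicator {- T n..T n} \<omega> *\<^sub>R ?k \<omega> \<partial>lborel) = integral {- T n..T n} ?k" for n
  proof -
    have "set_integrable lborel {- T n..T n} ?k"
      unfolding set_integrable_def using k by (intro integrable_mult_indicator) auto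
    then show ?thesis using set_borel_integral_eq_integral(2) by (simp add: set_lebesgue_integral_def)
  qed
  ultimately show ?thesis by simp
qed

text \<open>
  The rectangles of \<open>small_horizontal_segments\<close> exhaust the strip between two vertical lines.
\<close>

lemma Cauchy_strip:
  assumes "0 < a" "a < Re \<mu>" "Re \<mu> < R"
  shows "(\<integral>\<omega>. f (Complex a \<omega>) / (\<mu> - Complex a \<omega>) \<partial>lborel)
      - (\<integral>\<omega>. f (Complex R \<omega>) / (\<mu> - Complex R \<omega>) \<partial>lborel) = 2 * pi * f \<mu>"
proof -
  have "\<forall>n. \<exists>T>\<bar>Im \<mu>\<bar> + real n + 1. integral {a..R} (\<lambda>x. (norm (f (Complex x T)))\<^sup>2) \<le> 1 \<and>
      integral {a..R} (\<lambda>x. (norm (f (Complex x (-T))))\<^sup>2) \<le> 1"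
    by (intro allI small_horizontal_segments) (use assms in auto)
  then obtain T where T: "\<And>n. T n > \<bar>Im \<mu>\<bar> + real n + 1"
     "\<And>n. integral {a..R} (\<lambda>x. (norm (f (Complex x (T n))))\<^sup>2) \<le> 1"
     "\<And>n. integral {a..R} (\<lambda>x. (norm (f (Complex x (- T n))))\<^sup>2) \<le> 1"
    by metis
  let ?A = "\<lambda>n. integral {- T n..T n} (\<lambda>\<omega>. f (Complex a \<omega>) / (\<mu> - Complex a \<omega>))"
  let ?B = "\<lambda>n. integral {- T n..T n} (\<lambda>\<omega>. f (Complex R \<omega>) / (\<mu> - Complex R \<omega>))"
  let ?h = "\<lambda>t. integral {a..R} (\<lambda>x. f (Complex x t) / (Complex x t - \<mu>))"
  have Tn: "real n \<le> T n" for n using T(1)[of n] by simp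
  have small: "(R - a + 1) / (\<bar>T n\<bar> - \<bar>Im \<mu>\<bar>) \<le> (R - a + 1) * inverse (real (Suc n))" for n
  proof -
    have "(R - a + 1) / (\<bar>T n\<bar> - \<bar>Im \<mu>\<bar>) \<le> (R - a + 1) / (real (Suc n))"
      using assms T(1)[of n] by (intro divide_left_mono) auto
    then show ?thesis by (simp add: divide_inverse)
  qed
  have z: "(\<lambda>n. (R - a + 1) * inverse (real (Suc n))) \<longlonglongrightarrow> 0"
    by (rule tendsto_mult_right_zero) (rule LIMSEQ_inverse_real_of_nat)
  have lt: "\<bar>Im \<mu>\<bar> < \<bar>T n\<bar>" "\<bar>Im \<mu>\<bar> < \<bar>- T n\<bar>" for n using T(1)[of n] by auto
  have "norm (?h (T n)) \<le> (R - a + 1) * inverse (real (Suc n))"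
       "norm (?h (- T n)) \<le> (R - a + 1) * inverse (real (Suc n))" for n
    using horizontal_bound[of a R \<mu> "T n"] horizontal_bound[of a R \<mu> "- T n"] lt[of n] T(2,3)[of n] small[of n] assms
    by auto
  then have h: "(\<lambda>n. ?h (T n)) \<longlonglongrightarrow> 0" "(\<lambda>n. ?h (- T n)) \<longlonglongrightarrow> 0"
    by (auto intro!: Lim_null_comparison[OF _ z])
  have "(\<lambda>n. ?A n - ?B n + \<i> * (?h (T n) - ?h (- T n))) \<longlonglongrightarrow>
      (\<integral>\<omega>. f (Complex a \<omega>) / (\<mu> - Complex a \<omega>) \<partial>lborel)
      - (\<integral>\<omega>. f (Complex R \<omega>) / (\<mu> - Complex R \<omega>) \<partial>lborel) + \<i> * (0 - 0)"
    using assms by (intro tendsto_intros truncated_line_integral h Tn) auto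
  moreover have "?A n - ?B n + \<i> * (?h (T n) - ?h (- T n)) = 2 * pi * f \<mu>" for n
    by (rule Cauchy_rectangle[OF hol]) (use assms T(1)[of n] in auto)
  ultimately have "(\<lambda>n. 2 * pi * f \<mu>) \<longlonglongrightarrow> (\<integral>\<omega>. f (Complex a \<omega>) / (\<mu> - Complex a \<omega>) \<partial>lborel)
      - (\<integral>\<omega>. f (Complex R \<omega>) / (\<mu> - Complex R \<omega>) \<partial>lborel)" by simp
  then show ?thesis by (simp add: LIMSEQ_const_iff)
qed

text \<open>
  On the line at distance \<open>x\<close> to the right of \<open>\<mu>\<close> the squared norm of the Cauchy kernel is \<open>pi / x\<close>, so
  the Cauchy integral is of order \<open>1 / sqrt x\<close>. The distances \<open>(real (Suc n))\<^sup>2\<close> keep square roots out of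
  the weighted inequality between arithmetic and geometric mean.
\<close>

lemma far_line_integral:
  assumes "0 < Re \<mu>"
  shows "(\<lambda>n. \<integral>\<omega>. f (Complex (Re \<mu> + (real (Suc n))\<^sup>2) \<omega>) / (\<mu> - Complex (Re \<mu> + (real (Suc n))\<^sup>2) \<omega>) \<partial>lborel) \<longlonglongrightarrow> 0"
proof (rule Lim_null_comparison[OF always_eventually[OF allI]])
  show "(\<lambda>n. (K + pi) * inverse (real (Suc n))) \<longlonglongrightarrow> 0"
    by (rule tendsto_mult_right_zero) (rule LIMSEQ_inverse_real_of_nat)
  fix n
  let ?m = "real (Suc n)"
  let ?R = "Re \<mu> + ?m\<^sup>2"
  let ?f = "\<lambda>\<omega>. norm (f (Complex ?R \<omega>))" and ?k = "\<lambda>\<omega>. norm (1 / (\<mu> - Complex ?R \<omega>))"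
  have R: "0 < ?R" "?R \<noteq> Re \<mu>" using assms by (auto simp: add_pos_nonneg)
  note li = line_integrable[OF R] line_L2[OF R(1)]
  have amgm: "a * b \<le> a\<^sup>2 / ?m + ?m * b\<^sup>2" if "0 \<le> a" "0 \<le> b" for a b :: real
  proof -
    have "2 * a * (?m * b) \<le> a\<^sup>2 + (?m * b)\<^sup>2" by (rule sum_squares_bound)
    moreover have "0 \<le> a * (?m * b)" using that by (intro mult_nonneg_nonneg) auto
    ultimately have "?m * (a * b) \<le> ?m * (a\<^sup>2 / ?m + ?m * b\<^sup>2)"
      by (simp add: algebra_simps power2_eq_square del: of_nat_Suc)
    then show ?thesis by (simp del: of_nat_Suc)
  qed
  have "norm (\<integral>\<omega>. f (Complex ?R \<omega>) / (\<mu> - Complex ?R \<omega>) \<partial>lborel) \<le> (\<integral>\<omega>. ?f \<omega> * ?k \<omega> \<partial>lborel)"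
    using integral_norm_bound[of lborel "\<lambda>\<omega>. f (Complex ?R \<omega>) / (\<mu> - Complex ?R \<omega>)"] by (simp add: norm_divide)
  also have "\<dots> \<le> (\<integral>\<omega>. (?f \<omega>)\<^sup>2 / ?m + ?m * (?k \<omega>)\<^sup>2 \<partial>lborel)"
    by (intro integral_mono li Bochner_Integration.integrable_add integrable_divide_zero integrable_mult_right) (rule amgm; simp)
  also have "\<dots> = (\<integral>\<omega>. (?f \<omega>)\<^sup>2 \<partial>lborel) / ?m + ?m * (\<integral>\<omega>. (?k \<omega>)\<^sup>2 \<partial>lborel)"
    using li by (subst Bochner_Integration.integral_add) auto
  also have "(\<integral>\<omega>. (?k \<omega>)\<^sup>2 \<partial>lborel) = pi / ?m\<^sup>2" using li(4) by simp
  also have "(\<integral>\<omega>. (?f \<omega>)\<^sup>2 \<partial>lborel) / ?m + ?m * (pi / ?m\<^sup>2) \<le> K / ?m + ?m * (pi / ?m\<^sup>2)"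
    using li by (intro add_right_mono divide_right_mono) auto
  also have "\<dots> = (K + pi) * inverse ?m" by (simp add: power2_eq_square field_simps del: of_nat_Suc)
  finally show "norm (\<integral>\<omega>. f (Complex ?R \<omega>) / (\<mu> - Complex ?R \<omega>) \<partial>lborel) \<le> (K + pi) * inverse ?m" .
qed

lemma Cauchy_line:
  assumes "0 < a" "a < Re \<mu>"
  shows "(\<integral>\<omega>. f (Complex a \<omega>) / (\<mu> - Complex a \<omega>) \<partial>lborel) = 2 * pi * f \<mu>"
proof -
  let ?I = "\<lambda>x. \<integral>\<omega>. f (Complex x \<omega>) / (\<mu> - Complex x \<omega>) \<partial>lborel"
  let ?R = "\<lambda>n. Re \<mu> + (real (Suc n))\<^sup>2"
  have "(\<lambda>n. ?I a - ?I (?R n)) \<longlonglongrightarrow> ?I a - 0"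
    using assms by (intro tendsto_intros far_line_integral) auto
  moreover have "?I a - ?I (?R n) = 2 * pi * f \<mu>" for n
    by (rule Cauchy_strip) (use assms in auto)
  ultimately show ?thesis by (simp add: LIMSEQ_const_iff)
qed

text \<open>
  Applying the formula on the line \<open>Re s = x\<close> at the point \<open>\<mu> + x\<close> leaves the kernel independent of
  \<open>x\<close>, so that the limit \<open>x \<rightarrow> 0\<close> is exactly weak convergence of the boundary values.
\<close>

theorem Cauchy_boundary:
  assumes "0 < Re \<mu>"
  shows "(\<integral>\<omega>. f (\<i> * of_real \<omega>) * (1 / (\<mu> - \<i> * of_real \<omega>)) \<partial>lborel) = 2 * pi * f \<mu>"
proof -
  let ?X = "\<lambda>n. inverse (real (Suc n))"
  have X: "?X \<longlonglongrightarrow> 0" "\<And>n. 0 < ?X n" using LIMSEQ_inverse_real_of_nat by auto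
  have lim1: "(\<lambda>n. \<integral>\<omega>. f (Complex (?X n) \<omega>) * (1 / (\<mu> - \<i> * of_real \<omega>)) \<partial>lborel)
      \<longlonglongrightarrow> (\<integral>\<omega>. f (\<i> * of_real \<omega>) * (1 / (\<mu> - \<i> * of_real \<omega>)) \<partial>lborel)"
    by (rule weak_convergence_L2[OF _ _ _ boundary_sequence[OF X] line_L2[OF X(2)] boundary_L2 resolvent_L2(1)])
      (use assms boundary_measurable line_measurable[OF X(2)] in \<open>auto simp del: of_nat_Suc\<close>)
  have line: "(\<integral>\<omega>. f (Complex x \<omega>) * (1 / (\<mu> - \<i> * of_real \<omega>)) \<partial>lborel) = 2 * pi * f (\<mu> + of_real x)"
    if "0 < x" for x
  proof -
    have eq: "\<mu> + of_real x - Complex x \<omega> = \<mu> - \<i> * of_real \<omega>" for \<omega> by (simp add: Complex_eq)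
    show ?thesis using Cauchy_line[of x "\<mu> + of_real x"] assms that unfolding eq by simp
  qed
  have lim2: "(\<lambda>n. 2 * pi * f (\<mu> + of_real (?X n))) \<longlonglongrightarrow> 2 * pi * f (\<mu> + of_real 0)"
  proof (intro tendsto_intros isCont_tendsto_compose[of _ f] X)
    show "isCont f (\<mu> + of_real 0)"
      using holomorphic_on_imp_continuous_on[OF hol] assms
      by (simp add: continuous_on_eq_continuous_at open_halfspace_Re_gt)
  qed
  show ?thesis using LIMSEQ_unique[OF lim1[unfolded line[OF X(2)]] lim2] by simp
qed

lemma boundary_pairing_integrable:
  assumes "0 < Re \<mu>"
  shows "integrable lborel (\<lambda>\<omega>. f (\<i> * of_real \<omega>) * (1 / (\<mu> - \<i> * of_real \<omega>)))"
proof -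
  note [measurable] = boundary_measurable
  have "integrable lborel (\<lambda>\<omega>. norm (f (\<i> * of_real \<omega>)) * norm (1 / (\<mu> - \<i> * of_real \<omega>)))"
    by (rule integrable_norm_product_L2) (use boundary_L2 resolvent_L2[of \<mu>] assms in auto)
  then show ?thesis
    by (rule Bochner_Integration.integrable_bound) (auto simp: norm_mult norm_divide)
qed

lemma boundary_pairing_square_integrable:
  assumes "0 < Re \<mu>"
  shows "integrable lborel (\<lambda>\<omega>. f (\<i> * of_real \<omega>) * (1 / (\<mu> - \<i> * of_real \<omega>))\<^sup>2)"
proof -
  note [measurable] = boundary_measurable
  have le: "norm (1 / (\<mu> - \<i> * of_real \<omega>)) \<le> 1 / Re \<mu>" for \<omega>
  proof -
    have "Re \<mu> \<le> norm (\<mu> - \<i> * of_real \<omega>)"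
      using complex_Re_le_cmod[of "\<mu> - \<i> * of_real \<omega>"] by simp
    then show ?thesis unfolding norm_divide norm_one using assms by (intro divide_left_mono mult_pos_pos) auto
  qed
  show ?thesis
  proof (rule Bochner_Integration.integrable_bound)
    show "integrable lborel (\<lambda>\<omega>. (1 / Re \<mu>) * norm (f (\<i> * of_real \<omega>) * (1 / (\<mu> - \<i> * of_real \<omega>))))"
      using boundary_pairing_integrable[OF assms] by (intro integrable_mult_right integrable_norm)
    have "norm (f (\<i> * of_real \<omega>) * (1 / (\<mu> - \<i> * of_real \<omega>))\<^sup>2)
        \<le> (1 / Re \<mu>) * norm (f (\<i> * of_real \<omega>) * (1 / (\<mu> - \<i> * of_real \<omega>)))" for \<omega>
    proof -
      have "norm (f (\<i> * of_real \<omega>) * (1 / (\<mu> - \<i> * of_real \<omega>))\<^sup>2)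
        = norm (1 / (\<mu> - \<i> * of_real \<omega>)) * norm (f (\<i> * of_real \<omega>) * (1 / (\<mu> - \<i> * of_real \<omega>)))"
        by (simp only: power2_eq_square norm_mult mult_ac)
      also have "\<dots> \<le> (1 / Re \<mu>) * norm (f (\<i> * of_real \<omega>) * (1 / (\<mu> - \<i> * of_real \<omega>)))"
        by (intro mult_right_mono le) simp
      finally show ?thesis .
    qed
    then show "AE \<omega> in lborel. norm (f (\<i> * of_real \<omega>) * (1 / (\<mu> - \<i> * of_real \<omega>))\<^sup>2)
        \<le> norm ((1 / Re \<mu>) * norm (f (\<i> * of_real \<omega>) * (1 / (\<mu> - \<i> * of_real \<omega>))))"
      using assms by simp
  qed simp
qed

text \<open>
  The difference quotient of the kernel at \<open>\<mu>\<close> and \<open>\<mu> + x\<close> is, up to sign, the product of the two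
  kernels; moving to the right keeps the second factor below \<open>1 / Re \<mu>\<close>, which dominates the limit.
\<close>

theorem Cauchy_boundary_deriv:
  assumes "0 < Re \<mu>"
  shows "(\<integral>\<omega>. f (\<i> * of_real \<omega>) * (1 / (\<mu> - \<i> * of_real \<omega>))\<^sup>2 \<partial>lborel) = - 2 * pi * deriv f \<mu>"
proof -
  note [measurable] = boundary_measurable
  let ?X = "\<lambda>n. inverse (real (Suc n))"
  let ?u = "\<lambda>\<omega>. f (\<i> * of_real \<omega>) * (1 / (\<mu> - \<i> * of_real \<omega>))"
  let ?g = "\<lambda>n \<omega>. ?u \<omega> * (1 / (\<mu> + of_real (?X n) - \<i> * of_real \<omega>))"
  have X: "?X \<longlonglongrightarrow> 0" "\<And>n. 0 < ?X n" using LIMSEQ_inverse_real_of_nat by auto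
  have nz: "\<mu> + of_real x - \<i> * of_real \<omega> \<noteq> 0" "Re \<mu> \<le> norm (\<mu> + of_real x - \<i> * of_real \<omega>)" if "0 \<le> x" for \<omega> x
    using assms that complex_Re_le_cmod[of "\<mu> + of_real x - \<i> * of_real \<omega>"] by (auto simp: complex_eq_iff)
  have u: "integrable lborel ?u" using assms by (rule boundary_pairing_integrable)
  have gb: "norm (?g n \<omega>) \<le> norm (?u \<omega>) * (1 / Re \<mu>)" for n \<omega>
    unfolding norm_mult using assms nz[of "?X n" \<omega>] X(2)[of n]
    by (intro mult_left_mono) (auto simp: norm_divide simp del: of_nat_Suc intro!: divide_left_mono mult_pos_pos)
  have gi: "integrable lborel (?g n)" for n
    by (rule Bochner_Integration.integrable_bound[of _ "\<lambda>\<omega>. norm (?u \<omega>) * (1 / Re \<mu>)"])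
      (use u gb assms in \<open>auto simp del: of_nat_Suc\<close>)
  have lim1: "(\<lambda>n. integral\<^sup>L lborel (?g n)) \<longlonglongrightarrow> (\<integral>\<omega>. ?u \<omega> * (1 / (\<mu> + of_real 0 - \<i> * of_real \<omega>)) \<partial>lborel)"
  proof (rule integral_dominated_convergence)
    show "integrable lborel (\<lambda>\<omega>. norm (?u \<omega>) * (1 / Re \<mu>))" using u by (intro integrable_mult_left integrable_norm)
    show "AE \<omega> in lborel. (\<lambda>n. ?g n \<omega>) \<longlonglongrightarrow> ?u \<omega> * (1 / (\<mu> + of_real 0 - \<i> * of_real \<omega>))"
      by (intro AE_I2 tendsto_intros X nz) auto
  qed (use gb in auto)
  have quot: "integral\<^sup>L lborel (?g n) = - 2 * pi * ((f (\<mu> + of_real (?X n)) - f \<mu>) / of_real (?X n))" for n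
  proof -
    let ?x = "of_real (?X n) :: complex"
    have x: "?x \<noteq> 0" using X(2)[of n] by (simp del: of_nat_Suc)
    have split: "?g n \<omega> = (?u \<omega> - f (\<i> * of_real \<omega>) * (1 / (\<mu> + ?x - \<i> * of_real \<omega>))) / ?x" for \<omega>
      using x nz[of 0 \<omega>] nz[of "?X n" \<omega>] X(2)[of n] by (simp add: divide_simps del: of_nat_Suc) (simp add: algebra_simps)
    have pos: "0 < Re (\<mu> + ?x)"
      using assms X(2)[of n] by (simp only: plus_complex.sel Re_complex_of_real add_pos_pos)
    have v: "integrable lborel (\<lambda>\<omega>. f (\<i> * of_real \<omega>) * (1 / (\<mu> + ?x - \<i> * of_real \<omega>)))"
      by (rule boundary_pairing_integrable[OF pos])
    have "integral\<^sup>L lborel (?g n) = (integral\<^sup>L lborel ?u - (\<integral>\<omega>. f (\<i> * of_real \<omega>) * (1 / (\<mu> + ?x - \<i> * of_real \<omega>)) \<partial>lborel)) / ?x"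
      unfolding split integral_divide_zero Bochner_Integration.integral_diff[OF u v] ..
    also have "\<dots> = (2 * pi * f \<mu> - 2 * pi * f (\<mu> + ?x)) / ?x"
      unfolding Cauchy_boundary[OF assms] Cauchy_boundary[OF pos] ..
    also have "\<dots> = - 2 * pi * ((f (\<mu> + ?x) - f \<mu>) / ?x)"
      using x by (simp add: field_simps del: of_nat_Suc)
    finally show ?thesis .
  qed
  have lim2: "(\<lambda>n. - 2 * pi * ((f (\<mu> + of_real (?X n)) - f \<mu>) / of_real (?X n))) \<longlonglongrightarrow> - 2 * pi * deriv f \<mu>"
  proof (intro tendsto_intros)
    have "(f has_field_derivative deriv f \<mu>) (at \<mu>)"
      using hol assms by (intro holomorphic_derivI[of _ "{s. 0 < Re s}"]) (auto simp: open_halfspace_Re_gt)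
    then have lim: "((\<lambda>h. (f (\<mu> + h) - f \<mu>) / h) \<longlongrightarrow> deriv f \<mu>) (at 0)" by (simp add: DERIV_def)
    have "(\<lambda>n. of_real (?X n) :: complex) \<longlonglongrightarrow> of_real 0" by (intro tendsto_intros X)
    then have "filterlim (\<lambda>n. of_real (?X n) :: complex) (at 0) sequentially"
      using X(2) by (auto simp: filterlim_at less_imp_neq[THEN not_sym] simp del: of_nat_Suc)
    from filterlim_compose[OF lim this]
    show "(\<lambda>n. (f (\<mu> + of_real (?X n)) - f \<mu>) / of_real (?X n)) \<longlonglongrightarrow> deriv f \<mu>" .
  qed
  have "(\<integral>\<omega>. ?u \<omega> * (1 / (\<mu> + of_real 0 - \<i> * of_real \<omega>)) \<partial>lborel) = - 2 * pi * deriv f \<mu>"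
    using LIMSEQ_unique[OF lim1[unfolded quot] lim2] .
  then show ?thesis by (simp add: power2_eq_square)
qed

end

section \<open>Pole-residue form of a diagonal model\<close>

lemma matrix_inv_eqI:
  fixes A B :: "complex^'r^'r"
  assumes "A ** B = mat 1" "B ** A = mat 1"
  shows "matrix_inv A = B"
proof -
  have "A ** matrix_inv A = mat 1 \<and> matrix_inv A ** A = mat 1"
    unfolding matrix_inv_def by (rule someI[of _ B]) (use assms in auto)
  then have "matrix_inv A = (B ** A) ** matrix_inv A" "A ** matrix_inv A = mat 1"
    using assms by (auto simp: matrix_mul_lid)
  then show ?thesis by (metis matrix_mul_assoc matrix_mul_rid)
qed

lemma shifted_diagonal:
  assumes "diagonal_matrix M"
  shows "mat s - M = (\<chi> i j. if i = j then s - M $ i $ i else 0)"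
  using assms by (simp add: vec_eq_iff mat_def diagonal_matrix_def)

lemma matrix_inv_diagonal:
  assumes "diagonal_matrix M" "\<And>l. s \<noteq> M $ l $ l"
  shows "matrix_inv (mat s - M) = (\<chi> i j. if i = j then 1 / (s - M $ i $ i) else 0)"
  unfolding shifted_diagonal[OF assms(1)]
  by (rule matrix_inv_eqI)
    (use assms(2) in \<open>simp_all add: vec_eq_iff matrix_matrix_mult_def mat_def
      if_distrib[where f="\<lambda>x. x * _"] if_distrib[where f="\<lambda>x. _ * x"] sum.delta sum.delta' cong: if_cong\<close>)

text \<open>
  On singular matrices \<^const>\<open>matrix_inv\<close> is a choice from the empty set, hence one and the same unknown
  matrix for all of them. This is what makes the model measurable across its poles.
\<close>

lemma matrix_inv_singular:
  fixes M :: "complex^'r^'r"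
  assumes "diagonal_matrix M" "s = M $ l $ l"
  shows "matrix_inv (mat s - M) = matrix_inv 0"
proof -
  have "((mat s - M) ** X) $ l $ l = 0" for X :: "complex^'r^'r"
    unfolding shifted_diagonal[OF assms(1)]
    using assms(2) by (simp add: matrix_matrix_mult_def if_distrib[where f="\<lambda>x. x * _"] cong: if_cong)
  moreover have "(0 ** X) $ l $ l = (0::complex)" for X :: "complex^'r^'r"
    by (simp add: matrix_matrix_mult_def)
  moreover have "(mat 1 :: complex^'r^'r) $ l $ l = 1" by (simp add: mat_def)
  ultimately have "(mat s - M) ** X \<noteq> mat 1" "0 ** X \<noteq> mat 1" for X :: "complex^'r^'r"
    by (metis zero_neq_one)+
  then show ?thesis unfolding matrix_inv_def by simp
qed

definition cscale :: "complex \<Rightarrow> complex^'n^'m \<Rightarrow> complex^'n^'m" where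
  "cscale z N = (\<chi> i j. z * N $ i $ j)"

definition rank_one :: "'r \<Rightarrow> complex^'r^'o \<Rightarrow> complex^'i^'r \<Rightarrow> complex^'i^'o" where
  "rank_one l C B = (\<chi> i j. C $ i $ l * B $ l $ j)"

lemma cscale_nth[simp]: "cscale z N $ i $ j = z * N $ i $ j" by (simp add: cscale_def)

lemma rank_one_nth[simp]: "rank_one l C B $ i $ j = C $ i $ l * B $ l $ j" by (simp add: rank_one_def)

lemma resolvent_expansion:
  assumes "diagonal_matrix M" "\<And>l. s \<noteq> M $ l $ l"
  shows "C ** matrix_inv (mat s - M) ** B = (\<Sum>l\<in>UNIV. cscale (1 / (s - M $ l $ l)) (rank_one l C B))"
  unfolding matrix_inv_diagonal[OF assms]
  by (simp add: vec_eq_iff matrix_matrix_mult_def sum_component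
      if_distrib[where f="\<lambda>x. x * _"] if_distrib[where f="\<lambda>x. _ * x"] sum.delta sum.delta' cong: if_cong)

lemma norm_matrix_power2: 
  fixes N :: "complex^'n^'m"
  shows "(norm N)\<^sup>2 = (\<Sum>i\<in>UNIV. \<Sum>j\<in>UNIV. (norm (N $ i $ j))\<^sup>2)"
  by (simp add: power2_norm_eq_inner inner_vec_def)

lemma norm_entry_le:
  fixes N :: "complex^'n^'m"
  shows "norm (N $ i $ j) \<le> norm N"
  using Finite_Cartesian_Product.norm_nth_le[of "N $ i" j] Finite_Cartesian_Product.norm_nth_le[of N i] by linarith

lemma norm_cscale: 
  fixes N :: "complex^'n^'m"
  shows "norm (cscale z N) = norm z * norm N"
proof -
  have "(norm (cscale z N))\<^sup>2 = (norm z * norm N)\<^sup>2"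
    unfolding norm_matrix_power2 power_mult_distrib by (simp add: norm_mult power_mult_distrib sum_distrib_left)
  then show ?thesis by simp
qed

text \<open>
  The squared norm of an outer product factors into the squared norms of the column and the row.
\<close>

lemma norm_rank_one: 
  fixes C :: "complex^'r^'o" and B :: "complex^'i^'r"
  shows "norm (rank_one l C B) \<le> norm C * norm B"
proof -
  have "(\<Sum>i\<in>UNIV. (norm (C $ i $ l))\<^sup>2) \<le> (norm C)\<^sup>2"
    unfolding norm_matrix_power2 by (intro sum_mono member_le_sum) auto
  moreover have "(\<Sum>j\<in>UNIV. (norm (B $ l $ j))\<^sup>2) \<le> (norm B)\<^sup>2"
    unfolding norm_matrix_power2 
    by (rule member_le_sum[of l UNIV "\<lambda>l. \<Sum>j\<in>UNIV. (norm (B $ l $ j))\<^sup>2"]) (auto intro!: sum_nonneg)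
  ultimately have "(\<Sum>i\<in>UNIV. (norm (C $ i $ l))\<^sup>2) * (\<Sum>j\<in>UNIV. (norm (B $ l $ j))\<^sup>2) \<le> (norm C)\<^sup>2 * (norm B)\<^sup>2"
    by (intro mult_mono) (auto intro!: sum_nonneg)
  also have "(\<Sum>i\<in>UNIV. (norm (C $ i $ l))\<^sup>2) * (\<Sum>j\<in>UNIV. (norm (B $ l $ j))\<^sup>2) = (norm (rank_one l C B))\<^sup>2"
    unfolding norm_matrix_power2 by (simp add: sum_product norm_mult power_mult_distrib)
  finally show ?thesis by (simp flip: power_mult_distrib add: power2_le_iff_abs_le)
qed

lemma inner_cscale:
  fixes F N :: "complex^'n^'m"
  shows "F \<bullet> cscale z N = Re (\<Sum>i\<in>UNIV. \<Sum>j\<in>UNIV. F $ i $ j * cnj (z * N $ i $ j))"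
  by (simp add: inner_vec_def Re_sum inner_complex_def algebra_simps)

lemma cscale_cscale: "cscale z (cscale w M) = cscale (z * w) M"
  by (simp add: vec_eq_iff algebra_simps)

lemma scaleR_cscale:
  fixes M :: "complex^'n^'m"
  shows "t *\<^sub>R cscale z M = cscale (of_real t * z) M"
  by (simp add: vec_eq_iff scaleR_conv_of_real[where 'a=complex])

lemma borel_measurable_matrixI:
  fixes F :: "'x \<Rightarrow> complex^'n^'m"
  assumes "\<And>i j. (\<lambda>x. F x $ i $ j) \<in> borel_measurable M"
  shows "F \<in> borel_measurable M"
  unfolding borel_measurable_euclidean_space[of F]
  using assms by (auto simp: Basis_vec_def inner_axis)

lemma borel_measurable_matrix_nth:
  fixes F :: "'x \<Rightarrow> complex^'n^'m"
  assumes "F \<in> borel_measurable M"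
  shows "(\<lambda>x. F x $ i $ j) \<in> borel_measurable M"
  by (rule borel_measurable_continuous_on[OF _ assms]) (intro continuous_intros)

lemma borel_measurable_cscale:
  fixes N :: "'x \<Rightarrow> complex^'n^'m"
  assumes [measurable]: "z \<in> borel_measurable M" and N: "N \<in> borel_measurable M"
  shows "(\<lambda>x. cscale (z x) (N x)) \<in> borel_measurable M"
  using borel_measurable_matrix_nth[OF N] by (intro borel_measurable_matrixI) simp

lemma borel_measurable_rank_one:
  fixes C :: "'x \<Rightarrow> complex^'r^'o" and B :: "'x \<Rightarrow> complex^'i^'r"
  assumes "C \<in> borel_measurable M" "B \<in> borel_measurable M"
  shows "(\<lambda>x. rank_one l (C x) (B x)) \<in> borel_measurable M"
  using borel_measurable_matrix_nth[OF assms(1)] borel_measurable_matrix_nth[OF assms(2)] 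
  by (intro borel_measurable_matrixI) simp

lemma borel_measurable_matrix_mult:
  fixes C :: "'x \<Rightarrow> complex^'r^'o" and B :: "'x \<Rightarrow> complex^'i^'r"
  assumes "C \<in> borel_measurable M" "B \<in> borel_measurable M"
  shows "(\<lambda>x. C x ** B x) \<in> borel_measurable M"
  using borel_measurable_matrix_nth[OF assms(1)] borel_measurable_matrix_nth[OF assms(2)] 
  by (intro borel_measurable_matrixI) (simp add: matrix_matrix_mult_def)

lemma borel_measurable_param_sum:
  fixes M :: "(complex^'n^'m)^'k"
  assumes [measurable]: "\<And>k. \<phi> k \<in> borel_measurable \<nu>"
  shows "param_sum \<phi> M \<in> borel_measurable \<nu>"
  unfolding param_sum_def by measurable

lemma diagonal_param_sum:
  assumes "\<And>k. diagonal_matrix (A $ k)"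
  shows "diagonal_matrix (param_sum \<phi> A q)"
  using assms by (simp add: diagonal_matrix_def param_sum_def sum_component)

lemma norm_param_sum:
  fixes M :: "(complex^'n^'m)^'k"
  shows "norm (param_sum \<phi> M q) \<le> (\<Sum>k\<in>UNIV. norm (M $ k)) * (\<Sum>k\<in>UNIV. \<bar>\<phi> k q\<bar>)"
proof -
  have "norm (param_sum \<phi> M q) \<le> (\<Sum>k\<in>UNIV. \<bar>\<phi> k q\<bar> * norm (M $ k))"
    unfolding param_sum_def by (rule order_trans[OF norm_sum]) simp
  also have "\<dots> \<le> (\<Sum>k\<in>UNIV. \<bar>\<phi> k q\<bar> * (\<Sum>k\<in>UNIV. norm (M $ k)))"
    by (intro sum_mono mult_left_mono member_le_sum) auto
  also have "\<dots> = (\<Sum>k\<in>UNIV. norm (M $ k)) * (\<Sum>k\<in>UNIV. \<bar>\<phi> k q\<bar>)"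
    unfolding sum_distrib_right[symmetric] by (rule mult.commute)
  finally show ?thesis .
qed

lemma rom_eq: "rom \<alpha> \<beta> \<gamma> (A, B, C) s q =
    param_sum \<gamma> C q ** matrix_inv (mat s - param_sum \<alpha> A q) ** param_sum \<beta> B q"
  by (simp add: rom_def)

lemma rom_expansion:
  assumes "\<And>k. diagonal_matrix (A $ k)" "\<And>l. s \<noteq> param_sum \<alpha> A q $ l $ l"
  shows "rom \<alpha> \<beta> \<gamma> (A, B, C) s q =
    (\<Sum>l\<in>UNIV. cscale (1 / (s - param_sum \<alpha> A q $ l $ l)) (rank_one l (param_sum \<gamma> C q) (param_sum \<beta> B q)))"
  unfolding rom_eq by (rule resolvent_expansion[OF diagonal_param_sum]) (use assms in auto)

lemma rom_measurable:
  fixes A :: "(complex^'r^'r)^'a::finite" and B :: "(complex^'i^'r)^'b::finite" and C :: "(complex^'r^'o)^'c::finite"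
  assumes [measurable]: "\<And>k. \<alpha> k \<in> borel_measurable \<nu>" "\<And>k. \<beta> k \<in> borel_measurable \<nu>" "\<And>k. \<gamma> k \<in> borel_measurable \<nu>"
    and diag: "\<And>k. diagonal_matrix (A $ k)"
  shows "(\<lambda>(s, q). rom \<alpha> \<beta> \<gamma> (A, B, C) s q) \<in> borel_measurable (restrict_space borel {s. 0 \<le> Re s} \<Otimes>\<^sub>M \<nu>)"
proof -
  let ?P = "restrict_space borel {s. 0 \<le> Re s} \<Otimes>\<^sub>M \<nu>"
  let ?l = "\<lambda>l q. param_sum \<alpha> A q $ l $ l"
  let ?C = "param_sum \<gamma> C" and ?B = "param_sum \<beta> B"
  have [measurable]: "?C \<in> borel_measurable \<nu>" "?B \<in> borel_measurable \<nu>" "\<And>l. ?l l \<in> borel_measurable \<nu>"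
    by (auto intro!: borel_measurable_param_sum borel_measurable_matrix_nth)
  have [measurable]: "fst \<in> borel_measurable ?P"
    by (rule measurable_compose[OF measurable_fst]) (auto intro: measurable_restrict_space1)
  have eq: "rom \<alpha> \<beta> \<gamma> (A, B, C) s q = (if \<exists>l. s = ?l l q then ?C q ** matrix_inv 0 ** ?B q
      else (\<Sum>l\<in>UNIV. cscale (1 / (s - ?l l q)) (rank_one l (?C q) (?B q))))" for s q
  proof (cases "\<exists>l. s = ?l l q")
    case True
    then obtain l where "s = ?l l q" by blast
    from matrix_inv_singular[OF diagonal_param_sum[OF diag] this] True show ?thesis by (simp add: rom_eq)
  next
    case False
    then show ?thesis using rom_expansion[OF diag, of s \<alpha> q] by auto
  qed
  have "(\<lambda>p. if \<exists>l. fst p = ?l l (snd p) then ?C (snd p) ** matrix_inv 0 ** ?B (snd p)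
      else (\<Sum>l\<in>UNIV. cscale (1 / (fst p - ?l l (snd p))) (rank_one l (?C (snd p)) (?B (snd p))))) \<in> borel_measurable ?P"
  proof (rule measurable_If)
    show "(\<lambda>p. ?C (snd p) ** matrix_inv 0 ** ?B (snd p)) \<in> borel_measurable ?P"
      by (intro borel_measurable_matrix_mult) measurable
    show "(\<lambda>p. \<Sum>l\<in>UNIV. cscale (1 / (fst p - ?l l (snd p))) (rank_one l (?C (snd p)) (?B (snd p)))) \<in> borel_measurable ?P"
      by (intro borel_measurable_sum borel_measurable_cscale borel_measurable_rank_one) measurable
    show "{p \<in> space ?P. \<exists>l. fst p = ?l l (snd p)} \<in> sets ?P" by measurable
  qed
  then show ?thesis by (simp add: eq split_beta')
qed

section \<open>Stable models belong to the Hardy space\<close>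

lemma hardy2_cong:
  assumes "\<And>s. 0 \<le> Re s \<Longrightarrow> F s = G s" "F \<in> hardy2"
  shows "G \<in> hardy2"
proof -
  have eq: "G (Complex x \<omega>) = F (Complex x \<omega>)" if "0 < x" for x \<omega> using assms(1)[of "Complex x \<omega>"] that by simp
  have eq0: "G (\<i> * of_real \<omega>) = F (\<i> * of_real \<omega>)" for \<omega> using assms(1)[of "\<i> * of_real \<omega>"] by simp
  have "((\<lambda>x. G (Complex x \<omega>)) \<longlongrightarrow> c) (at_right 0) \<longleftrightarrow> ((\<lambda>x. F (Complex x \<omega>)) \<longlongrightarrow> c) (at_right 0)" for c \<omega>
    by (intro filterlim_cong) (auto simp: eq eventually_at_right_less[of 0, THEN eventually_mono])
  moreover have "(\<lambda>s. G s $ i $ j) holomorphic_on {s. 0 < Re s} \<longleftrightarrow> (\<lambda>s. F s $ i $ j) holomorphic_on {s. 0 < Re s}" for i j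
    by (rule holomorphic_cong) (use assms(1) in auto)
  ultimately show ?thesis using assms(2) unfolding hardy2_def by (simp add: eq eq0)
qed

lemma hardy2_line_measurable:
  assumes "F \<in> hardy2" "0 < x"
  shows "(\<lambda>\<omega>. F (Complex x \<omega>)) \<in> borel_measurable borel"
proof (rule borel_measurable_matrixI, rule borel_measurable_continuous_onI)
  fix i j
  have "continuous_on {s. 0 < Re s} (\<lambda>s. F s $ i $ j)"
    using assms(1) by (intro holomorphic_on_imp_continuous_on) (auto simp: hardy2_def)
  then show "continuous_on UNIV (\<lambda>\<omega>. F (Complex x \<omega>) $ i $ j)"
    unfolding Complex_eq by (rule continuous_on_compose2) (use assms(2) in \<open>auto intro!: continuous_intros\<close>)
qed

lemma hardy2_add:
  assumes F: "F \<in> hardy2" and G: "G \<in> hardy2"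
  shows "(\<lambda>s. F s + G s) \<in> hardy2"
proof -
  obtain K L where K: "\<And>x. x > 0 \<Longrightarrow> (\<integral>\<^sup>+ \<omega>. ennreal ((norm (F (Complex x \<omega>)))\<^sup>2) \<partial>lebesgue) \<le> ennreal K"
    and L: "\<And>x. x > 0 \<Longrightarrow> (\<integral>\<^sup>+ \<omega>. ennreal ((norm (G (Complex x \<omega>)))\<^sup>2) \<partial>lebesgue) \<le> ennreal L"
    using F G by (auto simp: hardy2_def)
  have bound: "(\<integral>\<^sup>+ \<omega>. ennreal ((norm (F (Complex x \<omega>) + G (Complex x \<omega>)))\<^sup>2) \<partial>lebesgue) \<le> ennreal (2 * max 0 K + 2 * max 0 L)"
    if x: "0 < x" for x
  proof -
    note [measurable] = hardy2_line_measurable[OF F x] hardy2_line_measurable[OF G x]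
    have "(\<integral>\<^sup>+ \<omega>. ennreal ((norm (F (Complex x \<omega>) + G (Complex x \<omega>)))\<^sup>2) \<partial>lborel)
      \<le> (\<integral>\<^sup>+ \<omega>. 2 * ennreal ((norm (F (Complex x \<omega>)))\<^sup>2) + 2 * ennreal ((norm (G (Complex x \<omega>)))\<^sup>2) \<partial>lborel)"
    proof (intro nn_integral_mono)
      fix \<omega>
      have "ennreal ((norm (F (Complex x \<omega>) + G (Complex x \<omega>)))\<^sup>2) \<le> ennreal (2 * (norm (F (Complex x \<omega>)))\<^sup>2 + 2 * (norm (G (Complex x \<omega>)))\<^sup>2)"
        by (intro ennreal_leI norm_add_power2_le)
      then show "ennreal ((norm (F (Complex x \<omega>) + G (Complex x \<omega>)))\<^sup>2) \<le> 2 * ennreal ((norm (F (Complex x \<omega>)))\<^sup>2) + 2 * ennreal ((norm (G (Complex x \<omega>)))\<^sup>2)"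
        by (simp add: ennreal_mult)
    qed
    also have "\<dots> = 2 * (\<integral>\<^sup>+ \<omega>. ennreal ((norm (F (Complex x \<omega>)))\<^sup>2) \<partial>lborel) + 2 * (\<integral>\<^sup>+ \<omega>. ennreal ((norm (G (Complex x \<omega>)))\<^sup>2) \<partial>lborel)"
      by (simp add: nn_integral_add nn_integral_cmult)
    also have "\<dots> \<le> 2 * ennreal (max 0 K) + 2 * ennreal (max 0 L)"
      using K[OF x] L[OF x] by (intro add_mono mult_left_mono) (auto simp: nn_integral_completion max_def ennreal_neg split: if_splits)
    also have "\<dots> = ennreal (2 * max 0 K + 2 * max 0 L)" by (simp add: ennreal_mult)
    finally show ?thesis by (simp add: nn_integral_completion)
  qed
  have lim: "AE \<omega> in lebesgue. ((\<lambda>x. F (Complex x \<omega>) + G (Complex x \<omega>)) \<longlongrightarrow> F (\<i> * of_real \<omega>) + G (\<i> * of_real \<omega>)) (at_right 0)"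
  proof -
    have "AE \<omega> in lebesgue. ((\<lambda>x. F (Complex x \<omega>)) \<longlongrightarrow> F (\<i> * of_real \<omega>)) (at_right 0)"
         "AE \<omega> in lebesgue. ((\<lambda>x. G (Complex x \<omega>)) \<longlongrightarrow> G (\<i> * of_real \<omega>)) (at_right 0)"
      using F G by (simp_all add: hardy2_def)
    then show ?thesis by eventually_elim (rule tendsto_add)
  qed
  have hol: "(\<lambda>s. (F s + G s) $ i $ j) holomorphic_on {s. 0 < Re s}" for i j
    using F G by (auto simp: hardy2_def intro!: holomorphic_intros)
  show ?thesis
    unfolding hardy2_def mem_Collect_eq using hol bound lim by blast
qed

lemma hardy2_simple_pole:
  assumes p: "Re p < 0"
  shows "(\<lambda>s. cscale (1 / (s - p)) N) \<in> hardy2"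
proof -
  have nz: "0 \<le> Re s \<Longrightarrow> s - p \<noteq> 0" for s using p by auto
  have "(\<integral>\<^sup>+ \<omega>. ennreal ((norm (cscale (1 / (Complex x \<omega> - p)) N))\<^sup>2) \<partial>lebesgue) \<le> ennreal ((norm N)\<^sup>2 * (pi / \<bar>Re p\<bar>))" 
    if x: "0 < x" for x
  proof -
    have eq: "norm (1 / (Complex x \<omega> - p)) = norm (1 / ((p - of_real x) - \<i> * of_real \<omega>))" for \<omega>
      by (simp add: norm_divide Complex_eq norm_minus_commute[of _ p] algebra_simps)
    have r: "Re (p - of_real x) \<noteq> 0" using x p by simp
    have "(\<integral>\<^sup>+ \<omega>. ennreal ((norm (cscale (1 / (Complex x \<omega> - p)) N))\<^sup>2) \<partial>lebesgue)
      = (\<integral>\<^sup>+ \<omega>. ennreal ((norm N)\<^sup>2 * (norm (1 / ((p - of_real x) - \<i> * of_real \<omega>)))\<^sup>2) \<partial>lborel)"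
      unfolding norm_cscale eq power_mult_distrib by (simp add: nn_integral_completion mult.commute)
    also have "\<dots> = ennreal (\<integral>\<omega>. (norm N)\<^sup>2 * (norm (1 / ((p - of_real x) - \<i> * of_real \<omega>)))\<^sup>2 \<partial>lborel)"
      by (intro nn_integral_eq_integral integrable_mult_right resolvent_L2(1) r) auto
    also have "\<dots> = ennreal ((norm N)\<^sup>2 * (pi / \<bar>Re (p - of_real x)\<bar>))"
      by (simp only: integral_mult_right_zero resolvent_L2(2)[OF r])
    also have "\<dots> \<le> ennreal ((norm N)\<^sup>2 * (pi / \<bar>Re p\<bar>))"
      using p x by (intro ennreal_leI mult_left_mono divide_left_mono mult_pos_pos) auto
    finally show ?thesis .
  qed
  moreover have "((\<lambda>x. cscale (1 / (Complex x \<omega> - p)) N) \<longlongrightarrow> cscale (1 / (\<i> * of_real \<omega> - p)) N) (at_right 0)" for \<omega>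
  proof -
    have "((\<lambda>x. cscale (1 / (of_real x + \<i> * of_real \<omega> - p)) N) \<longlongrightarrow> cscale (1 / (of_real 0 + \<i> * of_real \<omega> - p)) N) (at_right 0)"
      unfolding cscale_def by (intro tendsto_intros tendsto_vec_lambda nz) auto
    then show ?thesis by (simp add: Complex_eq)
  qed
  moreover have "(\<lambda>s. cscale (1 / (s - p)) N $ i $ j) holomorphic_on {s. 0 < Re s}" for i j
    using nz by (auto intro!: holomorphic_intros)
  ultimately show ?thesis unfolding hardy2_def by auto
qed

lemma hardy2_zero: "(\<lambda>s. 0) \<in> hardy2" 
  unfolding hardy2_def by auto

lemma hardy2_sum:
  assumes "finite I" "\<And>l. l \<in> I \<Longrightarrow> F l \<in> hardy2"
  shows "(\<lambda>s. \<Sum>l\<in>I. F l s) \<in> hardy2"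
  using assms by (induction I rule: finite_induct) (auto intro!: hardy2_zero hardy2_add)

lemma hardy2_uminus: "F \<in> hardy2 \<Longrightarrow> (\<lambda>s. - F s) \<in> hardy2"
  unfolding hardy2_def by (auto intro!: holomorphic_intros tendsto_minus elim!: eventually_mono)

lemma hardy2_rom:
  assumes diag: "\<And>k. diagonal_matrix (A $ k)" and stable: "\<And>l. Re (param_sum \<alpha> A q $ l $ l) < 0"
  shows "(\<lambda>s. rom \<alpha> \<beta> \<gamma> (A, B, C) s q) \<in> hardy2"
proof (rule hardy2_cong)
  let ?G = "\<lambda>s. \<Sum>l\<in>UNIV. cscale (1 / (s - param_sum \<alpha> A q $ l $ l)) (rank_one l (param_sum \<gamma> C q) (param_sum \<beta> B q))"
  show "?G \<in> hardy2" by (intro hardy2_sum hardy2_simple_pole stable) auto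
  show "?G s = rom \<alpha> \<beta> \<gamma> (A, B, C) s q" if "0 \<le> Re s" for s
    by (rule rom_expansion[symmetric]) (use diag stable that in \<open>auto dest: order.strict_implies_not_eq simp: not_le[symmetric]\<close>)
qed

lemma hardy2_component:
  fixes F :: "complex \<Rightarrow> complex^'n^'m"
  assumes F: "F \<in> hardy2" and meas: "(\<lambda>\<omega>. F (\<i> * of_real \<omega>)) \<in> borel_measurable borel"
  shows "\<exists>K. \<forall>i j. hardy_function (\<lambda>s. F s $ i $ j) K"
proof -
  obtain K where K: "\<And>x. x > 0 \<Longrightarrow> (\<integral>\<^sup>+ \<omega>. ennreal ((norm (F (Complex x \<omega>)))\<^sup>2) \<partial>lebesgue) \<le> ennreal K"
    using F by (auto simp: hardy2_def)
  have "hardy_function (\<lambda>s. F s $ i $ j) (max 0 K)" for i j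
  proof
    show "(\<lambda>s. F s $ i $ j) holomorphic_on {s. 0 < Re s}" using F by (simp add: hardy2_def)
    show "(\<lambda>\<omega>. F (\<i> * of_real \<omega>) $ i $ j) \<in> borel_measurable borel" by (rule borel_measurable_matrix_nth[OF meas])
    have "AE \<omega> in lborel. ((\<lambda>x. F (Complex x \<omega>)) \<longlongrightarrow> F (\<i> * of_real \<omega>)) (at_right 0)"
      using F by (simp add: hardy2_def AE_completion_iff)
    then show "AE \<omega> in lborel. ((\<lambda>x. F (Complex x \<omega>) $ i $ j) \<longlongrightarrow> F (\<i> * of_real \<omega>) $ i $ j) (at_right 0)"
      by (auto elim!: eventually_mono intro!: tendsto_vec_nth)
    fix x :: real assume x: "0 < x"
    have "(\<integral>\<^sup>+ \<omega>. ennreal ((norm (F (Complex x \<omega>) $ i $ j))\<^sup>2) \<partial>lborel) \<le> (\<integral>\<^sup>+ \<omega>. ennreal ((norm (F (Complex x \<omega>)))\<^sup>2) \<partial>lborel)"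
      by (intro nn_integral_mono ennreal_leI power_mono) (auto intro: norm_entry_le)
    also have "\<dots> \<le> ennreal K" using K[OF x] by (simp add: nn_integral_completion)
    also have "\<dots> \<le> ennreal (max 0 K)" by (intro ennreal_leI) auto
    finally show "(\<integral>\<^sup>+ \<omega>. ennreal ((norm (F (Complex x \<omega>) $ i $ j))\<^sup>2) \<partial>lborel) \<le> ennreal (max 0 K)" .
  qed simp
  then show ?thesis by blast
qed

section \<open>Boundary values and pairings with the Cauchy kernel\<close>

text \<open>
  Point evaluations in the right half-plane agree with integrals over the imaginary axis only almost
  everywhere. The integrals are measurable in the parameter; in the completion, this is inherited by the
  point evaluations.
\<close>

lemma integrable_completion_AE:
  fixes f g :: "'x \<Rightarrow> 'v::{banach, second_countable_topology}"
  assumes g: "integrable (completion M) g" and ae: "AE x in M. f x = g x"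
  shows "integrable (completion M) f" and "integral\<^sup>L (completion M) f = integral\<^sup>L (completion M) g"
proof -
  have ae': "AE x in completion M. g x = f x" using ae by (auto simp: AE_completion_iff elim!: eventually_mono)
  have f: "f \<in> borel_measurable (completion M)"
  proof (rule measurableI)
    fix A :: "'v set" assume A: "A \<in> sets borel"
    have "AE x in completion M. x \<in> g -` A \<inter> space (completion M) \<longleftrightarrow> x \<in> f -` A \<inter> space (completion M)"
      using ae' by eventually_elim simp
    then show "f -` A \<inter> space (completion M) \<in> sets (completion M)"
      by (rule completion.in_sets_AE) (use measurable_sets[OF borel_measurable_integrable[OF g] A] in auto)
  qed simp
  show "integrable (completion M) f" by (rule integrable_cong_AE_imp[OF g f ae'])
  show "integral\<^sup>L (completion M) f = integral\<^sup>L (completion M) g"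
    using ae' f g by (intro integral_cong_AE) (auto elim!: eventually_mono)
qed

lemma integrals_agree_diff:
  fixes f g d :: "'q \<Rightarrow> 'v::{banach, second_countable_topology}"
  assumes "integrable (completion \<nu>) f" "integrable (completion \<nu>) d" "(\<integral>q. d q \<partial>completion \<nu>) = 0"
    and ae: "AE q in \<nu>. g q = f q - d q"
  shows "integrals_agree \<nu> f g"
proof -
  have i: "integrable (completion \<nu>) (\<lambda>q. f q - d q)" using assms by auto
  from integrable_completion_AE[OF i ae] assms show ?thesis by (simp add: integrals_agree_def)
qed

lemma integrals_agree_vec:
  fixes f g :: "'q \<Rightarrow> complex^'n"
  assumes "\<And>m. integrals_agree \<nu> (\<lambda>q. f q $ m) (\<lambda>q. g q $ m)"
  shows "integrals_agree \<nu> f g"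
proof -
  have bl: "bounded_linear (axis m :: complex \<Rightarrow> complex^'n)" for m
    unfolding linear_conv_bounded_linear[symmetric]
    by (rule linearI) (auto simp: vec_eq_iff axis_def)
  have split: "h = (\<lambda>q. \<Sum>m\<in>UNIV. axis m (h q $ m))" for h :: "'q \<Rightarrow> complex^'n"
    by (auto simp: vec_eq_iff axis_def sum_component cong: if_cong)
  have int: "integrable (completion \<nu>) h \<and>
      integral\<^sup>L (completion \<nu>) h = (\<Sum>m\<in>UNIV. axis m (\<integral>q. h q $ m \<partial>completion \<nu>))"
    if "\<And>m. integrable (completion \<nu>) (\<lambda>q. h q $ m)" for h :: "'q \<Rightarrow> complex^'n"
  proof -
    have i: "integrable (completion \<nu>) (\<lambda>q. axis m (h q $ m))" for m
      by (rule integrable_bounded_linear[OF bl that])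
    show ?thesis
    proof
      show "integrable (completion \<nu>) h" by (subst split) (intro Bochner_Integration.integrable_sum i)
      have "integral\<^sup>L (completion \<nu>) h = (\<integral>q. (\<Sum>m\<in>UNIV. axis m (h q $ m)) \<partial>completion \<nu>)" using split[of h] by metis
      also have "\<dots> = (\<Sum>m\<in>UNIV. \<integral>q. axis m (h q $ m) \<partial>completion \<nu>)" by (rule Bochner_Integration.integral_sum[OF i])
      also have "\<dots> = (\<Sum>m\<in>UNIV. axis m (\<integral>q. h q $ m \<partial>completion \<nu>))"
        by (intro sum.cong refl integral_bounded_linear[OF bl that])
      finally show "integral\<^sup>L (completion \<nu>) h = (\<Sum>m\<in>UNIV. axis m (\<integral>q. h q $ m \<partial>completion \<nu>))" .
    qed
  qed
  have a: "integrable (completion \<nu>) (\<lambda>q. f q $ m)" "integrable (completion \<nu>) (\<lambda>q. g q $ m)"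
    "(\<integral>q. f q $ m \<partial>completion \<nu>) = (\<integral>q. g q $ m \<partial>completion \<nu>)" for m
    using assms[of m] by (simp_all add: integrals_agree_def)
  show ?thesis unfolding integrals_agree_def using int[OF a(1)] int[OF a(2)] a(3) by simp
qed

text \<open>
  The order of the arguments is swapped so that the parameter is the first, outer variable.
\<close>

definition on_axis :: "(complex \<Rightarrow> 'q \<Rightarrow> 'v) \<Rightarrow> 'q \<times> real \<Rightarrow> 'v" where
  "on_axis F p = F (\<i> * of_real (snd p)) (fst p)"

lemma on_axis_measurable:
  assumes "(\<lambda>(s, q). F s q) \<in> borel_measurable (restrict_space borel {s. 0 \<le> Re s} \<Otimes>\<^sub>M \<nu>)"
  shows "on_axis F \<in> borel_measurable (\<nu> \<Otimes>\<^sub>M lborel)"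
proof -
  have "(\<lambda>p. (\<i> * of_real (snd p), fst p)) \<in> \<nu> \<Otimes>\<^sub>M lborel \<rightarrow>\<^sub>M restrict_space borel {s. 0 \<le> Re s} \<Otimes>\<^sub>M \<nu>"
    by (intro measurable_Pair measurable_restrict_space2) auto
  from measurable_compose[OF this assms] show ?thesis by (simp add: on_axis_def[abs_def])
qed

lemma axis_section_measurable:
  assumes "on_axis F \<in> borel_measurable (\<nu> \<Otimes>\<^sub>M lborel)" "q \<in> space \<nu>"
  shows "(\<lambda>\<omega>. F (\<i> * of_real \<omega>) q) \<in> borel_measurable borel"
  using measurable_compose[OF measurable_Pair1'[OF assms(2)] assms(1)] by (simp add: on_axis_def)

lemma hardy2_norm_power2:
  assumes "on_axis F \<in> borel_measurable (\<nu> \<Otimes>\<^sub>M lborel)" "q \<in> space \<nu>"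
  shows "(hardy2_norm (\<lambda>s. F s q))\<^sup>2 = 1 / (2 * pi) * (\<integral>\<omega>. (norm (on_axis F (q, \<omega>)))\<^sup>2 \<partial>lborel)"
proof -
  have [measurable]: "(\<lambda>\<omega>. F (\<i> * of_real \<omega>) q) \<in> borel_measurable borel" by (rule axis_section_measurable[OF assms])
  show ?thesis by (simp add: hardy2_norm_def integral_completion on_axis_def)
qed

lemma hardy2_boundary_L2:
  fixes F :: "complex \<Rightarrow> complex^'n^'m"
  assumes F: "F \<in> hardy2" and meas: "(\<lambda>\<omega>. F (\<i> * of_real \<omega>)) \<in> borel_measurable borel"
  shows "integrable lborel (\<lambda>\<omega>. (norm (F (\<i> * of_real \<omega>)))\<^sup>2)"
proof -
  obtain K where "\<And>i j. hardy_function (\<lambda>s. F s $ i $ j) K" using hardy2_component[OF assms] by blast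
  from hardy_function.boundary_L2(1)[OF this] show ?thesis unfolding norm_matrix_power2 by auto
qed

lemma h2l2_L2:
  fixes F :: "complex \<Rightarrow> 'q \<Rightarrow> complex^'n^'m"
  assumes F: "F \<in> h2l2 \<nu>"
  shows "on_axis F \<in> borel_measurable (\<nu> \<Otimes>\<^sub>M lborel)"
    and "integrable (\<nu> \<Otimes>\<^sub>M lborel) (\<lambda>p. (norm (on_axis F p))\<^sup>2)"
proof -
  show m[measurable]: "on_axis F \<in> borel_measurable (\<nu> \<Otimes>\<^sub>M lborel)"
    using F by (intro on_axis_measurable) (simp add: h2l2_def)
  have "integrable \<nu> (\<lambda>q. (hardy2_norm (\<lambda>s. F s q))\<^sup>2)" using F by (simp add: h2l2_def)
  then have "integrable \<nu> (\<lambda>q. 1 / (2 * pi) * (\<integral>\<omega>. (norm (on_axis F (q, \<omega>)))\<^sup>2 \<partial>lborel))"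
    by (subst (asm) Bochner_Integration.integrable_cong[OF refl hardy2_norm_power2[OF m]]) auto
  from integrable_mult_right[OF this, of "2 * pi"]
  have outer: "integrable \<nu> (\<lambda>q. \<integral>\<omega>. (norm (on_axis F (q, \<omega>)))\<^sup>2 \<partial>lborel)" by simp
  have "AE q in \<nu>. (\<lambda>s. F s q) \<in> hardy2" using F by (simp add: h2l2_def)
  with AE_space have inner: "AE q in \<nu>. integrable lborel (\<lambda>\<omega>. (norm (on_axis F (q, \<omega>)))\<^sup>2)"
  proof eventually_elim
    fix q assume "q \<in> space \<nu>" "(\<lambda>s. F s q) \<in> hardy2"
    from hardy2_boundary_L2[OF this(2) axis_section_measurable[OF m this(1)]]
    show "integrable lborel (\<lambda>\<omega>. (norm (on_axis F (q, \<omega>)))\<^sup>2)" by (simp add: on_axis_def)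
  qed
  show "integrable (\<nu> \<Otimes>\<^sub>M lborel) (\<lambda>p. (norm (on_axis F p))\<^sup>2)"
    by (rule lborel.integrable_pair_nonneg[OF _ _ inner outer]) auto
qed

text \<open>
  Up to the factor \<open>2 * pi\<close> the norm is the \<open>L\<^sup>2\<close> norm of the boundary values on the product of parameter
  set and imaginary axis, which turns optimality into a least-squares problem on one measure space.
\<close>

lemma h2l2_norm_power2:
  fixes F :: "complex \<Rightarrow> 'q \<Rightarrow> complex^'n^'m"
  assumes m: "on_axis F \<in> borel_measurable (\<nu> \<Otimes>\<^sub>M lborel)"
    and i: "integrable (\<nu> \<Otimes>\<^sub>M lborel) (\<lambda>p. (norm (on_axis F p))\<^sup>2)"
  shows "integrable \<nu> (\<lambda>q. (hardy2_norm (\<lambda>s. F s q))\<^sup>2)"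
    and "(h2l2_norm \<nu> F)\<^sup>2 = 1 / (2 * pi) * (\<integral>p. (norm (on_axis F p))\<^sup>2 \<partial>(\<nu> \<Otimes>\<^sub>M lborel))"
proof -
  note cong = hardy2_norm_power2[OF m]
  show "integrable \<nu> (\<lambda>q. (hardy2_norm (\<lambda>s. F s q))\<^sup>2)"
    by (subst Bochner_Integration.integrable_cong[OF refl cong])
      (auto intro!: integrable_mult_right lborel.integral_fst_real(2)[OF i, simplified])
  have "(\<integral>q. (hardy2_norm (\<lambda>s. F s q))\<^sup>2 \<partial>\<nu>) = (\<integral>q. 1 / (2 * pi) * (\<integral>\<omega>. (norm (on_axis F (q, \<omega>)))\<^sup>2 \<partial>lborel) \<partial>\<nu>)"
    by (rule Bochner_Integration.integral_cong[OF refl cong])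
  also have "\<dots> = 1 / (2 * pi) * (\<integral>p. (norm (on_axis F p))\<^sup>2 \<partial>(\<nu> \<Otimes>\<^sub>M lborel))"
    by (simp only: integral_mult_right_zero lborel.integral_fst_real(3)[OF i])
  finally show "(h2l2_norm \<nu> F)\<^sup>2 = 1 / (2 * pi) * (\<integral>p. (norm (on_axis F p))\<^sup>2 \<partial>(\<nu> \<Otimes>\<^sub>M lborel))"
    by (simp add: h2l2_norm_def)
qed

text \<open>
  Integrating over frequencies first evaluates the real inner product of \<open>F\<close> with the separable matrix
  function \<open>cscale (\<kappa> (q, \<omega>)) (N q)\<close>: the values \<open>T q\<close>, which Cauchy's formula will supply, are
  contracted with the conjugate of \<open>N q\<close>. The factor \<open>z\<close> recovers complex information from the real
  inner product.
\<close>

lemma boundary_pairing: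
  fixes F :: "complex \<Rightarrow> 'q \<Rightarrow> complex^'i^'o" and N T :: "'q \<Rightarrow> complex^'i^'o"
    and \<kappa> :: "'q \<times> real \<Rightarrow> complex" and c :: real
  assumes F: "F \<in> h2l2 \<nu>"
    and G: "(\<lambda>p. cscale (\<kappa> p) (N (fst p))) \<in> borel_measurable (\<nu> \<Otimes>\<^sub>M lborel)"
      "integrable (\<nu> \<Otimes>\<^sub>M lborel) (\<lambda>p. (norm (cscale (\<kappa> p) (N (fst p))))\<^sup>2)"
    and T: "AE q in \<nu>. \<forall>i j. integrable lborel (\<lambda>\<omega>. F (\<i> * of_real \<omega>) q $ i $ j * cnj (\<kappa> (q, \<omega>))) \<and>
        (\<integral>\<omega>. F (\<i> * of_real \<omega>) q $ i $ j * cnj (\<kappa> (q, \<omega>)) \<partial>lborel) = of_real c * T q $ i $ j"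
    and "c \<noteq> 0"
  shows "integrable (completion \<nu>) (\<lambda>q. \<Sum>i\<in>UNIV. \<Sum>j\<in>UNIV. cnj (N q $ i $ j) * T q $ i $ j)" (is "integrable _ ?S")
    and "(\<integral>p. on_axis F p \<bullet> cscale (z * \<kappa> p) (N (fst p)) \<partial>(\<nu> \<Otimes>\<^sub>M lborel)) =
        c * Re (cnj z * (\<integral>q. (\<Sum>i\<in>UNIV. \<Sum>j\<in>UNIV. cnj (N q $ i $ j) * T q $ i $ j) \<partial>completion \<nu>))"
proof -
  note FL = h2l2_L2[OF F]
  let ?I = "\<lambda>z p. on_axis F p \<bullet> cscale (z * \<kappa> p) (N (fst p))"
  have I: "integrable (\<nu> \<Otimes>\<^sub>M lborel) (?I z)" for z
  proof (rule integrable_inner_L2[OF FL(1) _ FL(2)])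
    have eq: "cscale (z * \<kappa> p) (N (fst p)) = cscale z (cscale (\<kappa> p) (N (fst p)))" for p by (simp add: cscale_cscale)
    show "(\<lambda>p. cscale (z * \<kappa> p) (N (fst p))) \<in> borel_measurable (\<nu> \<Otimes>\<^sub>M lborel)"
      unfolding eq by (intro borel_measurable_cscale G) auto
    show "integrable (\<nu> \<Otimes>\<^sub>M lborel) (\<lambda>p. (norm (cscale (z * \<kappa> p) (N (fst p))))\<^sup>2)"
      unfolding eq norm_cscale[of z] power_mult_distrib using G(2) by (rule integrable_mult_right)
  qed
  note fub = lborel.integral_fst_real[OF I]
  have inner: "AE q in \<nu>. (\<integral>\<omega>. ?I z (q, \<omega>) \<partial>lborel) = c * Re (cnj z * ?S q)" for z
    using T
  proof eventually_elim
    fix q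
    assume *: "\<forall>i j. integrable lborel (\<lambda>\<omega>. F (\<i> * of_real \<omega>) q $ i $ j * cnj (\<kappa> (q, \<omega>))) \<and>
        (\<integral>\<omega>. F (\<i> * of_real \<omega>) q $ i $ j * cnj (\<kappa> (q, \<omega>)) \<partial>lborel) = of_real c * T q $ i $ j"
    let ?f = "\<lambda>i j \<omega>. cnj z * cnj (N q $ i $ j) * (F (\<i> * of_real \<omega>) q $ i $ j * cnj (\<kappa> (q, \<omega>)))"
    have fi: "integrable lborel (?f i j)" for i j using * by auto
    have "(\<integral>\<omega>. ?I z (q, \<omega>) \<partial>lborel) = (\<integral>\<omega>. Re (\<Sum>i\<in>UNIV. \<Sum>j\<in>UNIV. ?f i j \<omega>) \<partial>lborel)"
      by (intro Bochner_Integration.integral_cong refl) (simp add: inner_cscale on_axis_def ac_simps)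
    also have "\<dots> = Re (\<integral>\<omega>. (\<Sum>i\<in>UNIV. \<Sum>j\<in>UNIV. ?f i j \<omega>) \<partial>lborel)"
      by (intro integral_Re Bochner_Integration.integrable_sum fi)
    also have "(\<integral>\<omega>. (\<Sum>i\<in>UNIV. \<Sum>j\<in>UNIV. ?f i j \<omega>) \<partial>lborel) = (\<Sum>i\<in>UNIV. \<Sum>j\<in>UNIV. integral\<^sup>L lborel (?f i j))"
      by (subst Bochner_Integration.integral_sum, intro Bochner_Integration.integrable_sum fi,
          intro sum.cong refl Bochner_Integration.integral_sum fi)
    also have "\<dots> = (\<Sum>i\<in>UNIV. \<Sum>j\<in>UNIV. of_real c * (cnj z * (cnj (N q $ i $ j) * T q $ i $ j)))"
      using * by (intro sum.cong refl) (simp only: integral_mult_right_zero, simp)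
    also have "\<dots> = of_real c * (cnj z * ?S q)" by (simp only: sum_distrib_left)
    finally show "(\<integral>\<omega>. ?I z (q, \<omega>) \<partial>lborel) = c * Re (cnj z * ?S q)" by simp
  qed
  \<comment> \<open>The pairings with \<open>z = 1\<close> and \<open>z = \<i>\<close> give the real and the imaginary part of the sum.\<close>
  define S' where "S' q = of_real ((\<integral>\<omega>. ?I 1 (q, \<omega>) \<partial>lborel) / c) + \<i> * of_real ((\<integral>\<omega>. ?I \<i> (q, \<omega>) \<partial>lborel) / c)" for q
  have S': "integrable \<nu> S'" unfolding S'_def
    by (intro Bochner_Integration.integrable_add integrable_mult_right integrable_of_real integrable_divide_zero fub(2))
  have ae: "AE q in \<nu>. ?S q = S' q"
    using inner[of 1] inner[of \<i>]
    by eventually_elim (use \<open>c \<noteq> 0\<close> in \<open>simp add: S'_def complex_eq_iff\<close>)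
  have S'': "integrable (completion \<nu>) S'" using S' by (simp add: integrable_completion)
  show "integrable (completion \<nu>) ?S" by (rule integrable_completion_AE[OF S'' ae])
  have int: "integral\<^sup>L (completion \<nu>) ?S = integral\<^sup>L \<nu> S'"
    using integrable_completion_AE(2)[OF S'' ae] S' by (simp add: integral_completion)
  have "integral\<^sup>L (\<nu> \<Otimes>\<^sub>M lborel) (?I z) = (\<integral>q. (\<integral>\<omega>. ?I z (q, \<omega>) \<partial>lborel) \<partial>\<nu>)" by (rule fub(3)[symmetric])
  also have "\<dots> = (\<integral>q. Re (of_real c * (cnj z * S' q)) \<partial>\<nu>)"
  proof (rule integral_cong_AE)
    show "AE q in \<nu>. (\<integral>\<omega>. ?I z (q, \<omega>) \<partial>lborel) = Re (of_real c * (cnj z * S' q))"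
      using inner[of z] ae by eventually_elim simp
  qed (use fub(2) S' in auto)
  also have "\<dots> = Re (\<integral>q. of_real c * (cnj z * S' q) \<partial>\<nu>)"
    by (intro integral_Re integrable_mult_right S')
  also have "\<dots> = c * Re (cnj z * integral\<^sup>L \<nu> S')" by (simp only: integral_mult_right_zero) simp
  finally show "(\<integral>p. ?I z p \<partial>(\<nu> \<Otimes>\<^sub>M lborel)) = c * Re (cnj z * integral\<^sup>L (completion \<nu>) ?S)" 
    unfolding int .
qed

section \<open>Coefficients are bounded by the decay rates of the poles\<close>

lemma onorm_matrix_ge_entry:
  fixes M :: "complex^'r^'r"
  shows "norm (M $ l $ l) \<le> onorm ((*v) M)"
proof -
  have "linear ((*v) M)"
    by (rule linearI) (simp_all add: matrix_vector_right_distrib, simp add: vec_eq_iff matrix_vector_mult_def scaleR_sum_right)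
  then have "bounded_linear ((*v) M)" by (simp add: linear_conv_bounded_linear)
  then have "norm (M *v axis l 1) \<le> onorm ((*v) M) * norm (axis l (1::complex))" by (rule onorm)
  moreover have "norm (axis l (1::complex)) = 1" by (simp add: norm_eq_sqrt_inner inner_axis_axis)
  moreover have "(M *v axis l 1) $ l = M $ l $ l"
    by (simp add: matrix_vector_mult_def axis_def if_distrib[where f="\<lambda>x. _ * x"] cong: if_cong)
  ultimately show ?thesis using Finite_Cartesian_Product.norm_nth_le[of "M *v axis l 1" l] by simp
qed

text \<open>
  The resolvent is of size \<open>1 / \<bar>Re p\<bar>\<close> at the frequency \<open>Im p\<close> nearest to the pole \<open>p\<close>. An essential
  supremum does not see a single frequency, hence the factor \<open>2\<close>: on an interval of length \<open>\<bar>Re p\<bar>\<close> the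
  distance to the pole is at most \<open>2 * \<bar>Re p\<bar>\<close>.
\<close>

lemma resolvent_esssup_ge:
  fixes M :: "complex^'r^'r"
  assumes diag: "diagonal_matrix M" and stable: "\<And>l. Re (M $ l $ l) < 0"
  shows "ennreal (1 / (2 * \<bar>Re (M $ l $ l)\<bar>))
    \<le> esssup lborel (\<lambda>\<omega>. ennreal (onorm ((*v) (matrix_inv (mat (\<i> * of_real \<omega>) - M)))))" (is "?c \<le> ?e")
proof (rule ccontr)
  assume "\<not> ?c \<le> ?e"
  let ?p = "M $ l $ l"
  let ?I = "{Im ?p<..<Im ?p + \<bar>Re ?p\<bar>}"
  have "AE \<omega> in lborel. \<omega> \<notin> ?I"
    using esssup_AE[of "\<lambda>\<omega>. ennreal (onorm ((*v) (matrix_inv (mat (\<i> * of_real \<omega>) - M))))" lborel]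
  proof eventually_elim
    fix \<omega> :: real
    assume le: "ennreal (onorm ((*v) (matrix_inv (mat (\<i> * of_real \<omega>) - M)))) \<le> ?e"
    show "\<omega> \<notin> ?I"
    proof
      assume \<omega>: "\<omega> \<in> ?I"
      have ne: "\<i> * of_real \<omega> \<noteq> M $ l $ l" for l using stable[of l] by (auto simp: complex_eq_iff)
      have "norm (\<i> * of_real \<omega> - ?p) \<le> \<bar>Re ?p\<bar> + \<bar>\<omega> - Im ?p\<bar>"
        using cmod_le[of "\<i> * of_real \<omega> - ?p"] by simp
      also have "\<dots> \<le> 2 * \<bar>Re ?p\<bar>" using \<omega> by auto
      finally have "1 / (2 * \<bar>Re ?p\<bar>) \<le> norm (1 / (\<i> * of_real \<omega> - ?p))"
        unfolding norm_divide norm_one using ne[of l] stable[of l] by (intro divide_left_mono mult_pos_pos) auto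
      also have "\<dots> = norm (matrix_inv (mat (\<i> * of_real \<omega>) - M) $ l $ l)"
        by (subst matrix_inv_diagonal[OF diag ne]) simp
      also have "\<dots> \<le> onorm ((*v) (matrix_inv (mat (\<i> * of_real \<omega>) - M)))" by (rule onorm_matrix_ge_entry)
      finally have "?c \<le> ?e" using le by (meson ennreal_leI order_trans)
      with \<open>\<not> ?c \<le> ?e\<close> show False ..
    qed
  qed
  then have "emeasure lborel {\<omega> \<in> space lborel. \<omega> \<in> ?I} = 0" by (rule emeasure_eq_0_AE)
  moreover have "{\<omega> \<in> space lborel. \<omega> \<in> ?I} = ?I" by auto
  ultimately have "emeasure lborel ?I = 0" by (simp only:)
  then show False using stable[of l] by (subst (asm) emeasure_lborel_Ioo) auto
qed

text \<open>
  Shifting a pole by a small multiple of \<open>\<alpha>\<^sub>k\<close> thus changes it little relative to its distance from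
  the imaginary axis, uniformly in the parameter.
\<close>

lemma coefficients_bounded_by_decay:
  fixes A :: "(complex^'r^'r)^'a::finite"
  assumes diag: "\<And>k. diagonal_matrix (A $ k)"
    and bounded: "\<And>k. esssup \<nu> (\<lambda>q. ennreal \<bar>\<alpha> k q\<bar> * esssup lborel (\<lambda>\<omega>. ennreal (onorm
         ((*v) (matrix_inv (mat (\<i> * of_real \<omega>) - param_sum \<alpha> A q)))))) < \<infinity>"
    and stable: "AE q in \<nu>. \<forall>l. Re (param_sum \<alpha> A q $ l $ l) < 0"
  shows "\<exists>L>0. AE q in \<nu>. \<forall>k l. \<bar>\<alpha> k q\<bar> \<le> L * \<bar>Re (param_sum \<alpha> A q $ l $ l)\<bar>"
proof -
  let ?e = "\<lambda>q. esssup lborel (\<lambda>\<omega>. ennreal (onorm ((*v) (matrix_inv (mat (\<i> * of_real \<omega>) - param_sum \<alpha> A q)))))"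
  let ?b = "\<lambda>k. enn2real (esssup \<nu> (\<lambda>q. ennreal \<bar>\<alpha> k q\<bar> * ?e q))"
  define L where "L = 1 + 2 * (\<Sum>k\<in>UNIV. ?b k)"
  have L: "0 < L" unfolding L_def by (intro add_pos_nonneg mult_nonneg_nonneg sum_nonneg) auto
  have "AE q in \<nu>. \<forall>k. ennreal \<bar>\<alpha> k q\<bar> * ?e q \<le> ennreal (?b k)"
  proof -
    have "AE q in \<nu>. ennreal \<bar>\<alpha> k q\<bar> * ?e q \<le> ennreal (?b k)" for k
      using esssup_AE[of "\<lambda>q. ennreal \<bar>\<alpha> k q\<bar> * ?e q" \<nu>] bounded[of k] by simp
    then show ?thesis by (simp add: AE_all_countable)
  qed
  with stable have "AE q in \<nu>. \<forall>k l. \<bar>\<alpha> k q\<bar> \<le> L * \<bar>Re (param_sum \<alpha> A q $ l $ l)\<bar>"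
  proof eventually_elim
    fix q assume st: "\<forall>l. Re (param_sum \<alpha> A q $ l $ l) < 0" and b: "\<forall>k. ennreal \<bar>\<alpha> k q\<bar> * ?e q \<le> ennreal (?b k)"
    show "\<forall>k l. \<bar>\<alpha> k q\<bar> \<le> L * \<bar>Re (param_sum \<alpha> A q $ l $ l)\<bar>"
    proof (intro allI)
      fix k l
      let ?r = "\<bar>Re (param_sum \<alpha> A q $ l $ l)\<bar>"
      have "ennreal \<bar>\<alpha> k q\<bar> * ennreal (1 / (2 * ?r)) \<le> ennreal \<bar>\<alpha> k q\<bar> * ?e q"
        using st by (intro mult_left_mono resolvent_esssup_ge diagonal_param_sum diag) auto
      also have "\<dots> \<le> ennreal (?b k)" using b by blast
      finally have "\<bar>\<alpha> k q\<bar> * (1 / (2 * ?r)) \<le> ?b k" by (simp flip: ennreal_mult add: ennreal_le_iff)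
      then have "\<bar>\<alpha> k q\<bar> \<le> (2 * ?b k) * ?r" using st[rule_format, of l] by (simp add: field_simps)
      also have "?b k \<le> (\<Sum>k\<in>UNIV. ?b k)" by (rule member_le_sum) auto
      then have "(2 * ?b k) * ?r \<le> L * ?r" by (intro mult_right_mono) (auto simp: L_def)
      finally show "\<bar>\<alpha> k q\<bar> \<le> L * ?r" .
    qed
  qed
  with L show ?thesis by blast
qed

text \<open>
  By the previous bound \<open>\<Sum>\<^sub>k \<bar>\<alpha>\<^sub>k\<bar>\<close> is at most a constant times \<open>\<bar>Re p\<bar>\<close>, so that \<open>w\<^sup>2 * pi / \<bar>Re p\<bar>\<close> is
  dominated by the integrable function. The quotient by the sum is harmless although division by zero
  gives zero: where all \<open>\<alpha>\<^sub>k\<close> vanish, so do all poles, which contradicts stability.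
\<close>

lemma weighted_resolvent_L2:
  fixes A :: "(complex^'r^'r)^'a::finite" and w :: "'q \<Rightarrow> real"
  assumes meas_\<alpha>: "\<And>k. \<alpha> k \<in> borel_measurable \<nu>" and meas_w[measurable]: "w \<in> borel_measurable \<nu>"
    and stable: "AE q in \<nu>. \<forall>l. Re (param_sum \<alpha> A q $ l $ l) < 0"
    and "0 < L" and bound: "AE q in \<nu>. \<forall>k l. \<bar>\<alpha> k q\<bar> \<le> L * \<bar>Re (param_sum \<alpha> A q $ l $ l)\<bar>"
    and int: "integrable \<nu> (\<lambda>q. (w q)\<^sup>2 / (\<Sum>k\<in>UNIV. \<bar>\<alpha> k q\<bar>))"
  shows "integrable (\<nu> \<Otimes>\<^sub>M lborel)
    (\<lambda>p. (w (fst p) * norm (1 / (param_sum \<alpha> A (fst p) $ l $ l - \<i> * of_real (snd p))))\<^sup>2)"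
proof -
  let ?p = "\<lambda>q. param_sum \<alpha> A q $ l $ l"
  have [measurable]: "?p \<in> borel_measurable \<nu>"
    by (intro borel_measurable_matrix_nth borel_measurable_param_sum meas_\<alpha>)
  then have [measurable]: "(\<lambda>x. ?p (fst x)) \<in> borel_measurable (\<nu> \<Otimes>\<^sub>M lborel)"
    by (rule measurable_compose[OF measurable_fst])
  have meas: "(\<lambda>p. (w (fst p) * norm (1 / (?p (fst p) - \<i> * of_real (snd p))))\<^sup>2) \<in> borel_measurable (\<nu> \<Otimes>\<^sub>M lborel)"
    by measurable
  have "AE q in \<nu>. integrable lborel (\<lambda>\<omega>. (w q * norm (1 / (?p q - \<i> * of_real \<omega>)))\<^sup>2) \<and>
      (\<integral>\<omega>. (w q * norm (1 / (?p q - \<i> * of_real \<omega>)))\<^sup>2 \<partial>lborel) \<le> pi * CARD('a) * L * ((w q)\<^sup>2 / (\<Sum>k\<in>UNIV. \<bar>\<alpha> k q\<bar>))"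
    using stable bound
  proof eventually_elim
    fix q assume st: "\<forall>l. Re (param_sum \<alpha> A q $ l $ l) < 0"
      and b: "\<forall>k l. \<bar>\<alpha> k q\<bar> \<le> L * \<bar>Re (param_sum \<alpha> A q $ l $ l)\<bar>"
    have p: "Re (?p q) \<noteq> 0" using st by (metis less_irrefl)
    have i: "integrable lborel (\<lambda>\<omega>. (w q * norm (1 / (?p q - \<i> * of_real \<omega>)))\<^sup>2)"
      unfolding power_mult_distrib by (intro integrable_mult_right resolvent_L2 p)
    have "(\<Sum>k\<in>UNIV. \<bar>\<alpha> k q\<bar>) \<noteq> 0"
    proof
      assume "(\<Sum>k\<in>UNIV. \<bar>\<alpha> k q\<bar>) = 0"
      then have "\<alpha> k q = 0" for k by (subst (asm) sum_nonneg_eq_0_iff) auto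
      then have "?p q = 0" by (simp add: param_sum_def)
      with p show False by simp
    qed
    then have pos: "0 < (\<Sum>k\<in>UNIV. \<bar>\<alpha> k q\<bar>)" by (simp add: sum_nonneg less_le)
    have "(\<Sum>k\<in>UNIV. \<bar>\<alpha> k q\<bar>) \<le> (\<Sum>k\<in>(UNIV::'a set). L * \<bar>Re (?p q)\<bar>)" using b by (intro sum_mono) auto
    then have "1 / \<bar>Re (?p q)\<bar> \<le> CARD('a) * L / (\<Sum>k\<in>UNIV. \<bar>\<alpha> k q\<bar>)"
      using pos p by (simp add: field_simps)
    then have "(w q)\<^sup>2 * pi * (1 / \<bar>Re (?p q)\<bar>) \<le> (w q)\<^sup>2 * pi * (CARD('a) * L / (\<Sum>k\<in>UNIV. \<bar>\<alpha> k q\<bar>))"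
      by (intro mult_left_mono) auto
    moreover have "(\<integral>\<omega>. (w q * norm (1 / (?p q - \<i> * of_real \<omega>)))\<^sup>2 \<partial>lborel) = (w q)\<^sup>2 * (pi / \<bar>Re (?p q)\<bar>)"
      unfolding power_mult_distrib by (simp only: integral_mult_right_zero resolvent_L2(2)[OF p])
    ultimately show "integrable lborel (\<lambda>\<omega>. (w q * norm (1 / (?p q - \<i> * of_real \<omega>)))\<^sup>2) \<and>
      (\<integral>\<omega>. (w q * norm (1 / (?p q - \<i> * of_real \<omega>)))\<^sup>2 \<partial>lborel) \<le> pi * CARD('a) * L * ((w q)\<^sup>2 / (\<Sum>k\<in>UNIV. \<bar>\<alpha> k q\<bar>))"
      using i by (simp add: ac_simps)
  qed
  then have ae: "AE q in \<nu>. integrable lborel (\<lambda>\<omega>. (w q * norm (1 / (?p q - \<i> * of_real \<omega>)))\<^sup>2)"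
      "AE q in \<nu>. (\<integral>\<omega>. (w q * norm (1 / (?p q - \<i> * of_real \<omega>)))\<^sup>2 \<partial>lborel) \<le> pi * CARD('a) * L * ((w q)\<^sup>2 / (\<Sum>k\<in>UNIV. \<bar>\<alpha> k q\<bar>))"
    by (auto elim: eventually_mono)
  show ?thesis
  proof (rule lborel.integrable_pair_nonneg)
    show "AE q in \<nu>. integrable lborel (\<lambda>\<omega>. (w (fst (q, \<omega>)) * norm (1 / (?p (fst (q, \<omega>)) - \<i> * of_real (snd (q, \<omega>)))))\<^sup>2)"
      using ae(1) by simp
    have "integrable \<nu> (\<lambda>q. \<integral>\<omega>. (w q * norm (1 / (?p q - \<i> * of_real \<omega>)))\<^sup>2 \<partial>lborel)"
    proof (rule Bochner_Integration.integrable_bound)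
      show "integrable \<nu> (\<lambda>q. pi * CARD('a) * L * ((w q)\<^sup>2 / (\<Sum>k\<in>UNIV. \<bar>\<alpha> k q\<bar>)))"
        by (intro integrable_mult_right int)
      show "AE q in \<nu>. norm (\<integral>\<omega>. (w q * norm (1 / (?p q - \<i> * of_real \<omega>)))\<^sup>2 \<partial>lborel)
          \<le> norm (pi * CARD('a) * L * ((w q)\<^sup>2 / (\<Sum>k\<in>UNIV. \<bar>\<alpha> k q\<bar>)))"
        using ae(2)
      proof eventually_elim
        fix q assume "(\<integral>\<omega>. (w q * norm (1 / (?p q - \<i> * of_real \<omega>)))\<^sup>2 \<partial>lborel) \<le> pi * CARD('a) * L * ((w q)\<^sup>2 / (\<Sum>k\<in>UNIV. \<bar>\<alpha> k q\<bar>))"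
        moreover have "0 \<le> (\<integral>\<omega>. (w q * norm (1 / (?p q - \<i> * of_real \<omega>)))\<^sup>2 \<partial>lborel)" by simp
        ultimately show "norm (\<integral>\<omega>. (w q * norm (1 / (?p q - \<i> * of_real \<omega>)))\<^sup>2 \<partial>lborel)
          \<le> norm (pi * CARD('a) * L * ((w q)\<^sup>2 / (\<Sum>k\<in>UNIV. \<bar>\<alpha> k q\<bar>)))" unfolding real_norm_def by linarith
      qed
      show "(\<lambda>q. \<integral>\<omega>. (w q * norm (1 / (?p q - \<i> * of_real \<omega>)))\<^sup>2 \<partial>lborel) \<in> borel_measurable \<nu>"
        using meas by (intro lborel.borel_measurable_lebesgue_integral) (simp add: split_beta')
    qed
    then show "integrable \<nu> (\<lambda>q. \<integral>\<omega>. (w (fst (q, \<omega>)) * norm (1 / (?p (fst (q, \<omega>)) - \<i> * of_real (snd (q, \<omega>)))))\<^sup>2 \<partial>lborel)"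
      by simp
  qed (use meas in auto)
qed

section \<open>Perturbation of a single pole or residue\<close>

definition unit_matrix :: "'m \<Rightarrow> 'n \<Rightarrow> complex^'n^'m" where
  "unit_matrix m n = (\<chi> i j. if i = m \<and> j = n then 1 else 0)"

lemma cscale_unit_nonzero:
  assumes "z \<noteq> 0"
  shows "axis k (cscale z (unit_matrix m n)) \<noteq> 0"
proof
  assume "axis k (cscale z (unit_matrix m n)) = 0"
  then have "axis k (cscale z (unit_matrix m n)) $ k $ m $ n = 0" by simp
  then show False using assms by (simp add: unit_matrix_def del: axis_eq_0_iff)
qed

lemma rank_one_unit_left: "rank_one l (unit_matrix m l) M $ i $ j = (if i = m then M $ l $ j else 0)"
  by (simp add: unit_matrix_def)

lemma rank_one_unit_right: "rank_one l M (unit_matrix l n) $ i $ j = (if j = n then M $ i $ l else 0)"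
  by (simp add: unit_matrix_def)

text \<open>
  A real-valued variation sees only the real part of a pairing; the complex directions \<open>1\<close> and \<open>\<i>\<close>
  together see all of it.
\<close>

lemma unimodular_test_vanishes:
  assumes "c \<noteq> 0" "\<And>z. norm z = 1 \<Longrightarrow> c * Re (cnj z * I) = 0"
  shows "I = 0"
  using assms(2)[of 1] assms(2)[of \<i>] \<open>c \<noteq> 0\<close> by (simp add: complex_eq_iff)

lemma param_sum_add_scaleR: "param_sum \<phi> (M + t *\<^sub>R N) q = param_sum \<phi> M q + t *\<^sub>R param_sum \<phi> N q"
  by (simp add: param_sum_def scaleR_add_right sum.distrib scaleR_sum_right mult.commute)

lemma param_sum_axis: "param_sum \<phi> (axis k E) q = \<phi> k q *\<^sub>R E"
  by (simp add: param_sum_def axis_def if_distrib[where f="\<lambda>x. _ *\<^sub>R x"] cong: if_cong)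

lemma rom_difference_one_pole:
  fixes A A' :: "(complex^'r^'r)^'a::finite" and B B' :: "(complex^'i^'r)^'b::finite" and C C' :: "(complex^'r^'o)^'c::finite"
  assumes "\<And>k. diagonal_matrix (A $ k)" "\<And>k. diagonal_matrix (A' $ k)"
    and "\<And>m. s \<noteq> param_sum \<alpha> A q $ m $ m" "\<And>m. s \<noteq> param_sum \<alpha> A' q $ m $ m"
    and same: "\<And>m. m \<noteq> l \<Longrightarrow> param_sum \<alpha> A' q $ m $ m = param_sum \<alpha> A q $ m $ m"
      "\<And>m. m \<noteq> l \<Longrightarrow> rank_one m (param_sum \<gamma> C' q) (param_sum \<beta> B' q) = rank_one m (param_sum \<gamma> C q) (param_sum \<beta> B q)"
  shows "rom \<alpha> \<beta> \<gamma> (A', B', C') s q - rom \<alpha> \<beta> \<gamma> (A, B, C) s q =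
     cscale (1 / (s - param_sum \<alpha> A' q $ l $ l)) (rank_one l (param_sum \<gamma> C' q) (param_sum \<beta> B' q)) -
     cscale (1 / (s - param_sum \<alpha> A q $ l $ l)) (rank_one l (param_sum \<gamma> C q) (param_sum \<beta> B q))"
proof -
  let ?f' = "\<lambda>m. cscale (1 / (s - param_sum \<alpha> A' q $ m $ m)) (rank_one m (param_sum \<gamma> C' q) (param_sum \<beta> B' q))"
  let ?f = "\<lambda>m. cscale (1 / (s - param_sum \<alpha> A q $ m $ m)) (rank_one m (param_sum \<gamma> C q) (param_sum \<beta> B q))"
  have "rom \<alpha> \<beta> \<gamma> (A', B', C') s q - rom \<alpha> \<beta> \<gamma> (A, B, C) s q = (\<Sum>m\<in>UNIV. ?f' m - ?f m)"
    by (simp only: rom_expansion[OF assms(1,3)] rom_expansion[OF assms(2,4)] sum_subtractf)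
  also have "\<dots> = (\<Sum>m\<in>UNIV. if m = l then ?f' l - ?f l else 0)"
    by (intro sum.cong) (auto simp: same)
  finally show ?thesis by simp
qed

text \<open>
  A pole \<open>p\<close> moves to \<open>p' = p + t * a * z\<close>. For \<open>\<bar>t\<bar> < 1 / (2 * L)\<close> the shift is at most half the distance
  of \<open>p\<close> from the imaginary axis, so \<open>p'\<close> stays stable and at least half as far from \<open>s\<close> as \<open>p\<close>. The
  difference quotient \<open>h\<close> of the resolvent is then controlled by the resolvent \<open>k\<close> itself, and so is its
  distance from the derivative \<open>z * a * k\<^sup>2\<close>.
\<close>

lemma pole_perturbation:
  fixes a L t :: real and z s p :: complex
  assumes a: "\<bar>a\<bar> \<le> L * \<bar>Re p\<bar>" and "0 < L" and p: "Re p < 0" and s: "Re s = 0" and z: "norm z = 1" and t: "\<bar>t\<bar> < 1 / (2 * L)"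
  defines "p' \<equiv> p + of_real (t * a) * z"
  defines "k \<equiv> 1 / (s - p)" and "h \<equiv> z * of_real a / ((s - p') * (s - p))"
  shows "Re p' < 0" "s \<noteq> p" "s \<noteq> p'"
    and "1 / (s - p') - 1 / (s - p) = of_real t * h"
    and "norm h \<le> 2 * L * norm k"
    and "norm (h - z * (of_real a * k\<^sup>2)) \<le> \<bar>t\<bar> * (2 * L\<^sup>2 * norm k)"
proof -
  have "\<bar>t\<bar> * \<bar>a\<bar> \<le> 1 / (2 * L) * (L * \<bar>Re p\<bar>)" using t a \<open>0 < L\<close> by (intro mult_mono) auto
  then have ta: "\<bar>t * a\<bar> \<le> \<bar>Re p\<bar> / 2" using \<open>0 < L\<close> by (simp add: abs_mult)
  have taz: "norm (of_real (t * a) * z) \<le> \<bar>Re p\<bar> / 2" using ta z by (simp only: norm_mult norm_of_real mult_1_right)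
  have "Re (of_real (t * a) * z) \<le> \<bar>Re p\<bar> / 2" using taz complex_Re_le_cmod order_trans by blast
  then show p': "Re p' < 0" using p unfolding p'_def plus_complex.sel by linarith
  show sp: "s \<noteq> p" "s \<noteq> p'" using p p' s by auto
  have "\<bar>Re p\<bar> \<le> norm (s - p)" using abs_Re_le_cmod[of "s - p"] s by simp
  moreover have "norm (s - p) \<le> norm (s - p') + norm (of_real (t * a) * z)"
    using norm_triangle_ineq[of "s - p'" "of_real (t * a) * z"] by (simp add: p'_def)
  ultimately have half: "norm (s - p) / 2 \<le> norm (s - p')" and Re: "\<bar>Re p\<bar> \<le> norm (s - p)" using taz by linarith+
  have a': "\<bar>a\<bar> \<le> L * norm (s - p)" using a Re \<open>0 < L\<close> by (meson order_trans mult_left_mono less_imp_le)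
  have pos: "0 < norm (s - p)" "0 < norm (s - p')" using sp by auto
  show "1 / (s - p') - 1 / (s - p) = of_real t * h"
    using sp by (simp add: h_def p'_def divide_simps)
  have x: "\<bar>a\<bar> / norm (s - p') \<le> 2 * L"
  proof -
    have "\<bar>a\<bar> \<le> 2 * L * (norm (s - p) / 2)" using a' by simp
    also have "\<dots> \<le> 2 * L * norm (s - p')" using half \<open>0 < L\<close> by (intro mult_left_mono) auto
    finally show ?thesis using pos by (simp add: field_simps)
  qed
  have "norm h = \<bar>a\<bar> / norm (s - p') * norm k"
    using z by (simp add: h_def k_def norm_mult norm_divide)
  also have "\<dots> \<le> 2 * L * norm k" using x by (intro mult_right_mono) auto
  finally show "norm h \<le> 2 * L * norm k" .
  have y: "\<bar>a\<bar> / norm (s - p) \<le> L" using a' pos by (simp add: field_simps)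
  have "h - z * (of_real a * k\<^sup>2) = of_real t * z\<^sup>2 * (of_real a / (s - p')) * (of_real a / (s - p)) * k"
    using sp by (simp add: h_def k_def p'_def divide_simps power2_eq_square) (simp add: algebra_simps power2_eq_square)
  then have "norm (h - z * (of_real a * k\<^sup>2)) = \<bar>t\<bar> * (\<bar>a\<bar> / norm (s - p') * (\<bar>a\<bar> / norm (s - p)) * norm k)"
    using z by (simp add: norm_mult norm_divide norm_power)
  also have "\<dots> \<le> \<bar>t\<bar> * (2 * L * L * norm k)"
    using x y \<open>0 < L\<close> by (intro mult_left_mono mult_right_mono mult_mono) auto
  finally show "norm (h - z * (of_real a * k\<^sup>2)) \<le> \<bar>t\<bar> * (2 * L\<^sup>2 * norm k)"
    by (simp add: power2_eq_square mult.assoc)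
qed

section \<open>First-order conditions at a local minimizer\<close>

text \<open>
  The constant \<open>L\<close> is the one produced by \<open>coefficients_bounded_by_decay\<close>.
\<close>

locale optimal_rom =
  fixes \<nu> :: "'q measure"
    and \<alpha> :: "'a::finite \<Rightarrow> 'q \<Rightarrow> real" and \<beta> :: "'b::finite \<Rightarrow> 'q \<Rightarrow> real" and \<gamma> :: "'c::finite \<Rightarrow> 'q \<Rightarrow> real"
    and H :: "complex \<Rightarrow> 'q \<Rightarrow> complex^'i::finite^'o::finite"
    and A :: "(complex^'r::finite^'r)^'a" and B :: "(complex^'i^'r)^'b" and C :: "(complex^'r^'o)^'c"
    and L :: real
  assumes H: "H \<in> h2l2 \<nu>"
    and meas_\<alpha>: "\<And>k. \<alpha> k \<in> borel_measurable \<nu>"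
    and meas_\<beta>: "\<And>k. \<beta> k \<in> borel_measurable \<nu>"
    and meas_\<gamma>: "\<And>k. \<gamma> k \<in> borel_measurable \<nu>"
    and diag: "\<And>k. diagonal_matrix (A $ k)"
    and integrability:
      "integrable \<nu> (\<lambda>q. ((\<Sum>j\<in>UNIV. \<bar>\<beta> j q\<bar>) * (\<Sum>k\<in>UNIV. \<bar>\<gamma> k q\<bar>))\<^sup>2 / (\<Sum>k\<in>UNIV. \<bar>\<alpha> k q\<bar>))"
    and L: "0 < L" "AE q in \<nu>. \<forall>k l. \<bar>\<alpha> k q\<bar> \<le> L * \<bar>Re (param_sum \<alpha> A q $ l $ l)\<bar>"
    and stable: "AE q in \<nu>. \<forall>l. Re (param_sum \<alpha> A q $ l $ l) < 0"
    and optimal: "optimal_dstrom \<nu> \<alpha> \<beta> \<gamma> H (A, B, C)"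
begin

abbreviation pole :: "'r \<Rightarrow> 'q \<Rightarrow> complex" where
  "pole l q \<equiv> param_sum \<alpha> A q $ l $ l"

definition err :: "complex \<Rightarrow> 'q \<Rightarrow> complex^'i^'o" where
  "err s q = H s q - rom \<alpha> \<beta> \<gamma> (A, B, C) s q"

definition weight :: "'q \<Rightarrow> real" where
  "weight q = (\<Sum>j\<in>UNIV. \<bar>\<beta> j q\<bar>) * (\<Sum>k\<in>UNIV. \<bar>\<gamma> k q\<bar>)"

text \<open>
  On the imaginary axis the complex conjugate of the resolvent with pole \<open>p\<close> is the Cauchy kernel of the
  mirror image \<open>- cnj p\<close>, which is why the interpolation points are the mirrored poles.
\<close>

definition kernel :: "'r \<Rightarrow> 'q \<times> real \<Rightarrow> complex" where
  "kernel l p = 1 / (\<i> * of_real (snd p) - pole l (fst p))"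

lemma err_h2l2: "err \<in> h2l2 \<nu>"
  using optimal by (simp add: optimal_dstrom_def err_def[abs_def])

lemma weight_measurable[measurable]: "weight \<in> borel_measurable \<nu>"
  using meas_\<beta> meas_\<gamma> unfolding weight_def[abs_def] by measurable

lemma pole_measurable[measurable]: "pole l \<in> borel_measurable \<nu>"
  by (intro borel_measurable_matrix_nth borel_measurable_param_sum meas_\<alpha>)

lemma pole_fst_measurable[measurable]: "(\<lambda>p. pole l (fst p)) \<in> borel_measurable (\<nu> \<Otimes>\<^sub>M lborel)"
  by (rule measurable_compose[OF measurable_fst pole_measurable])

lemma kernel_measurable[measurable]: "kernel l \<in> borel_measurable (\<nu> \<Otimes>\<^sub>M lborel)"
  unfolding kernel_def[abs_def] by measurable

lemma weighted_kernel_L2: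
  "integrable (\<nu> \<Otimes>\<^sub>M lborel) (\<lambda>p. (weight (fst p) * norm (kernel l p))\<^sup>2)"
proof -
  have "norm (kernel l p) = norm (1 / (pole l (fst p) - \<i> * of_real (snd p)))" for p
    by (simp add: kernel_def norm_divide norm_minus_commute)
  then show ?thesis
    using weighted_resolvent_L2[OF meas_\<alpha> weight_measurable stable L integrability[folded weight_def], of l] by simp
qed

text \<open>
  Local minimality over the product of the three parameter spaces, restricted to one line through the
  minimizer.
\<close>

lemma err_minimal:
  fixes PA :: "(complex^'r^'r)^'a" and PB :: "(complex^'i^'r)^'b" and PC :: "(complex^'r^'o)^'c"
  assumes "(PA, PB, PC) \<noteq> 0" and "\<And>k. diagonal_matrix (PA $ k)"
  shows "\<exists>\<delta>>0. \<forall>t. t \<noteq> 0 \<and> \<bar>t\<bar> < \<delta> \<longrightarrow>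
    (\<lambda>s q. H s q - rom \<alpha> \<beta> \<gamma> (A + t *\<^sub>R PA, B + t *\<^sub>R PB, C + t *\<^sub>R PC) s q) \<in> h2l2 \<nu> \<longrightarrow>
    h2l2_norm \<nu> err \<le> h2l2_norm \<nu> (\<lambda>s q. H s q - rom \<alpha> \<beta> \<gamma> (A + t *\<^sub>R PA, B + t *\<^sub>R PB, C + t *\<^sub>R PC) s q)"
proof -
  let ?X = "(A, B, C)" and ?P = "(PA, PB, PC)"
  have "((\<lambda>t::real. ?X + t *\<^sub>R ?P) \<longlongrightarrow> ?X + 0 *\<^sub>R ?P) (at 0)" by (intro tendsto_intros)
  then have "filterlim (\<lambda>t::real. ?X + t *\<^sub>R ?P) (at ?X within diagonal_params) (at 0)"
    unfolding filterlim_at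
  proof (intro conjI)
    show "\<forall>\<^sub>F t in at (0::real). ?X + t *\<^sub>R ?P \<in> diagonal_params \<and> ?X + t *\<^sub>R ?P \<noteq> ?X"
      unfolding eventually_at_filter
    proof (intro always_eventually allI impI conjI)
      fix t :: real assume "t \<noteq> 0"
      show "?X + t *\<^sub>R ?P \<in> diagonal_params"
        using diag assms(2) by (auto simp: diagonal_params_def diagonal_matrix_def)
      show "?X + t *\<^sub>R ?P \<noteq> ?X" using assms(1) \<open>t \<noteq> 0\<close> by (metis add_cancel_right_right scaleR_eq_0_iff)
    qed
  qed simp
  from eventually_compose_filterlim[OF _ this] optimal
  have "\<forall>\<^sub>F t in at (0::real). (\<lambda>s q. H s q - rom \<alpha> \<beta> \<gamma> (?X + t *\<^sub>R ?P) s q) \<in> h2l2 \<nu> \<longrightarrow>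
    h2l2_norm \<nu> (\<lambda>s q. H s q - rom \<alpha> \<beta> \<gamma> ?X s q) \<le> h2l2_norm \<nu> (\<lambda>s q. H s q - rom \<alpha> \<beta> \<gamma> (?X + t *\<^sub>R ?P) s q)"
    unfolding optimal_dstrom_def by blast
  then show ?thesis unfolding eventually_at by (auto simp: err_def[abs_def])
qed

text \<open>
  A direction \<open>(PA, PB, PC)\<close> whose effect on the model is concentrated at one pole: the increment on the
  imaginary axis is \<open>t\<close> times a scalar function of parameter and frequency times the matrix \<open>N q\<close>. As the
  scalar factors are bounded by the kernel of the pole, the perturbed error is square integrable and, by
  stability of the perturbed poles, a legitimate competitor. The error is therefore orthogonal to the
  tangent direction.
\<close>

lemma first_order_condition:
  fixes PA :: "(complex^'r^'r)^'a" and PB :: "(complex^'i^'r)^'b" and PC :: "(complex^'r^'o)^'c"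
    and N :: "'q \<Rightarrow> complex^'i^'o" and \<kappa> :: "'q \<times> real \<Rightarrow> complex" and \<kappa>t :: "real \<Rightarrow> 'q \<times> real \<Rightarrow> complex"
  assumes P: "(PA, PB, PC) \<noteq> 0" "\<And>k. diagonal_matrix (PA $ k)"
    and N[measurable]: "N \<in> borel_measurable \<nu>" and N_le: "\<And>q. norm (N q) \<le> K * weight q"
    and \<kappa>[measurable]: "\<kappa> \<in> borel_measurable (\<nu> \<Otimes>\<^sub>M lborel)" "\<And>t. \<kappa>t t \<in> borel_measurable (\<nu> \<Otimes>\<^sub>M lborel)"
    and "0 < \<delta>" "0 \<le> M" "0 \<le> K"
    and \<kappa>_le: "AE q in \<nu>. \<forall>\<omega>. norm (\<kappa> (q, \<omega>)) \<le> M * norm (kernel l (q, \<omega>))"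
    and pert: "\<And>t. \<bar>t\<bar> < \<delta> \<Longrightarrow> t \<noteq> 0 \<Longrightarrow> AE q in \<nu>.
       (\<forall>l. Re (param_sum \<alpha> (A + t *\<^sub>R PA) q $ l $ l) < 0) \<and>
       (\<forall>\<omega>. rom \<alpha> \<beta> \<gamma> (A + t *\<^sub>R PA, B + t *\<^sub>R PB, C + t *\<^sub>R PC) (\<i> * of_real \<omega>) q
          - rom \<alpha> \<beta> \<gamma> (A, B, C) (\<i> * of_real \<omega>) q = t *\<^sub>R cscale (\<kappa>t t (q, \<omega>)) (N q) \<and>
         norm (\<kappa>t t (q, \<omega>)) \<le> M * norm (kernel l (q, \<omega>)) \<and>
         norm (\<kappa>t t (q, \<omega>) - \<kappa> (q, \<omega>)) \<le> \<bar>t\<bar> * (M * norm (kernel l (q, \<omega>))))"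
  shows "(\<integral>p. on_axis err p \<bullet> cscale (\<kappa> p) (N (fst p)) \<partial>(\<nu> \<Otimes>\<^sub>M lborel)) = 0"
proof -
  let ?P = "\<nu> \<Otimes>\<^sub>M (lborel :: real measure)"
  let ?g = "\<lambda>p. M * K * (weight (fst p) * norm (kernel l p))"
  let ?G = "\<lambda>p. cscale (\<kappa> p) (N (fst p))" and ?Gt = "\<lambda>t p. cscale (\<kappa>t t p) (N (fst p))"
  note D = h2l2_L2[OF err_h2l2]
  have [measurable]: "(\<lambda>p. N (fst p)) \<in> borel_measurable ?P" by (rule measurable_compose[OF measurable_fst N])
  have G: "?G \<in> borel_measurable ?P" "\<And>t. ?Gt t \<in> borel_measurable ?P" by (intro borel_measurable_cscale; measurable)+
  have g[measurable]: "?g \<in> borel_measurable ?P" by measurable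
  have g2: "integrable ?P (\<lambda>p. (?g p)\<^sup>2)"
    unfolding power_mult_distrib[of "M * K"] by (intro integrable_mult_right weighted_kernel_L2)
  have le: "norm (cscale z (N q)) \<le> x * (M * K * (weight q * k))" if "norm z \<le> x * (M * k)" "0 \<le> x" "0 \<le> k" for z x k q
  proof -
    have "norm (cscale z (N q)) \<le> (x * (M * k)) * (K * weight q)"
      unfolding norm_cscale using that \<open>0 \<le> M\<close> by (intro mult_mono N_le) auto
    then show ?thesis by (simp add: ac_simps)
  qed
  obtain \<delta>' where \<delta>': "0 < \<delta>'" and min: "\<And>t. t \<noteq> 0 \<Longrightarrow> \<bar>t\<bar> < \<delta>' \<Longrightarrow>
    (\<lambda>s q. H s q - rom \<alpha> \<beta> \<gamma> (A + t *\<^sub>R PA, B + t *\<^sub>R PB, C + t *\<^sub>R PC) s q) \<in> h2l2 \<nu> \<Longrightarrow>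
    h2l2_norm \<nu> err \<le> h2l2_norm \<nu> (\<lambda>s q. H s q - rom \<alpha> \<beta> \<gamma> (A + t *\<^sub>R PA, B + t *\<^sub>R PB, C + t *\<^sub>R PC) s q)"
    using err_minimal[OF P] by blast
  show ?thesis
  proof (rule first_variation_vanishes[where Gt = ?Gt and g = ?g and \<delta> = "min \<delta> \<delta>'"])
    show "AE p in ?P. norm (?G p) \<le> ?g p"
      by (rule lborel.AE_pair_sections) (use \<kappa>_le le[where x = 1] in \<open>auto elim!: eventually_mono\<close>)
  next
    fix t assume "\<bar>t\<bar> < min \<delta> \<delta>'" "t \<noteq> 0"
    then have t: "\<bar>t\<bar> < \<delta>" "\<bar>t\<bar> < \<delta>'" "t \<noteq> 0" by auto
    have diffG: "?Gt t p - ?G p = cscale (\<kappa>t t p - \<kappa> p) (N (fst p))" for p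
      by (simp add: vec_eq_iff algebra_simps)
    show bounds: "AE p in ?P. norm (?Gt t p) \<le> ?g p \<and> norm (?Gt t p - ?G p) \<le> \<bar>t\<bar> * ?g p"
      unfolding diffG
    proof (rule lborel.AE_pair_sections)
      show "AE q in \<nu>. \<forall>\<omega>. norm (cscale (\<kappa>t t (q, \<omega>)) (N (fst (q, \<omega>)))) \<le> M * K * (weight (fst (q, \<omega>)) * norm (kernel l (q, \<omega>)))
        \<and> norm (cscale (\<kappa>t t (q, \<omega>) - \<kappa> (q, \<omega>)) (N (fst (q, \<omega>)))) \<le> \<bar>t\<bar> * (M * K * (weight (fst (q, \<omega>)) * norm (kernel l (q, \<omega>))))"
        using pert[OF t(1,3)]
      proof eventually_elim
        case (elim q)
        then show ?case using le[where x = 1] le[where x = "\<bar>t\<bar>"] by simp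
      qed
    qed
    define Dt where "Dt s q = H s q - rom \<alpha> \<beta> \<gamma> (A + t *\<^sub>R PA, B + t *\<^sub>R PB, C + t *\<^sub>R PC) s q" for s q
    have diag': "diagonal_matrix ((A + t *\<^sub>R PA) $ k)" for k
      using diag P(2) by (simp add: diagonal_matrix_def)
    have Dt_meas: "(\<lambda>(s, q). Dt s q) \<in> borel_measurable (restrict_space borel {s. 0 \<le> Re s} \<Otimes>\<^sub>M \<nu>)"
    proof -
      have "(\<lambda>(s, q). H s q) \<in> borel_measurable (restrict_space borel {s. 0 \<le> Re s} \<Otimes>\<^sub>M \<nu>)"
        using H by (simp add: h2l2_def)
      from borel_measurable_diff[OF this rom_measurable[OF meas_\<alpha> meas_\<beta> meas_\<gamma> diag', where B = "B + t *\<^sub>R PB" and C = "C + t *\<^sub>R PC"]]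
      show ?thesis by (simp add: Dt_def split_beta')
    qed
    note Dt_axis = on_axis_measurable[OF Dt_meas]
    have eq: "AE p in ?P. on_axis Dt p = on_axis err p - t *\<^sub>R ?Gt t p"
    proof (rule lborel.AE_pair_sections)
      show "AE q in \<nu>. \<forall>\<omega>. on_axis Dt (q, \<omega>) = on_axis err (q, \<omega>) - t *\<^sub>R cscale (\<kappa>t t (q, \<omega>)) (N (fst (q, \<omega>)))"
        using pert[OF t(1,3)]
      proof eventually_elim
        case (elim q)
        show ?case
        proof
          fix \<omega>
          have "rom \<alpha> \<beta> \<gamma> (A + t *\<^sub>R PA, B + t *\<^sub>R PB, C + t *\<^sub>R PC) (\<i> * of_real \<omega>) q
            - rom \<alpha> \<beta> \<gamma> (A, B, C) (\<i> * of_real \<omega>) q = t *\<^sub>R cscale (\<kappa>t t (q, \<omega>)) (N q)" using elim by blast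
          then show "on_axis Dt (q, \<omega>) = on_axis err (q, \<omega>) - t *\<^sub>R cscale (\<kappa>t t (q, \<omega>)) (N (fst (q, \<omega>)))"
            by (simp add: on_axis_def Dt_def err_def algebra_simps)
        qed
      qed
    qed
    have Gt2: "integrable ?P (\<lambda>p. (norm (t *\<^sub>R ?Gt t p))\<^sup>2)"
    proof (rule Bochner_Integration.integrable_bound)
      show "integrable ?P (\<lambda>p. t\<^sup>2 * (?g p)\<^sup>2)" by (intro integrable_mult_right g2)
      show "(\<lambda>p. (norm (t *\<^sub>R ?Gt t p))\<^sup>2) \<in> borel_measurable ?P" using G(2)[of t] by measurable
      show "AE p in ?P. norm ((norm (t *\<^sub>R ?Gt t p))\<^sup>2) \<le> norm (t\<^sup>2 * (?g p)\<^sup>2)"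
        using bounds
      proof eventually_elim
        case (elim p)
        then have "(norm (?Gt t p))\<^sup>2 \<le> (?g p)\<^sup>2" by (intro power_mono) auto
        then have "t\<^sup>2 * (norm (?Gt t p))\<^sup>2 \<le> t\<^sup>2 * (?g p)\<^sup>2" by (intro mult_left_mono) auto
        then show ?case by (simp add: power_mult_distrib)
      qed
    qed
    have diff2: "integrable ?P (\<lambda>p. (norm (on_axis err p - t *\<^sub>R ?Gt t p))\<^sup>2)"
      by (rule integrable_norm2_diff) (use D G(2) Gt2 in auto)
    have Dt2: "integrable ?P (\<lambda>p. (norm (on_axis Dt p))\<^sup>2)"
      by (rule integrable_cong_AE_imp[OF diff2]) (use Dt_axis eq in \<open>auto elim!: eventually_mono\<close>)
    have Dt_int: "(\<integral>p. (norm (on_axis Dt p))\<^sup>2 \<partial>?P) = (\<integral>p. (norm (on_axis err p - t *\<^sub>R ?Gt t p))\<^sup>2 \<partial>?P)"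
      by (rule integral_cong_AE) (use Dt_axis diff2 eq in \<open>auto elim!: eventually_mono\<close>)
    have Dt_hardy: "AE q in \<nu>. (\<lambda>s. Dt s q) \<in> hardy2"
    proof -
      have "AE q in \<nu>. (\<lambda>s. H s q) \<in> hardy2" using H by (simp add: h2l2_def)
      with pert[OF t(1,3)] show ?thesis
      proof eventually_elim
        case (elim q)
        have "(\<lambda>s. rom \<alpha> \<beta> \<gamma> (A + t *\<^sub>R PA, B + t *\<^sub>R PB, C + t *\<^sub>R PC) s q) \<in> hardy2"
          by (rule hardy2_rom[OF diag']) (use elim(1) in blast)
        from hardy2_add[OF elim(2) hardy2_uminus[OF this]] show ?case by (simp add: Dt_def)
      qed
    qed
    have "Dt \<in> h2l2 \<nu>"
      unfolding h2l2_def using Dt_meas Dt_hardy h2l2_norm_power2(1)[OF Dt_axis Dt2] by simp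
    then have "h2l2_norm \<nu> err \<le> h2l2_norm \<nu> Dt" using min[OF t(3,2)] unfolding Dt_def by blast
    moreover have "0 \<le> h2l2_norm \<nu> err" by (simp add: h2l2_norm_def)
    ultimately have "(h2l2_norm \<nu> err)\<^sup>2 \<le> (h2l2_norm \<nu> Dt)\<^sup>2" by (intro power_mono)
    then have "(\<integral>p. (norm (on_axis err p))\<^sup>2 \<partial>?P) \<le> (\<integral>p. (norm (on_axis Dt p))\<^sup>2 \<partial>?P)"
      unfolding h2l2_norm_power2(2)[OF D] h2l2_norm_power2(2)[OF Dt_axis Dt2]
      by (rule mult_le_cancel_left_pos[THEN iffD1, rotated]) simp
    then show "(\<integral>p. (norm (on_axis err p))\<^sup>2 \<partial>?P) \<le> (\<integral>p. (norm (on_axis err p - t *\<^sub>R ?Gt t p))\<^sup>2 \<partial>?P)"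
      unfolding Dt_int .
  qed (use D G g g2 \<open>0 < \<delta>\<close> \<delta>' in auto)
qed

lemma cnj_kernel: "cnj (kernel l (q, \<omega>)) = 1 / (- cnj (pole l q) - \<i> * of_real \<omega>)"
  by (simp add: kernel_def)

lemma kernel_nonzero: "Re (pole l q) < 0 \<Longrightarrow> \<i> * of_real \<omega> - pole l q \<noteq> 0"
  by (auto simp: complex_eq_iff)

lemma norm_kernel_le: "Re (pole l q) < 0 \<Longrightarrow> norm (kernel l (q, \<omega>)) \<le> 1 / \<bar>Re (pole l q)\<bar>"
  using abs_Re_le_cmod[of "\<i> * of_real \<omega> - pole l q"] kernel_nonzero[of q l \<omega>]
  unfolding kernel_def norm_divide norm_one by (intro divide_left_mono mult_pos_pos) auto

lemma weighted_L2:
  assumes N[measurable]: "N \<in> borel_measurable \<nu>" and N_le: "\<And>q. norm (N q) \<le> K * weight q" and "0 \<le> K" "0 \<le> M"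
    and \<kappa>[measurable]: "\<kappa> \<in> borel_measurable (\<nu> \<Otimes>\<^sub>M lborel)"
    and \<kappa>_le: "AE q in \<nu>. \<forall>\<omega>. norm (\<kappa> (q, \<omega>)) \<le> M * norm (kernel l (q, \<omega>))"
  shows "(\<lambda>p. cscale (\<kappa> p) (N (fst p))) \<in> borel_measurable (\<nu> \<Otimes>\<^sub>M lborel)"
    and "integrable (\<nu> \<Otimes>\<^sub>M lborel) (\<lambda>p. (norm (cscale (\<kappa> p) (N (fst p))))\<^sup>2)"
proof -
  let ?P = "\<nu> \<Otimes>\<^sub>M (lborel :: real measure)"
  have [measurable]: "(\<lambda>p. N (fst p)) \<in> borel_measurable ?P" by (rule measurable_compose[OF measurable_fst N])
  show G: "(\<lambda>p. cscale (\<kappa> p) (N (fst p))) \<in> borel_measurable ?P" by (intro borel_measurable_cscale; measurable)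
  show "integrable ?P (\<lambda>p. (norm (cscale (\<kappa> p) (N (fst p))))\<^sup>2)"
  proof (rule Bochner_Integration.integrable_bound)
    show "integrable ?P (\<lambda>p. (M * K)\<^sup>2 * (weight (fst p) * norm (kernel l p))\<^sup>2)"
      by (intro integrable_mult_right weighted_kernel_L2)
    show "(\<lambda>p. (norm (cscale (\<kappa> p) (N (fst p))))\<^sup>2) \<in> borel_measurable ?P" using G by measurable
    show "AE p in ?P. norm ((norm (cscale (\<kappa> p) (N (fst p))))\<^sup>2) \<le> norm ((M * K)\<^sup>2 * (weight (fst p) * norm (kernel l p))\<^sup>2)"
    proof (rule lborel.AE_pair_sections, use \<kappa>_le in eventually_elim, intro allI)
      fix q \<omega> assume "\<forall>\<omega>. norm (\<kappa> (q, \<omega>)) \<le> M * norm (kernel l (q, \<omega>))"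
      then have "norm (cscale (\<kappa> (q, \<omega>)) (N q)) \<le> (M * norm (kernel l (q, \<omega>))) * (K * weight q)"
        unfolding norm_cscale using \<open>0 \<le> M\<close> by (intro mult_mono N_le) auto
      then have "(norm (cscale (\<kappa> (q, \<omega>)) (N q)))\<^sup>2 \<le> ((M * norm (kernel l (q, \<omega>))) * (K * weight q))\<^sup>2"
        by (intro power_mono) auto
      then show "norm ((norm (cscale (\<kappa> (q, \<omega>)) (N (fst (q, \<omega>)))))\<^sup>2)
          \<le> norm ((M * K)\<^sup>2 * (weight (fst (q, \<omega>)) * norm (kernel l (q, \<omega>)))\<^sup>2)"
        by (simp add: power_mult_distrib ac_simps)
    qed
  qed
qed

lemma h2l2_entries:
  fixes F :: "complex \<Rightarrow> 'q \<Rightarrow> complex^'n^'m"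
  assumes F: "F \<in> h2l2 \<nu>"
  shows "AE q in \<nu>. \<exists>K. \<forall>i j. hardy_function (\<lambda>s. F s q $ i $ j) K"
proof -
  have "AE q in \<nu>. (\<lambda>s. F s q) \<in> hardy2" using F by (simp add: h2l2_def)
  with AE_space show ?thesis
    by eventually_elim (rule hardy2_component, simp, rule axis_section_measurable[OF h2l2_L2(1)[OF F]])
qed

text \<open>
  Cauchy's formula evaluates the pairing with the resolvent kernel at the mirrored pole.
\<close>

lemma resolvent_pairing:
  fixes F :: "complex \<Rightarrow> 'q \<Rightarrow> complex^'i^'o" and N :: "'q \<Rightarrow> complex^'i^'o"
  assumes F: "F \<in> h2l2 \<nu>"
    and N: "N \<in> borel_measurable \<nu>" "\<And>q. norm (N q) \<le> K * weight q" "0 \<le> K"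
  shows "integrable (completion \<nu>) (\<lambda>q. \<Sum>i\<in>UNIV. \<Sum>j\<in>UNIV. cnj (N q $ i $ j) * F (- cnj (pole l q)) q $ i $ j)"
    and "(\<integral>p. on_axis F p \<bullet> cscale (z * kernel l p) (N (fst p)) \<partial>(\<nu> \<Otimes>\<^sub>M lborel)) =
        2 * pi * Re (cnj z * (\<integral>q. (\<Sum>i\<in>UNIV. \<Sum>j\<in>UNIV. cnj (N q $ i $ j) * F (- cnj (pole l q)) q $ i $ j) \<partial>completion \<nu>))"
proof -
  have G: "(\<lambda>p. cscale (kernel l p) (N (fst p))) \<in> borel_measurable (\<nu> \<Otimes>\<^sub>M lborel)"
    "integrable (\<nu> \<Otimes>\<^sub>M lborel) (\<lambda>p. (norm (cscale (kernel l p) (N (fst p))))\<^sup>2)"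
    using weighted_L2[OF N, where M = 1 and \<kappa> = "kernel l" and l = l] by simp_all
  have T: "AE q in \<nu>. \<forall>i j. integrable lborel (\<lambda>\<omega>. F (\<i> * of_real \<omega>) q $ i $ j * cnj (kernel l (q, \<omega>))) \<and>
        (\<integral>\<omega>. F (\<i> * of_real \<omega>) q $ i $ j * cnj (kernel l (q, \<omega>)) \<partial>lborel) = of_real (2 * pi) * F (- cnj (pole l q)) q $ i $ j"
    using h2l2_entries[OF F] stable
  proof eventually_elim
    case (elim q)
    then obtain K where h: "\<And>i j. hardy_function (\<lambda>s. F s q $ i $ j) K" by blast
    have p: "0 < Re (- cnj (pole l q))" using elim by simp
    show ?case unfolding cnj_kernel
      using hardy_function.boundary_pairing_integrable[OF h p] hardy_function.Cauchy_boundary[OF h p] by simp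
  qed
  note bp = boundary_pairing[OF F G T]
  show "integrable (completion \<nu>) (\<lambda>q. \<Sum>i\<in>UNIV. \<Sum>j\<in>UNIV. cnj (N q $ i $ j) * F (- cnj (pole l q)) q $ i $ j)"
    by (rule bp(1)) simp
  show "(\<integral>p. on_axis F p \<bullet> cscale (z * kernel l p) (N (fst p)) \<partial>(\<nu> \<Otimes>\<^sub>M lborel)) =
        2 * pi * Re (cnj z * (\<integral>q. (\<Sum>i\<in>UNIV. \<Sum>j\<in>UNIV. cnj (N q $ i $ j) * F (- cnj (pole l q)) q $ i $ j) \<partial>completion \<nu>))"
    by (rule bp(2)) simp
qed

lemma square_kernel_bound:
  "AE q in \<nu>. \<forall>\<omega>. norm (of_real (\<alpha> k q) * (kernel l (q, \<omega>))\<^sup>2) \<le> L * norm (kernel l (q, \<omega>))"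
  using stable L(2)
proof eventually_elim
  case (elim q)
  show ?case
  proof
    fix \<omega>
    have st: "Re (pole l q) < 0" using elim by blast
    have "\<bar>\<alpha> k q\<bar> * norm (kernel l (q, \<omega>)) \<le> (L * \<bar>Re (pole l q)\<bar>) * (1 / \<bar>Re (pole l q)\<bar>)"
      using elim L(1) by (intro mult_mono norm_kernel_le[OF st]) auto
    also have "\<dots> = L" using st by simp
    finally have "(\<bar>\<alpha> k q\<bar> * norm (kernel l (q, \<omega>))) * norm (kernel l (q, \<omega>)) \<le> L * norm (kernel l (q, \<omega>))"
      by (rule mult_right_mono) simp
    then show "norm (of_real (\<alpha> k q) * (kernel l (q, \<omega>))\<^sup>2) \<le> L * norm (kernel l (q, \<omega>))"
      by (simp add: norm_mult norm_power power2_eq_square mult.assoc)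
  qed
qed

lemma \<alpha>_fst_measurable: "(\<lambda>p. \<alpha> k (fst p)) \<in> borel_measurable (\<nu> \<Otimes>\<^sub>M lborel)"
  by (rule measurable_compose[OF measurable_fst meas_\<alpha>])

lemma square_kernel_measurable:
  "(\<lambda>p. of_real (\<alpha> k (fst p)) * (kernel l p)\<^sup>2) \<in> borel_measurable (\<nu> \<Otimes>\<^sub>M lborel)"
  using \<alpha>_fst_measurable by measurable

text \<open>
  The squared kernel is paired in the same way with the derivative. The factor \<open>\<alpha> k q\<close> is essential, since
  only \<open>\<alpha>\<close> times the squared kernel is bounded by a multiple of the kernel.
\<close>

lemma derivative_pairing:
  fixes F :: "complex \<Rightarrow> 'q \<Rightarrow> complex^'i^'o" and N T :: "'q \<Rightarrow> complex^'i^'o" and k l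
  assumes F: "F \<in> h2l2 \<nu>"
    and N: "N \<in> borel_measurable \<nu>" "\<And>q. norm (N q) \<le> K * weight q" "0 \<le> K"
  defines "T \<equiv> \<lambda>q. \<alpha> k q *\<^sub>R matrix_deriv (\<lambda>s. F s q) (- cnj (pole l q))"
  shows "integrable (completion \<nu>) (\<lambda>q. \<Sum>i\<in>UNIV. \<Sum>j\<in>UNIV. cnj (N q $ i $ j) * T q $ i $ j)"
    and "(\<integral>p. on_axis F p \<bullet> cscale (z * (of_real (\<alpha> k (fst p)) * (kernel l p)\<^sup>2)) (N (fst p)) \<partial>(\<nu> \<Otimes>\<^sub>M lborel)) =
        - (2 * pi) * Re (cnj z * (\<integral>q. (\<Sum>i\<in>UNIV. \<Sum>j\<in>UNIV. cnj (N q $ i $ j) * T q $ i $ j) \<partial>completion \<nu>))"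
proof -
  let ?\<kappa> = "\<lambda>p. of_real (\<alpha> k (fst p)) * (kernel l p)\<^sup>2"
  have G: "(\<lambda>p. cscale (?\<kappa> p) (N (fst p))) \<in> borel_measurable (\<nu> \<Otimes>\<^sub>M lborel)"
    "integrable (\<nu> \<Otimes>\<^sub>M lborel) (\<lambda>p. (norm (cscale (?\<kappa> p) (N (fst p))))\<^sup>2)"
    using weighted_L2[OF N _ square_kernel_measurable, where M = L and l = l and l1 = l and k1 = k] square_kernel_bound[of k l] L(1) by simp_all
  have T: "AE q in \<nu>. \<forall>i j. integrable lborel (\<lambda>\<omega>. F (\<i> * of_real \<omega>) q $ i $ j * cnj (?\<kappa> (q, \<omega>))) \<and>
        (\<integral>\<omega>. F (\<i> * of_real \<omega>) q $ i $ j * cnj (?\<kappa> (q, \<omega>)) \<partial>lborel) = of_real (- (2 * pi)) * T q $ i $ j"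
    using h2l2_entries[OF F] stable
  proof eventually_elim
    case (elim q)
    then obtain K where h: "\<And>i j. hardy_function (\<lambda>s. F s q $ i $ j) K" by blast
    have p: "0 < Re (- cnj (pole l q))" using elim by simp
    have eq: "F (\<i> * of_real \<omega>) q $ i $ j * cnj (?\<kappa> (q, \<omega>)) =
        of_real (\<alpha> k q) * (F (\<i> * of_real \<omega>) q $ i $ j * (1 / (- cnj (pole l q) - \<i> * of_real \<omega>))\<^sup>2)" for i j \<omega>
      by (simp add: cnj_kernel)
    show ?case
    proof (intro allI conjI)
      fix i j
      show "integrable lborel (\<lambda>\<omega>. F (\<i> * of_real \<omega>) q $ i $ j * cnj (?\<kappa> (q, \<omega>)))"
        unfolding eq by (intro integrable_mult_right hardy_function.boundary_pairing_square_integrable[OF h p])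
      show "(\<integral>\<omega>. F (\<i> * of_real \<omega>) q $ i $ j * cnj (?\<kappa> (q, \<omega>)) \<partial>lborel) = of_real (- (2 * pi)) * T q $ i $ j"
        unfolding eq integral_mult_right_zero hardy_function.Cauchy_boundary_deriv[OF h p]
        by (simp add: T_def matrix_deriv_def scaleR_conv_of_real[where 'a=complex])
    qed
  qed
  note bp = boundary_pairing[OF F G T]
  show "integrable (completion \<nu>) (\<lambda>q. \<Sum>i\<in>UNIV. \<Sum>j\<in>UNIV. cnj (N q $ i $ j) * T q $ i $ j)"
    by (rule bp(1)) simp
  show "(\<integral>p. on_axis F p \<bullet> cscale (z * ?\<kappa> p) (N (fst p)) \<partial>(\<nu> \<Otimes>\<^sub>M lborel)) =
        - (2 * pi) * Re (cnj z * (\<integral>q. (\<Sum>i\<in>UNIV. \<Sum>j\<in>UNIV. cnj (N q $ i $ j) * T q $ i $ j) \<partial>completion \<nu>))"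
    by (rule bp(2)) simp
qed

lemma coefficient_measurable: "param_sum \<beta> B \<in> borel_measurable \<nu>" "param_sum \<gamma> C \<in> borel_measurable \<nu>"
  by (intro borel_measurable_param_sum meas_\<beta> meas_\<gamma>)+

lemma coefficient_le_sum: "\<bar>\<beta> j q\<bar> \<le> (\<Sum>j\<in>UNIV. \<bar>\<beta> j q\<bar>)" "\<bar>\<gamma> k q\<bar> \<le> (\<Sum>k\<in>UNIV. \<bar>\<gamma> k q\<bar>)"
  by (rule member_le_sum; simp)+

lemma residue_directions_le:
  "norm (\<gamma> k q *\<^sub>R rank_one l (unit_matrix m l :: complex^'r^'o) (param_sum \<beta> B q))
    \<le> (norm (unit_matrix m l :: complex^'r^'o) * (\<Sum>j\<in>UNIV. norm (B $ j))) * weight q"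
  "norm (\<beta> j q *\<^sub>R rank_one l (param_sum \<gamma> C q) (unit_matrix l n :: complex^'i^'r))
    \<le> ((\<Sum>k\<in>UNIV. norm (C $ k)) * norm (unit_matrix l n :: complex^'i^'r)) * weight q"
  "norm (rank_one l (param_sum \<gamma> C q) (param_sum \<beta> B q))
    \<le> ((\<Sum>k\<in>UNIV. norm (C $ k)) * (\<Sum>j\<in>UNIV. norm (B $ j))) * weight q"
proof -
  let ?b = "\<Sum>j\<in>UNIV. \<bar>\<beta> j q\<bar>" and ?c = "\<Sum>k\<in>UNIV. \<bar>\<gamma> k q\<bar>"
  have nn: "0 \<le> ?b" "0 \<le> ?c" by (auto intro: sum_nonneg)
  have "\<bar>\<gamma> k q\<bar> * norm (rank_one l (unit_matrix m l :: complex^'r^'o) (param_sum \<beta> B q))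
      \<le> ?c * (norm (unit_matrix m l :: complex^'r^'o) * ((\<Sum>j\<in>UNIV. norm (B $ j)) * ?b))"
    by (intro mult_mono coefficient_le_sum order_trans[OF norm_rank_one] norm_param_sum order_refl mult_nonneg_nonneg nn sum_nonneg) auto
  then show "norm (\<gamma> k q *\<^sub>R rank_one l (unit_matrix m l :: complex^'r^'o) (param_sum \<beta> B q))
    \<le> (norm (unit_matrix m l :: complex^'r^'o) * (\<Sum>j\<in>UNIV. norm (B $ j))) * weight q"
    unfolding norm_scaleR weight_def by (simp only: mult_ac)
  have "\<bar>\<beta> j q\<bar> * norm (rank_one l (param_sum \<gamma> C q) (unit_matrix l n :: complex^'i^'r))
      \<le> ?b * (((\<Sum>k\<in>UNIV. norm (C $ k)) * ?c) * norm (unit_matrix l n :: complex^'i^'r))"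
    by (intro mult_mono coefficient_le_sum order_trans[OF norm_rank_one] norm_param_sum order_refl mult_nonneg_nonneg nn sum_nonneg) auto
  then show "norm (\<beta> j q *\<^sub>R rank_one l (param_sum \<gamma> C q) (unit_matrix l n :: complex^'i^'r))
    \<le> ((\<Sum>k\<in>UNIV. norm (C $ k)) * norm (unit_matrix l n :: complex^'i^'r)) * weight q"
    unfolding norm_scaleR weight_def by (simp only: mult_ac)
  have "norm (rank_one l (param_sum \<gamma> C q) (param_sum \<beta> B q))
      \<le> ((\<Sum>k\<in>UNIV. norm (C $ k)) * ?c) * ((\<Sum>j\<in>UNIV. norm (B $ j)) * ?b)"
    by (intro order_trans[OF norm_rank_one] mult_mono norm_param_sum mult_nonneg_nonneg nn sum_nonneg) auto
  then show "norm (rank_one l (param_sum \<gamma> C q) (param_sum \<beta> B q))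
    \<le> ((\<Sum>k\<in>UNIV. norm (C $ k)) * (\<Sum>j\<in>UNIV. norm (B $ j))) * weight q"
    unfolding weight_def by (simp only: mult_ac)
qed

lemma residue_directions_measurable:
  "(\<lambda>q. \<gamma> k q *\<^sub>R rank_one l (unit_matrix m l) (param_sum \<beta> B q)) \<in> borel_measurable \<nu>"
  "(\<lambda>q. \<beta> j q *\<^sub>R rank_one l (param_sum \<gamma> C q) (unit_matrix l n)) \<in> borel_measurable \<nu>"
  "(\<lambda>q. rank_one l (param_sum \<gamma> C q) (param_sum \<beta> B q)) \<in> borel_measurable \<nu>"
  by (intro borel_measurable_scaleR borel_measurable_rank_one coefficient_measurable meas_\<beta> meas_\<gamma> borel_measurable_const)+

text \<open>
  Changing \<open>B\<close> or \<open>C\<close> in one entry leaves all poles fixed and changes the residue at a single pole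
  linearly, so the increment of the model is exactly linear in \<open>t\<close>.
\<close>

lemma stationary_residue:
  fixes PB :: "complex \<Rightarrow> (complex^'i^'r)^'b" and PC :: "complex \<Rightarrow> (complex^'r^'o)^'c"
    and N :: "'q \<Rightarrow> complex^'i^'o" and l
  assumes nonzero: "\<And>z. z \<noteq> 0 \<Longrightarrow> (PB z, PC z) \<noteq> 0"
    and N: "N \<in> borel_measurable \<nu>" "\<And>q. norm (N q) \<le> K * weight q" and K: "0 \<le> K"
    and residue: "\<And>z t q m. rank_one m (param_sum \<gamma> (C + t *\<^sub>R PC z) q) (param_sum \<beta> (B + t *\<^sub>R PB z) q)
      = rank_one m (param_sum \<gamma> C q) (param_sum \<beta> B q) + (if m = l then cscale (of_real t * z) (N q) else 0)"
  shows "(\<integral>q. (\<Sum>i\<in>UNIV. \<Sum>j\<in>UNIV. cnj (N q $ i $ j) * err (- cnj (pole l q)) q $ i $ j) \<partial>completion \<nu>) = 0"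
proof (rule unimodular_test_vanishes)
  fix z :: complex assume z: "norm z = 1"
  have "(\<integral>p. on_axis err p \<bullet> cscale (z * kernel l p) (N (fst p)) \<partial>(\<nu> \<Otimes>\<^sub>M lborel)) = 0"
  proof (rule first_order_condition[where PA = 0 and PB = "PB z" and PC = "PC z"
        and \<kappa>t = "\<lambda>t p. z * kernel l p" and l = l and \<delta> = 1 and M = 1])
    have "z \<noteq> 0" using z by auto
    from nonzero[OF this] show "(0, PB z, PC z) \<noteq> 0" by (auto simp: zero_prod_def)
    fix t :: real
    show "AE q in \<nu>. (\<forall>l. Re (param_sum \<alpha> (A + t *\<^sub>R 0) q $ l $ l) < 0) \<and>
      (\<forall>\<omega>. rom \<alpha> \<beta> \<gamma> (A + t *\<^sub>R 0, B + t *\<^sub>R PB z, C + t *\<^sub>R PC z) (\<i> * of_real \<omega>) q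
          - rom \<alpha> \<beta> \<gamma> (A, B, C) (\<i> * of_real \<omega>) q = t *\<^sub>R cscale (z * kernel l (q, \<omega>)) (N q) \<and>
         norm (z * kernel l (q, \<omega>)) \<le> 1 * norm (kernel l (q, \<omega>)) \<and>
         norm (z * kernel l (q, \<omega>) - z * kernel l (q, \<omega>)) \<le> \<bar>t\<bar> * (1 * norm (kernel l (q, \<omega>))))"
      using stable
    proof eventually_elim
      case (elim q)
      have ne: "\<i> * of_real \<omega> \<noteq> pole m q" for m \<omega>
        using elim[rule_format, of m] by (auto simp: complex_eq_iff)
      have "rom \<alpha> \<beta> \<gamma> (A, B + t *\<^sub>R PB z, C + t *\<^sub>R PC z) (\<i> * of_real \<omega>) q - rom \<alpha> \<beta> \<gamma> (A, B, C) (\<i> * of_real \<omega>) q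
        = t *\<^sub>R cscale (z * kernel l (q, \<omega>)) (N q)" for \<omega>
        by (subst rom_difference_one_pole[where l = l, OF diag diag ne ne refl])
          (simp_all add: residue, simp add: vec_eq_iff kernel_def scaleR_conv_of_real[where 'a=complex]
            ring_distribs add_divide_distrib)
      then show ?case using elim z by (simp add: norm_mult)
    qed
  qed (use N K z in \<open>auto simp: norm_mult diagonal_matrix_def\<close>)
  then show "2 * pi * Re (cnj z * (\<integral>q. (\<Sum>i\<in>UNIV. \<Sum>j\<in>UNIV. cnj (N q $ i $ j) * err (- cnj (pole l q)) q $ i $ j) \<partial>completion \<nu>)) = 0"
    unfolding resolvent_pairing(2)[OF err_h2l2 N K] .
qed simp

lemma stationary_output:
  fixes m :: 'o
  shows "(\<integral>q. (\<Sum>i\<in>UNIV. \<Sum>j\<in>UNIV. cnj ((\<gamma> k q *\<^sub>R rank_one l (unit_matrix m l) (param_sum \<beta> B q)) $ i $ j)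
      * err (- cnj (pole l q)) q $ i $ j) \<partial>completion \<nu>) = 0"
proof (rule stationary_residue[where PB = "\<lambda>z. 0" and PC = "\<lambda>z. axis k (cscale z (unit_matrix m l))"])
  show "(0, axis k (cscale z (unit_matrix m l))) \<noteq> 0" if "z \<noteq> 0" for z
    using cscale_unit_nonzero[OF that] by (simp add: zero_prod_def)
  show "0 \<le> norm (unit_matrix m l :: complex^'r^'o) * (\<Sum>j\<in>UNIV. norm (B $ j))"
    by (intro mult_nonneg_nonneg sum_nonneg) auto
qed (rule residue_directions_measurable residue_directions_le
      | simp add: vec_eq_iff param_sum_add_scaleR param_sum_axis unit_matrix_def
          scaleR_conv_of_real[where 'a=complex] ring_distribs)+

lemma stationary_input:
  fixes n :: 'i
  shows "(\<integral>q. (\<Sum>i\<in>UNIV. \<Sum>j\<in>UNIV. cnj ((\<beta> j0 q *\<^sub>R rank_one l (param_sum \<gamma> C q) (unit_matrix l n)) $ i $ j)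
      * err (- cnj (pole l q)) q $ i $ j) \<partial>completion \<nu>) = 0"
proof (rule stationary_residue[where PB = "\<lambda>z. axis j0 (cscale z (unit_matrix l n))" and PC = "\<lambda>z. 0"])
  show "(axis j0 (cscale z (unit_matrix l n)), 0) \<noteq> 0" if "z \<noteq> 0" for z
    using cscale_unit_nonzero[OF that] by (simp add: zero_prod_def)
  show "0 \<le> (\<Sum>k\<in>UNIV. norm (C $ k)) * norm (unit_matrix l n :: complex^'i^'r)"
    by (intro mult_nonneg_nonneg sum_nonneg) auto
qed (rule residue_directions_measurable residue_directions_le
      | simp add: vec_eq_iff param_sum_add_scaleR param_sum_axis unit_matrix_def
          scaleR_conv_of_real[where 'a=complex] ring_distribs)+

text \<open>
  Changing one diagonal entry of one \<open>A\<close>-coefficient moves a single pole and leaves all residues fixed;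
  the tangent direction carries the square of the kernel, and hence the derivative of the error appears.
\<close>

lemma stationary_pole:
  fixes k l
  defines "N \<equiv> \<lambda>q. rank_one l (param_sum \<gamma> C q) (param_sum \<beta> B q)"
  shows "(\<integral>q. (\<Sum>i\<in>UNIV. \<Sum>j\<in>UNIV. cnj (N q $ i $ j) *
      (\<alpha> k q *\<^sub>R matrix_deriv (\<lambda>s. err s q) (- cnj (pole l q))) $ i $ j) \<partial>completion \<nu>) = 0"
proof (rule unimodular_test_vanishes)
  fix z :: complex assume z: "norm z = 1"
  let ?K = "(\<Sum>k\<in>UNIV. norm (C $ k)) * (\<Sum>j\<in>UNIV. norm (B $ j))"
  let ?E = "axis k (cscale z (unit_matrix l l)) :: (complex^'r^'r)^'a"
  let ?\<kappa> = "\<lambda>p. of_real (\<alpha> k (fst p)) * (kernel l p)\<^sup>2"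
  let ?p' = "\<lambda>t q. pole l q + of_real (t * \<alpha> k q) * z"
  let ?\<kappa>t = "\<lambda>t p. z * of_real (\<alpha> k (fst p)) / ((\<i> * of_real (snd p) - ?p' t (fst p)) * (\<i> * of_real (snd p) - pole l (fst p)))"
  have K: "0 \<le> ?K" by (intro mult_nonneg_nonneg sum_nonneg) auto
  have N: "N \<in> borel_measurable \<nu>" "\<And>q. norm (N q) \<le> ?K * weight q"
    unfolding N_def by (rule residue_directions_measurable residue_directions_le)+
  note [measurable] = \<alpha>_fst_measurable square_kernel_measurable
  have "(\<integral>p. on_axis err p \<bullet> cscale (z * ?\<kappa> p) (N (fst p)) \<partial>(\<nu> \<Otimes>\<^sub>M lborel)) = 0"
  proof (rule first_order_condition[where PA = ?E and PB = 0 and PC = 0 and \<kappa>t = ?\<kappa>t and l = l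
        and \<delta> = "1 / (2 * L)" and M = "2 * L + 2 * L\<^sup>2"])
    have "z \<noteq> 0" using z by auto
    then show "(?E, 0, 0) \<noteq> 0" using cscale_unit_nonzero by (auto simp: prod_eq_iff)
    show "diagonal_matrix (?E $ i)" for i by (simp add: diagonal_matrix_def axis_def unit_matrix_def)
    show "(\<lambda>p. z * ?\<kappa> p) \<in> borel_measurable (\<nu> \<Otimes>\<^sub>M lborel)" by measurable
    show "?\<kappa>t t \<in> borel_measurable (\<nu> \<Otimes>\<^sub>M lborel)" for t by measurable
    show "AE q in \<nu>. \<forall>\<omega>. norm (z * ?\<kappa> (q, \<omega>)) \<le> (2 * L + 2 * L\<^sup>2) * norm (kernel l (q, \<omega>))"
      using square_kernel_bound[of k l]
    proof eventually_elim
      case (elim q)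
      show ?case
      proof
        fix \<omega>
        have "norm (z * ?\<kappa> (q, \<omega>)) \<le> L * norm (kernel l (q, \<omega>))" using elim z by (simp add: norm_mult)
        also have "\<dots> \<le> (2 * L + 2 * L\<^sup>2) * norm (kernel l (q, \<omega>))" using L(1) by (intro mult_right_mono) auto
        finally show "norm (z * ?\<kappa> (q, \<omega>)) \<le> (2 * L + 2 * L\<^sup>2) * norm (kernel l (q, \<omega>))" .
      qed
    qed
    fix t :: real assume t: "\<bar>t\<bar> < 1 / (2 * L)"
    have pole': "param_sum \<alpha> (A + t *\<^sub>R ?E) q $ m $ m = (if m = l then ?p' t q else pole m q)" for m q
      by (simp add: param_sum_add_scaleR param_sum_axis unit_matrix_def scaleR_conv_of_real[where 'a=complex] ac_simps)
    have diag': "diagonal_matrix ((A + t *\<^sub>R ?E) $ i)" for i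
      using diag by (simp add: diagonal_matrix_def axis_def unit_matrix_def)
    show "AE q in \<nu>. (\<forall>m. Re (param_sum \<alpha> (A + t *\<^sub>R ?E) q $ m $ m) < 0) \<and>
      (\<forall>\<omega>. rom \<alpha> \<beta> \<gamma> (A + t *\<^sub>R ?E, B + t *\<^sub>R 0, C + t *\<^sub>R 0) (\<i> * of_real \<omega>) q
          - rom \<alpha> \<beta> \<gamma> (A, B, C) (\<i> * of_real \<omega>) q = t *\<^sub>R cscale (?\<kappa>t t (q, \<omega>)) (N q) \<and>
         norm (?\<kappa>t t (q, \<omega>)) \<le> (2 * L + 2 * L\<^sup>2) * norm (kernel l (q, \<omega>)) \<and>
         norm (?\<kappa>t t (q, \<omega>) - z * ?\<kappa> (q, \<omega>)) \<le> \<bar>t\<bar> * ((2 * L + 2 * L\<^sup>2) * norm (kernel l (q, \<omega>))))"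
      using stable L(2)
    proof eventually_elim
      case (elim q)
      have st: "Re (pole m q) < 0" for m using elim by blast
      have al: "\<bar>\<alpha> k q\<bar> \<le> L * \<bar>Re (pole l q)\<bar>" using elim by blast
      note pp = pole_perturbation[OF al L(1) st _ z t]
      have s0: "Re (\<i> * of_real \<omega>) = 0" for \<omega> by simp
      have ne: "\<i> * of_real \<omega> \<noteq> pole m q" for m \<omega> using st[of m] by (auto simp: complex_eq_iff)
      have ne': "\<i> * of_real \<omega> \<noteq> param_sum \<alpha> (A + t *\<^sub>R ?E) q $ m $ m" for m \<omega>
        unfolding pole' using ne pp(3)[OF s0] by simp
      have st': "Re (param_sum \<alpha> (A + t *\<^sub>R ?E) q $ m $ m) < 0" for m
        unfolding pole' using st pp(1)[OF s0] by simp
      have kern: "kernel l (q, \<omega>) = 1 / (\<i> * of_real \<omega> - pole l q)" for \<omega> by (simp add: kernel_def)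
      have "rom \<alpha> \<beta> \<gamma> (A + t *\<^sub>R ?E, B, C) (\<i> * of_real \<omega>) q - rom \<alpha> \<beta> \<gamma> (A, B, C) (\<i> * of_real \<omega>) q
        = t *\<^sub>R cscale (?\<kappa>t t (q, \<omega>)) (N q)" for \<omega>
      proof -
        have "rom \<alpha> \<beta> \<gamma> (A + t *\<^sub>R ?E, B, C) (\<i> * of_real \<omega>) q - rom \<alpha> \<beta> \<gamma> (A, B, C) (\<i> * of_real \<omega>) q
          = cscale (1 / (\<i> * of_real \<omega> - ?p' t q)) (N q) - cscale (1 / (\<i> * of_real \<omega> - pole l q)) (N q)"
          by (subst rom_difference_one_pole[where l = l, OF diag diag' ne ne' _ refl]) (simp_all add: pole' N_def)
        also have "\<dots> = cscale (1 / (\<i> * of_real \<omega> - ?p' t q) - 1 / (\<i> * of_real \<omega> - pole l q)) (N q)"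
          by (simp add: vec_eq_iff left_diff_distrib)
        also have "\<dots> = t *\<^sub>R cscale (?\<kappa>t t (q, \<omega>)) (N q)"
          unfolding pp(4)[OF s0] scaleR_cscale by simp
        finally show ?thesis .
      qed
      moreover have "norm (?\<kappa>t t (q, \<omega>)) \<le> (2 * L + 2 * L\<^sup>2) * norm (kernel l (q, \<omega>))" for \<omega>
      proof -
        have "norm (?\<kappa>t t (q, \<omega>)) \<le> 2 * L * norm (kernel l (q, \<omega>))" using pp(5)[OF s0] by (simp add: kern)
        also have "\<dots> \<le> (2 * L + 2 * L\<^sup>2) * norm (kernel l (q, \<omega>))" using L(1) by (intro mult_right_mono) auto
        finally show ?thesis .
      qed
      moreover have "norm (?\<kappa>t t (q, \<omega>) - z * ?\<kappa> (q, \<omega>)) \<le> \<bar>t\<bar> * ((2 * L + 2 * L\<^sup>2) * norm (kernel l (q, \<omega>)))" for \<omega>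
      proof -
        have "norm (?\<kappa>t t (q, \<omega>) - z * ?\<kappa> (q, \<omega>)) \<le> \<bar>t\<bar> * (2 * L\<^sup>2 * norm (kernel l (q, \<omega>)))"
          using pp(6)[OF s0] by (simp add: kern)
        also have "\<dots> \<le> \<bar>t\<bar> * ((2 * L + 2 * L\<^sup>2) * norm (kernel l (q, \<omega>)))" using L(1) by (intro mult_left_mono mult_right_mono) auto
        finally show ?thesis .
      qed
      ultimately show ?case using st' by simp
    qed
  qed (use N K L(1) in auto)
  then show "- (2 * pi) * Re (cnj z * (\<integral>q. (\<Sum>i\<in>UNIV. \<Sum>j\<in>UNIV. cnj (N q $ i $ j) *
      (\<alpha> k q *\<^sub>R matrix_deriv (\<lambda>s. err s q) (- cnj (pole l q))) $ i $ j) \<partial>completion \<nu>)) = 0"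
    unfolding derivative_pairing(2)[OF err_h2l2 N K] .
qed simp

end

section \<open>Interpolation conditions\<close>

theorem theorem3p2:
  fixes Q :: "(real^'q) set" and \<nu> :: "(real^'q) measure"
    and E A :: "real^'q \<Rightarrow> complex^'n^'n"
    and B :: "real^'q \<Rightarrow> complex^'i^'n" and C :: "real^'q \<Rightarrow> complex^'n^'o"
    and H Hhat :: "complex \<Rightarrow> real^'q \<Rightarrow> complex^'i^'o"
    and \<alpha> :: "'a::finite \<Rightarrow> real^'q \<Rightarrow> real"
    and \<beta> :: "'b::finite \<Rightarrow> real^'q \<Rightarrow> real"
    and \<gamma> :: "'c::finite \<Rightarrow> real^'q \<Rightarrow> real"
    and Ah :: "(complex^'r^'r)^'a" and Bh :: "(complex^'i^'r)^'b" and Ch :: "(complex^'r^'o)^'c"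
    and Ahat :: "real^'q \<Rightarrow> complex^'r^'r"
    and Bhat :: "real^'q \<Rightarrow> complex^'i^'r"
    and Chat :: "real^'q \<Rightarrow> complex^'r^'o"
    and lam :: "'r \<Rightarrow> real^'q \<Rightarrow> complex"
    and c :: "'r \<Rightarrow> real^'q \<Rightarrow> complex^'o" and b :: "'r \<Rightarrow> real^'q \<Rightarrow> complex^'i"
  assumes space: "space \<nu> = Q"
    and H_tf: "is_transfer_function Q E A B C H"
    and H_h2l2: "H \<in> h2l2 \<nu>"
    and meas_\<alpha>: "\<And>k. \<alpha> k \<in> borel_measurable \<nu>"
    and meas_\<beta>: "\<And>k. \<beta> k \<in> borel_measurable \<nu>"
    and meas_\<gamma>: "\<And>k. \<gamma> k \<in> borel_measurable \<nu>"
    and diag: "\<And>k. diagonal_matrix (Ah $ k)"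
    and Ahat: "Ahat = param_sum \<alpha> Ah"
    and Bhat: "Bhat = param_sum \<beta> Bh"
    and Chat: "Chat = param_sum \<gamma> Ch"
    and Hhat: "Hhat = (\<lambda>s q. Chat q ** matrix_inv (mat s - Ahat q) ** Bhat q)"
    and lam: "lam = (\<lambda>l q. Ahat q $ l $ l)"
    and c: "c = (\<lambda>l q. Chat q *v axis l 1)"
    and b: "b = (\<lambda>l q. conj_transpose (Bhat q) *v axis l 1)"
    and integrability:
      "integrable \<nu> (\<lambda>q. ((\<Sum>j\<in>UNIV. \<bar>\<beta> j q\<bar>) * (\<Sum>k\<in>UNIV. \<bar>\<gamma> k q\<bar>))\<^sup>2 / (\<Sum>k\<in>UNIV. \<bar>\<alpha> k q\<bar>))"
    and bounded1:
      "esssup \<nu> (\<lambda>q. esssup lborel (\<lambda>\<omega>. ennreal (onorm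
         ((*v) (mat (\<i> * of_real \<omega>) ** matrix_inv (mat (\<i> * of_real \<omega>) - Ahat q)))))) < \<infinity>"
    and bounded2:
      "\<And>k. esssup \<nu> (\<lambda>q. ennreal \<bar>\<alpha> k q\<bar> * esssup lborel (\<lambda>\<omega>. ennreal (onorm
         ((*v) (matrix_inv (mat (\<i> * of_real \<omega>) - Ahat q)))))) < \<infinity>"
    and stable: "AE q in \<nu>. \<forall>l. Re (lam l q) < 0"
    and optimal: "optimal_dstrom \<nu> \<alpha> \<beta> \<gamma> H (Ah, Bh, Ch)"
  shows
    "(\<forall>q\<in>Q. \<forall>s. (\<forall>l. s \<noteq> lam l q) \<longrightarrow>
        Hhat s q = (\<Sum>l\<in>UNIV. (\<chi> i j. c l q $ i * cnj (b l q $ j) / (s - lam l q)))) \<and>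
     (\<forall>l k. integrals_agree \<nu>
        (\<lambda>q. \<gamma> k q *\<^sub>R (H (- cnj (lam l q)) q *v b l q))
        (\<lambda>q. \<gamma> k q *\<^sub>R (Hhat (- cnj (lam l q)) q *v b l q))) \<and>
     (\<forall>l j. integrals_agree \<nu>
        (\<lambda>q. \<beta> j q *\<^sub>R (vcnj (c l q) v* H (- cnj (lam l q)) q))
        (\<lambda>q. \<beta> j q *\<^sub>R (vcnj (c l q) v* Hhat (- cnj (lam l q)) q))) \<and>
     (\<forall>l i. integrals_agree \<nu>
        (\<lambda>q. \<alpha> i q *\<^sub>R scalar_product (vcnj (c l q))
                (matrix_deriv (\<lambda>s. H s q) (- cnj (lam l q)) *v b l q))
        (\<lambda>q. \<alpha> i q *\<^sub>R scalar_product (vcnj (c l q))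
                (matrix_deriv (\<lambda>s. Hhat s q) (- cnj (lam l q)) *v b l q)))"
proof -
  have pole: "lam l q = param_sum \<alpha> Ah q $ l $ l" for l q by (simp add: lam Ahat)
  have c_nth: "c l q $ i = param_sum \<gamma> Ch q $ i $ l" for l q i
    by (simp add: c Chat matrix_vector_mult_def axis_def if_distrib[where f="\<lambda>x. _ * x"] cong: if_cong)
  have b_nth: "b l q $ j = cnj (param_sum \<beta> Bh q $ l $ j)" for l q j
    by (simp add: b Bhat conj_transpose_def matrix_vector_mult_def axis_def if_distrib[where f="\<lambda>x. _ * x"] cong: if_cong)
  have stab: "AE q in \<nu>. \<forall>l. Re (param_sum \<alpha> Ah q $ l $ l) < 0" using stable by (simp add: pole)
  obtain L where L: "0 < L" "AE q in \<nu>. \<forall>k l. \<bar>\<alpha> k q\<bar> \<le> L * \<bar>Re (param_sum \<alpha> Ah q $ l $ l)\<bar>"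
    using coefficients_bounded_by_decay[OF diag bounded2[unfolded Ahat] stab] by blast
  interpret optimal_rom \<nu> \<alpha> \<beta> \<gamma> H Ah Bh Ch L
    by unfold_locales (use H_h2l2 meas_\<alpha> meas_\<beta> meas_\<gamma> diag integrability L stab optimal in auto)
  have Hhat_eq: "Hhat s q = H s q - err s q" for s q
    by (simp add: err_def rom_eq Hhat Ahat Bhat Chat)
  have expansion: "Hhat s q = (\<Sum>l\<in>UNIV. (\<chi> i j. c l q $ i * cnj (b l q $ j) / (s - lam l q)))"
    if "\<forall>l. s \<noteq> lam l q" for s q
  proof -
    have "Hhat s q = rom \<alpha> \<beta> \<gamma> (Ah, Bh, Ch) s q" by (simp add: rom_eq Hhat Ahat Bhat Chat)
    also have "\<dots> = (\<Sum>l\<in>UNIV. (\<chi> i j. c l q $ i * cnj (b l q $ j) / (s - lam l q)))"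
      using that by (subst rom_expansion[OF diag]) (simp_all add: pole vec_eq_iff c_nth b_nth)
    finally show ?thesis .
  qed
  have right_tangential: "integrals_agree \<nu>
        (\<lambda>q. \<gamma> k q *\<^sub>R (H (- cnj (lam l q)) q *v b l q))
        (\<lambda>q. \<gamma> k q *\<^sub>R (Hhat (- cnj (lam l q)) q *v b l q))" for l k
  proof (rule integrals_agree_vec)
    fix m :: 'o
    let ?N = "\<lambda>q. \<gamma> k q *\<^sub>R rank_one l (unit_matrix m l) (param_sum \<beta> Bh q)"
    have entry: "(\<gamma> k q *\<^sub>R (F *v b l q)) $ m = (\<Sum>i\<in>UNIV. \<Sum>j\<in>UNIV. cnj (?N q $ i $ j) * F $ i $ j)" for F q
    proof -
      have "(\<Sum>j\<in>UNIV. cnj (?N q $ i $ j) * F $ i $ j) = (if i = m then (\<gamma> k q *\<^sub>R (F *v b l q)) $ m else 0)" for i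
        by (simp add: rank_one_unit_left del: rank_one_nth)
          (simp add: matrix_vector_mult_def b_nth sum_distrib_left scaleR_conv_of_real[where 'a=complex] ac_simps)
      then show ?thesis by simp
    qed
    note N = residue_directions_measurable(1)[where k = k and l = l and m = m]
      residue_directions_le(1)[where k = k and l = l and m = m]
    have K: "0 \<le> norm (unit_matrix m l :: complex^'r^'o) * (\<Sum>j\<in>UNIV. norm (Bh $ j))"
      by (intro mult_nonneg_nonneg sum_nonneg) auto
    show "integrals_agree \<nu> (\<lambda>q. (\<gamma> k q *\<^sub>R (H (- cnj (lam l q)) q *v b l q)) $ m)
        (\<lambda>q. (\<gamma> k q *\<^sub>R (Hhat (- cnj (lam l q)) q *v b l q)) $ m)"
      unfolding entry pole
      by (rule integrals_agree_diff[OF resolvent_pairing(1)[OF H N K] resolvent_pairing(1)[OF err_h2l2 N K] stationary_output])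
        (simp add: Hhat_eq right_diff_distrib sum_subtractf)
  qed
  have left_tangential: "integrals_agree \<nu>
        (\<lambda>q. \<beta> j q *\<^sub>R (vcnj (c l q) v* H (- cnj (lam l q)) q))
        (\<lambda>q. \<beta> j q *\<^sub>R (vcnj (c l q) v* Hhat (- cnj (lam l q)) q))" for l j
  proof (rule integrals_agree_vec)
    fix n :: 'i
    let ?N = "\<lambda>q. \<beta> j q *\<^sub>R rank_one l (param_sum \<gamma> Ch q) (unit_matrix l n)"
    have entry: "(\<beta> j q *\<^sub>R (vcnj (c l q) v* F)) $ n = (\<Sum>i\<in>UNIV. \<Sum>j\<in>UNIV. cnj (?N q $ i $ j) * F $ i $ j)" for F q
    proof -
      have "(\<Sum>j'\<in>UNIV. cnj (?N q $ i $ j') * F $ i $ j') = \<beta> j q * (cnj (c l q $ i) * F $ i $ n)" for i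
      proof -
        have "cnj (?N q $ i $ j') * F $ i $ j' = (if j' = n then \<beta> j q * (cnj (c l q $ i) * F $ i $ n) else 0)" for j'
          by (simp add: rank_one_unit_right c_nth scaleR_conv_of_real[where 'a=complex] del: rank_one_nth)
        then show ?thesis by simp
      qed
      then show ?thesis
        by (simp add: vector_matrix_mult_def vcnj_def scaleR_conv_of_real[where 'a=complex] sum_distrib_left)
    qed
    note N = residue_directions_measurable(2)[where j = j and l = l and n = n]
      residue_directions_le(2)[where j = j and l = l and n = n]
    have K: "0 \<le> (\<Sum>k\<in>UNIV. norm (Ch $ k)) * norm (unit_matrix l n :: complex^'i^'r)"
      by (intro mult_nonneg_nonneg sum_nonneg) auto
    show "integrals_agree \<nu> (\<lambda>q. (\<beta> j q *\<^sub>R (vcnj (c l q) v* H (- cnj (lam l q)) q)) $ n)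
        (\<lambda>q. (\<beta> j q *\<^sub>R (vcnj (c l q) v* Hhat (- cnj (lam l q)) q)) $ n)"
      unfolding entry pole
      by (rule integrals_agree_diff[OF resolvent_pairing(1)[OF H N K] resolvent_pairing(1)[OF err_h2l2 N K] stationary_input])
        (simp add: Hhat_eq right_diff_distrib sum_subtractf)
  qed
  have bitangential: "integrals_agree \<nu>
        (\<lambda>q. \<alpha> i q *\<^sub>R scalar_product (vcnj (c l q))
                (matrix_deriv (\<lambda>s. H s q) (- cnj (lam l q)) *v b l q))
        (\<lambda>q. \<alpha> i q *\<^sub>R scalar_product (vcnj (c l q))
                (matrix_deriv (\<lambda>s. Hhat s q) (- cnj (lam l q)) *v b l q))" for l i
  proof -
    let ?N = "\<lambda>q. rank_one l (param_sum \<gamma> Ch q) (param_sum \<beta> Bh q)"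
    have form: "\<alpha> i q *\<^sub>R scalar_product (vcnj (c l q)) (F *v b l q)
        = (\<Sum>i'\<in>UNIV. \<Sum>j\<in>UNIV. cnj (?N q $ i' $ j) * (\<alpha> i q *\<^sub>R F) $ i' $ j)" for F q
      by (simp add: scalar_product_def matrix_vector_mult_def vcnj_def c_nth b_nth sum_distrib_left
          scaleR_conv_of_real[where 'a=complex] ac_simps)
    note N = residue_directions_measurable(3)[where l = l] residue_directions_le(3)[where l = l]
    have K: "0 \<le> (\<Sum>k\<in>UNIV. norm (Ch $ k)) * (\<Sum>j\<in>UNIV. norm (Bh $ j))"
      by (intro mult_nonneg_nonneg sum_nonneg) auto
    have deriv: "AE q in \<nu>. matrix_deriv (\<lambda>s. Hhat s q) (- cnj (lam l q)) =
        matrix_deriv (\<lambda>s. H s q) (- cnj (lam l q)) - matrix_deriv (\<lambda>s. err s q) (- cnj (lam l q))"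
      using h2l2_entries[OF H] h2l2_entries[OF err_h2l2] stable
    proof eventually_elim
      case (elim q)
      have d: "(\<lambda>s. F s $ i $ j) field_differentiable at (- cnj (lam l q))"
        if h: "\<exists>K. \<forall>i j. hardy_function (\<lambda>s. F s $ i $ j) K" for F :: "complex \<Rightarrow> complex^'i^'o" and i j
      proof -
        have "(\<lambda>s. F s $ i $ j) holomorphic_on {s. 0 < Re s}" using h by (auto simp: hardy_function_def)
        then show ?thesis
          by (rule holomorphic_on_imp_differentiable_at) (use elim in \<open>auto simp: pole open_halfspace_Re_gt\<close>)
      qed
      show ?case
        by (simp add: matrix_deriv_def vec_eq_iff Hhat_eq deriv_diff[OF d[OF elim(1)] d[OF elim(2)]])
    qed
    show ?thesis
      unfolding form
    proof (rule integrals_agree_diff)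
      show "integrable (completion \<nu>) (\<lambda>q. \<Sum>i'\<in>UNIV. \<Sum>j\<in>UNIV. cnj (?N q $ i' $ j) *
          (\<alpha> i q *\<^sub>R matrix_deriv (\<lambda>s. H s q) (- cnj (lam l q))) $ i' $ j)"
        unfolding pole by (rule derivative_pairing(1)[OF H N K])
      show "integrable (completion \<nu>) (\<lambda>q. \<Sum>i'\<in>UNIV. \<Sum>j\<in>UNIV. cnj (?N q $ i' $ j) *
          (\<alpha> i q *\<^sub>R matrix_deriv (\<lambda>s. err s q) (- cnj (lam l q))) $ i' $ j)"
        unfolding pole by (rule derivative_pairing(1)[OF err_h2l2 N K])
      show "(\<integral>q. (\<Sum>i'\<in>UNIV. \<Sum>j\<in>UNIV. cnj (?N q $ i' $ j) *
          (\<alpha> i q *\<^sub>R matrix_deriv (\<lambda>s. err s q) (- cnj (lam l q))) $ i' $ j) \<partial>completion \<nu>) = 0"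
        unfolding pole by (rule stationary_pole)
      show "AE q in \<nu>. (\<Sum>i'\<in>UNIV. \<Sum>j\<in>UNIV. cnj (?N q $ i' $ j) *
            (\<alpha> i q *\<^sub>R matrix_deriv (\<lambda>s. Hhat s q) (- cnj (lam l q))) $ i' $ j) =
          (\<Sum>i'\<in>UNIV. \<Sum>j\<in>UNIV. cnj (?N q $ i' $ j) * (\<alpha> i q *\<^sub>R matrix_deriv (\<lambda>s. H s q) (- cnj (lam l q))) $ i' $ j) -
          (\<Sum>i'\<in>UNIV. \<Sum>j\<in>UNIV. cnj (?N q $ i' $ j) * (\<alpha> i q *\<^sub>R matrix_deriv (\<lambda>s. err s q) (- cnj (lam l q))) $ i' $ j)"
        using deriv by eventually_elim (simp add: right_diff_distrib sum_subtractf scaleR_diff_right del: rank_one_nth)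
    qed
  qed
  show ?thesis using expansion right_tangential left_tangential bitangential by blast
qed

end
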